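(* Let $(M^3,g)$ be a complete Riemannian three-manifold admitting a static potential $V\in C^\infty(M)$, with scalar curvature $R$. Then $$\frac12\, div\left(V\nabla|\mathring{Ric}|^2\right)=\left(|\nabla\mathring{Ric}|^2+\frac{|C|^2}{2}\right)V+\left(R\,|\mathring{Ric}|^2+18\,det(\mathring{Ric})\right)V .$$
   Context: A static potential on a complete Riemannian manifold $(M,g)$ is a not identically zero $V\in C^\infty(M)$ with $Hess_g V-(\Delta_g V)g-V\,Ric_g=0$, where $\Delta_g=\mathrm{tr}_g Hess_g$. (The existence of $V$ forces $R$ to be constant.) $\mathring{Ric}=Ric-\frac{R}{3}g$ is the trace-free Ricci tensor, and $det(\mathring{Ric})$ is its determinant as an endomorphism of the tangent space (via $g$). $C$ is the Cotton tensor $$C(X,Y,Z)=(\nabla_Z Ric)(X,Y)-(\nabla_Y Ric)(X,Z)-\frac14\left(dR(Z)g(X,Y)-dR(Y)g(X,Z)\right).$$ Norms of tensors are the full ones, e.g. $|C|^2=\sum_{i,j,k}C_{ijk}^2$ in an orthonormal frame. *)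

theory Defs
  imports "HOL-Analysis.Analysis"
begin

section \<open>Smooth functions on open subsets of Euclidean space\<close>

fun C_k_on :: "nat \<Rightarrow> 'a::real_normed_vector set \<Rightarrow> ('a \<Rightarrow> 'b::real_normed_vector) \<Rightarrow> bool" where
  "C_k_on 0 S f \<longleftrightarrow> continuous_on S f"
| "C_k_on (Suc k) S f \<longleftrightarrow>
     (\<forall>x\<in>S. f differentiable (at x)) \<and> (\<forall>v. C_k_on k S (\<lambda>x. frechet_derivative f (at x) v))"

text \<open>For open \<open>S\<close> in a finite-dimensional space, \<open>C_k_on k S f\<close> says that \<open>f\<close> is of class
  \<open>C\<^sup>k\<close> on \<open>S\<close>: all iterated directional derivatives up to order \<open>k\<close> exist and are continuous.\<close>

definition smooth_fun_on :: "'a::real_normed_vector set \<Rightarrow> ('a \<Rightarrow> 'b::real_normed_vector) \<Rightarrow> bool" where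
  "smooth_fun_on S f \<longleftrightarrow> (\<forall>k. C_k_on k S f)"

definition partial :: "'n::finite \<Rightarrow> (real^'n \<Rightarrow> real) \<Rightarrow> real^'n \<Rightarrow> real" where
  "partial i f x = frechet_derivative f (at x) (axis i 1)"


section \<open>Smooth manifolds\<close>

text \<open>The manifold is the whole carrier type \<open>'a\<close>, whose topology is Hausdorff and second
  countable by its type class. A chart is a pair of an open domain and a coordinate map; values of
  the coordinate map outside the domain are irrelevant.\<close>

type_synonym ('a, 'n) chart = "'a set \<times> ('a \<Rightarrow> real^'n)"

abbreviation chart_image :: "('a, 'n::finite) chart \<Rightarrow> (real^'n) set" where
  "chart_image c \<equiv> snd c ` fst c"

abbreviation chart_inv :: "('a, 'n::finite) chart \<Rightarrow> real^'n \<Rightarrow> 'a" where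
  "chart_inv c \<equiv> inv_into (fst c) (snd c)"

definition is_chart :: "('a::topological_space, 'n::finite) chart \<Rightarrow> bool" where
  "is_chart c \<longleftrightarrow> open (fst c) \<and> open (chart_image c)
     \<and> homeomorphism (fst c) (chart_image c) (snd c) (chart_inv c)"

definition transition :: "('a, 'n::finite) chart \<Rightarrow> ('a, 'n) chart \<Rightarrow> real^'n \<Rightarrow> real^'n" where
  "transition c d = snd d \<circ> chart_inv c"

definition smooth_atlas ::
    "('a::{t2_space,second_countable_topology}, 'n::finite) chart set \<Rightarrow> bool" where
  "smooth_atlas A \<longleftrightarrow> (\<forall>c\<in>A. is_chart c) \<and> (\<Union>c\<in>A. fst c) = UNIV
     \<and> (\<forall>c\<in>A. \<forall>d\<in>A. smooth_fun_on (snd c ` (fst c \<inter> fst d)) (transition c d))"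

definition smooth_on_manifold ::
    "('a::{t2_space,second_countable_topology}, 'n::finite) chart set \<Rightarrow> ('a \<Rightarrow> real) \<Rightarrow> bool" where
  "smooth_on_manifold A f \<longleftrightarrow> (\<forall>c\<in>A. smooth_fun_on (chart_image c) (f \<circ> chart_inv c))"


section \<open>Riemannian metrics\<close>

text \<open>A metric is a covariant 2-tensor field, given by its matrix of components
  \<open>g\<^sub>i\<^sub>j = g(\<partial>\<^sub>i, \<partial>\<^sub>j)\<close> in each chart as a function of the coordinates of that chart, where the
  components in different charts are related by the tensor transformation law.\<close>

type_synonym 'n field2 = "real^'n \<Rightarrow> real^'n^'n"

definition riemannian_metric ::
    "('a::{t2_space,second_countable_topology}, 'n::finite) chart set
      \<Rightarrow> (('a, 'n) chart \<Rightarrow> 'n field2) \<Rightarrow> bool" where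
  "riemannian_metric A g \<longleftrightarrow>
     (\<forall>c\<in>A. smooth_fun_on (chart_image c) (g c)
        \<and> (\<forall>x\<in>chart_image c. transpose (g c x) = g c x \<and> (\<forall>v. v \<noteq> 0 \<longrightarrow> v \<bullet> (g c x *v v) > 0)))
     \<and> (\<forall>c\<in>A. \<forall>d\<in>A. \<forall>p \<in> fst c \<inter> fst d.
          let J = matrix (frechet_derivative (transition c d) (at (snd c p)))
          in g c (snd c p) = transpose J ** g d (snd d p) ** J)"


section \<open>Curvature in local coordinates\<close>

text \<open>In this section \<open>G\<close> is the component matrix of a metric in one chart.\<close>

definition Ginv :: "'n::finite field2 \<Rightarrow> 'n field2" where
  "Ginv G x = matrix_inv (G x)"

text \<open>\<open>christoffel G k i j\<close> is \<open>\<Gamma>\<^sup>k\<^sub>i\<^sub>j\<close>, the symbols of the Levi-Civita connection.\<close>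

definition christoffel :: "'n::finite field2 \<Rightarrow> 'n \<Rightarrow> 'n \<Rightarrow> 'n \<Rightarrow> real^'n \<Rightarrow> real" where
  "christoffel G k i j x = (1/2) * (\<Sum>l\<in>UNIV. Ginv G x $ k $ l *
     (partial i (\<lambda>y. G y $ j $ l) x + partial j (\<lambda>y. G y $ i $ l) x - partial l (\<lambda>y. G y $ i $ j) x))"

text \<open>\<open>riem G l k i j\<close> is \<open>R\<^sup>l\<^sub>k\<^sub>i\<^sub>j\<close> with \<open>R(\<partial>\<^sub>i,\<partial>\<^sub>j)\<partial>\<^sub>k = R\<^sup>l\<^sub>k\<^sub>i\<^sub>j \<partial>\<^sub>l\<close> and
  \<open>R(X,Y) = [\<nabla>\<^sub>X,\<nabla>\<^sub>Y] - \<nabla>\<^sub>[\<^sub>X\<^sub>,\<^sub>Y\<^sub>]\<close>; \<open>Ric(Y,Z)\<close> is the trace of \<open>X \<mapsto> R(X,Y)Z\<close>, so that round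
  spheres have positive Ricci curvature.\<close>

definition riem :: "'n::finite field2 \<Rightarrow> 'n \<Rightarrow> 'n \<Rightarrow> 'n \<Rightarrow> 'n \<Rightarrow> real^'n \<Rightarrow> real" where
  "riem G l k i j x =
     partial i (christoffel G l j k) x - partial j (christoffel G l i k) x
     + (\<Sum>m\<in>UNIV. christoffel G l i m x * christoffel G m j k x
               - christoffel G l j m x * christoffel G m i k x)"

definition ricci :: "'n::finite field2 \<Rightarrow> 'n field2" where
  "ricci G x = (\<chi> j k. \<Sum>i\<in>UNIV. riem G i k i j x)"

definition metric_trace :: "'n::finite field2 \<Rightarrow> 'n field2 \<Rightarrow> real^'n \<Rightarrow> real" where
  "metric_trace G T x = (\<Sum>i\<in>UNIV. \<Sum>j\<in>UNIV. Ginv G x $ i $ j * T x $ i $ j)"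

definition scalar_curv :: "'n::finite field2 \<Rightarrow> real^'n \<Rightarrow> real" where
  "scalar_curv G = metric_trace G (ricci G)"

definition hess :: "'n::finite field2 \<Rightarrow> (real^'n \<Rightarrow> real) \<Rightarrow> 'n field2" where
  "hess G f x = (\<chi> i j. partial i (partial j f) x - (\<Sum>k\<in>UNIV. christoffel G k i j x * partial k f x))"

definition laplacian :: "'n::finite field2 \<Rightarrow> (real^'n \<Rightarrow> real) \<Rightarrow> real^'n \<Rightarrow> real" where
  "laplacian G f = metric_trace G (hess G f)"

definition grad :: "'n::finite field2 \<Rightarrow> (real^'n \<Rightarrow> real) \<Rightarrow> real^'n \<Rightarrow> real^'n" where
  "grad G f x = (\<chi> i. \<Sum>j\<in>UNIV. Ginv G x $ i $ j * partial j f x)"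

definition divergence :: "'n::finite field2 \<Rightarrow> (real^'n \<Rightarrow> real^'n) \<Rightarrow> real^'n \<Rightarrow> real" where
  "divergence G X x = (\<Sum>i\<in>UNIV. partial i (\<lambda>y. X y $ i) x
     + (\<Sum>j\<in>UNIV. christoffel G i i j x * X x $ j))"

text \<open>\<open>cov_deriv G T i j k\<close> is \<open>(\<nabla>\<^sub>k T)\<^sub>i\<^sub>j\<close>: the direction of differentiation comes last.\<close>

definition cov_deriv :: "'n::finite field2 \<Rightarrow> 'n field2 \<Rightarrow> 'n \<Rightarrow> 'n \<Rightarrow> 'n \<Rightarrow> real^'n \<Rightarrow> real" where
  "cov_deriv G T i j k x = partial k (\<lambda>y. T y $ i $ j) x
     - (\<Sum>l\<in>UNIV. christoffel G l k i x * T x $ l $ j + christoffel G l k j x * T x $ i $ l)"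

text \<open>Squared full norms of covariant 2- and 3-tensors, in arbitrary coordinates.\<close>

definition norm2_sq :: "'n::finite field2 \<Rightarrow> 'n field2 \<Rightarrow> real^'n \<Rightarrow> real" where
  "norm2_sq G T x = (\<Sum>i\<in>UNIV. \<Sum>j\<in>UNIV. \<Sum>a\<in>UNIV. \<Sum>b\<in>UNIV.
     Ginv G x $ i $ a * Ginv G x $ j $ b * T x $ i $ j * T x $ a $ b)"

definition norm3_sq ::
    "'n::finite field2 \<Rightarrow> ('n \<Rightarrow> 'n \<Rightarrow> 'n \<Rightarrow> real^'n \<Rightarrow> real) \<Rightarrow> real^'n \<Rightarrow> real" where
  "norm3_sq G T x = (\<Sum>i\<in>UNIV. \<Sum>j\<in>UNIV. \<Sum>k\<in>UNIV. \<Sum>a\<in>UNIV. \<Sum>b\<in>UNIV. \<Sum>c\<in>UNIV.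
     Ginv G x $ i $ a * Ginv G x $ j $ b * Ginv G x $ k $ c * T i j k x * T a b c x)"

text \<open>The determinant of the endomorphism \<open>T\<^sup>i\<^sub>j = g\<^sup>i\<^sup>k T\<^sub>k\<^sub>j\<close> associated with \<open>T\<close>.\<close>

definition endo_det :: "'n::finite field2 \<Rightarrow> 'n field2 \<Rightarrow> real^'n \<Rightarrow> real" where
  "endo_det G T x = det (Ginv G x ** T x)"


subsection \<open>Dimension three\<close>

definition tracefree_ricci :: "3 field2 \<Rightarrow> 3 field2" where
  "tracefree_ricci G x = ricci G x - (scalar_curv G x / 3) *\<^sub>R G x"

text \<open>\<open>cotton G i j k\<close> is \<open>C(\<partial>\<^sub>i,\<partial>\<^sub>j,\<partial>\<^sub>k)\<close>.\<close>

definition cotton :: "3 field2 \<Rightarrow> 3 \<Rightarrow> 3 \<Rightarrow> 3 \<Rightarrow> real^3 \<Rightarrow> real" where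
  "cotton G i j k x = cov_deriv G (ricci G) i j k x - cov_deriv G (ricci G) i k j x
     - (1/4) * (partial k (scalar_curv G) x * G x $ i $ j - partial j (scalar_curv G) x * G x $ i $ k)"


section \<open>Completeness\<close>

definition geodesic ::
    "('a::{t2_space,second_countable_topology}, 'n::finite) chart set
      \<Rightarrow> (('a, 'n) chart \<Rightarrow> 'n field2) \<Rightarrow> (real \<Rightarrow> 'a) \<Rightarrow> bool" where
  "geodesic A g \<gamma> \<longleftrightarrow> continuous_on UNIV \<gamma> \<and>
     (\<forall>c\<in>A. \<forall>t. \<gamma> t \<in> fst c \<longrightarrow>
        (let x = snd c \<circ> \<gamma>; x' = (\<lambda>s. vector_derivative x (at s)) in
          x differentiable (at t) \<and>
          (x' has_vector_derivative
             (\<chi> k. - (\<Sum>i\<in>UNIV. \<Sum>j\<in>UNIV. christoffel (g c) k i j (x t) * x' t $ i * x' t $ j))) (at t)))"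

text \<open>Geodesic completeness: through every point, in every direction, there is a geodesic defined
  for all times.\<close>

definition complete_metric ::
    "('a::{t2_space,second_countable_topology}, 'n::finite) chart set
      \<Rightarrow> (('a, 'n) chart \<Rightarrow> 'n field2) \<Rightarrow> bool" where
  "complete_metric A g \<longleftrightarrow> (\<forall>c\<in>A. \<forall>p\<in>fst c. \<forall>v. \<exists>\<gamma>. geodesic A g \<gamma> \<and> \<gamma> 0 = p
     \<and> ((snd c \<circ> \<gamma>) has_vector_derivative v) (at 0))"


section \<open>Static potentials\<close>

definition static_potential ::
    "('a::{t2_space,second_countable_topology}, 'n::finite) chart set
      \<Rightarrow> (('a, 'n) chart \<Rightarrow> 'n field2) \<Rightarrow> ('a \<Rightarrow> real) \<Rightarrow> bool" where
  "static_potential A g V \<longleftrightarrow> smooth_on_manifold A V \<and> (\<exists>p. V p \<noteq> 0) \<and>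
     (\<forall>c\<in>A. \<forall>x\<in>chart_image c.
        let v = V \<circ> chart_inv c in
          hess (g c) v x - laplacian (g c) v x *\<^sub>R g c x - v x *\<^sub>R ricci (g c) x = 0)"

end

theory Submission
  imports Defs
begin

text \<open>Write \<open>E\<close> for the trace-free Ricci tensor and \<open>C\<^sub>i\<^sub>j\<^sub>k = \<nabla>\<^sub>kE\<^sub>i\<^sub>j - \<nabla>\<^sub>jE\<^sub>i\<^sub>k\<close>, which is the Cotton
  tensor where \<open>dR = 0\<close>. The left hand side of the formula is
  \<open>\<langle>\<nabla>\<^sub>\<nabla>\<^sub>V E, E\<rangle> + V |\<nabla>E|\<^sup>2 + V \<langle>E, \<Delta>E\<rangle>\<close>, so everything depends on \<open>V \<langle>E, \<Delta>E\<rangle>\<close>.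

  The trace of the static equation gives \<open>\<Delta>V = - R V / 2\<close>, hence \<open>Hess V = V (E - R/6 g)\<close> (\<open>D1_dv\<close>).
  Differentiating once more and commuting derivatives of \<open>dV\<close> expresses \<open>V C\<close> by the curvature applied
  to \<open>\<nabla>V\<close>. In dimension three the curvature tensor is an explicit linear function of \<open>E\<close> and \<open>R\<close>
  (\<open>Rm_dim3\<close>), and one obtains
  \<open>V C\<^sub>i\<^sub>j\<^sub>k = W\<^sub>j g\<^sub>i\<^sub>k - W\<^sub>k g\<^sub>i\<^sub>j + 2 E\<^sub>i\<^sub>k V\<^sub>j - 2 E\<^sub>i\<^sub>j V\<^sub>k\<close> with \<open>W = E(\<nabla>V)\<close> (\<open>static_cotton\<close>); on the way the trace
  of the identity and the contracted Bianchi identity yield \<open>V dR = 0\<close> (\<open>v_dR\<close>).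

  The divergence in \<open>k\<close> of this formula for \<open>V C\<close>, contracted with \<open>E\<close>, contains
  \<open>V \<langle>E, \<Delta>E\<rangle>\<close> together with \<open>V E\<^sub>i\<^sub>j \<nabla>\<^sub>k\<nabla>\<^sub>jE\<^sub>i\<^sub>k\<close>. Interchanging the derivatives in the latter leaves only
  curvature terms, as \<open>E\<close> is divergence-free; they are cubic in \<open>E\<close> apart from a multiple of \<open>R |E|\<^sup>2\<close>, and
  \<open>tr E\<^sup>3 = 3 det E\<close> because \<open>E\<close> is trace-free. The first-order terms assemble to a multiple of
  \<open>E\<^sub>i\<^sub>j V\<^sub>k C\<^sub>i\<^sub>j\<^sub>k\<close>, which by the formula for \<open>V C\<close> is \<open>- V |C|\<^sup>2 / 4\<close>. This bookkeeping is
  \<open>static_algebra_dim3\<close>, and \<open>bochner_static\<close> combines it with Bochner's formula for \<open>|E|\<^sup>2\<close>.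

  Zeros of \<open>V\<close> need no separate limit argument. If \<open>V\<close> and \<open>dV\<close> vanish at a point, both sides vanish there;
  otherwise \<open>V dR = 0\<close> and its derivative force \<open>dR = 0\<close> at the point, and the computation above only uses
  the derivative of \<open>dR\<close> multiplied by \<open>V\<close>.

  All statements are local. They are proved in a fixed chart with covariant derivatives of
  tensor fields given by their components, and the purely algebraic steps are carried out in an
  orthonormal basis of one tangent space.\<close>

section \<open>Calculus of smooth functions on an open set\<close>

lemma frechet_derivativeI:
  "(f has_derivative f') (at x) \<Longrightarrow> frechet_derivative f (at x) v = f' v"
  using frechet_derivative_at by metis

lemma C_k_on_cong:
  assumes "open S" "\<And>x. x \<in> S \<Longrightarrow> f x = g x" "C_k_on k S f"
  shows "C_k_on k S g"
  using assms(2,3)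
proof (induction k arbitrary: f g)
  case 0
  then show ?case using continuous_on_cong by force
next
  case (Suc k)
  have d: "g differentiable (at x)" "frechet_derivative f (at x) = frechet_derivative g (at x)"
    if "x \<in> S" for x
  proof -
    have f: "f differentiable (at x)" using Suc.prems(2) that by simp
    show "frechet_derivative f (at x) = frechet_derivative g (at x)"
      by (rule frechet_derivative_transform_within_open[OF f \<open>open S\<close> that Suc.prems(1)])
    obtain f' where "(f has_derivative f') (at x)" using f unfolding differentiable_def by blast
    then have "(g has_derivative f') (at x)"
      by (rule has_derivative_transform_within_open[OF _ \<open>open S\<close> that Suc.prems(1)])
    then show "g differentiable (at x)" unfolding differentiable_def by blast
  qed
  have "C_k_on k S (\<lambda>x. frechet_derivative g (at x) v)" for v
    using Suc.IH[of "\<lambda>x. frechet_derivative f (at x) v"] Suc.prems(2) d(2) by simp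
  then show ?case using d(1) by simp
qed

lemma C_k_on_Suc_lower: "C_k_on (Suc k) S f \<Longrightarrow> C_k_on k S f"
proof (induction k arbitrary: f)
  case 0
  then show ?case
    by (auto intro!: continuous_at_imp_continuous_on differentiable_imp_continuous_within)
next
  case (Suc k)
  from Suc.prems have d: "\<forall>x\<in>S. f differentiable (at x)"
    and h: "\<And>v. C_k_on (Suc k) S (\<lambda>x. frechet_derivative f (at x) v)"
    using C_k_on.simps(2) by blast+
  from d Suc.IH[OF h] show ?case unfolding C_k_on.simps(2) by blast
qed

text \<open>Closure properties of the class \<open>C\<^sup>k\<close> all follow the same pattern: the derivative of
  the compound function is again built by operations under which \<open>C\<^sup>k\<close> is already known to be
  closed at the previous order.\<close>

lemma C_k_on_SucI:
  assumes "open S" "\<And>x. x \<in> S \<Longrightarrow> (f has_derivative f' x) (at x)"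
    "\<And>v. C_k_on k S (\<lambda>x. f' x v)"
  shows "C_k_on (Suc k) S f"
proof -
  have "C_k_on k S (\<lambda>x. frechet_derivative f (at x) v)" for v
    by (rule C_k_on_cong[OF assms(1) _ assms(3)[of v]])
       (simp add: frechet_derivativeI[OF assms(2)])
  then show ?thesis using assms(2) unfolding C_k_on.simps differentiable_def by blast
qed

lemma C_k_on_SucD:
  assumes "C_k_on (Suc k) S f"
  shows "x \<in> S \<Longrightarrow> (f has_derivative frechet_derivative f (at x)) (at x)"
    "C_k_on k S (\<lambda>x. frechet_derivative f (at x) v)"
proof -
  have "\<forall>x\<in>S. f differentiable (at x)" "\<forall>v. C_k_on k S (\<lambda>x. frechet_derivative f (at x) v)"
    using assms C_k_on.simps(2) by blast+
  then show "x \<in> S \<Longrightarrow> (f has_derivative frechet_derivative f (at x)) (at x)"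
    "C_k_on k S (\<lambda>x. frechet_derivative f (at x) v)"
    using frechet_derivative_works by blast+
qed

lemma C_k_on_const:
  fixes c :: "'b::real_normed_vector"
  assumes S: "open S"
  shows "C_k_on k S (\<lambda>_. c)"
proof (induction k arbitrary: c)
  case (Suc k)
  show ?case
  proof (rule C_k_on_SucI[where f' = "\<lambda>_ _. 0", OF S])
    show "C_k_on k S (\<lambda>_. 0::'b)" by (rule Suc.IH)
  qed simp
qed simp

lemma C_k_on_add:
  assumes S: "open S"
  shows "C_k_on k S f \<Longrightarrow> C_k_on k S g \<Longrightarrow> C_k_on k S (\<lambda>x. f x + g x)"
proof (induction k arbitrary: f g)
  case 0
  then show ?case by (simp add: continuous_on_add)
next
  case (Suc k)
  note f = C_k_on_SucD[OF Suc.prems(1)] and g = C_k_on_SucD[OF Suc.prems(2)]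
  let ?f' = "\<lambda>x. frechet_derivative f (at x)" and ?g' = "\<lambda>x. frechet_derivative g (at x)"
  show ?case
  proof (rule C_k_on_SucI[where f' = "\<lambda>x v. ?f' x v + ?g' x v", OF S])
    show "((\<lambda>x. f x + g x) has_derivative (\<lambda>v. ?f' x v + ?g' x v)) (at x)" if "x \<in> S" for x
      by (rule has_derivative_add[OF f(1)[OF that] g(1)[OF that]])
    show "C_k_on k S (\<lambda>x. ?f' x v + ?g' x v)" for v
      by (rule Suc.IH[OF f(2) g(2)])
  qed
qed

lemma C_k_on_linear:
  assumes L: "bounded_linear L" and S: "open S"
  shows "C_k_on k S f \<Longrightarrow> C_k_on k S (\<lambda>x. L (f x))"
proof (induction k arbitrary: f)
  case 0
  then show ?case using bounded_linear.continuous_on[OF L] by simp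
next
  case (Suc k)
  note f = C_k_on_SucD[OF Suc.prems]
  let ?f' = "\<lambda>x. frechet_derivative f (at x)"
  show ?case
  proof (rule C_k_on_SucI[where f' = "\<lambda>x v. L (?f' x v)", OF S])
    show "((\<lambda>x. L (f x)) has_derivative (\<lambda>v. L (?f' x v))) (at x)" if "x \<in> S" for x
      by (rule bounded_linear.has_derivative[OF L f(1)[OF that]])
    show "C_k_on k S (\<lambda>x. L (?f' x v))" for v
      by (rule Suc.IH[OF f(2)])
  qed
qed

lemma C_k_on_mult:
  fixes f g :: "'a::real_normed_vector \<Rightarrow> real"
  assumes S: "open S"
  shows "C_k_on k S f \<Longrightarrow> C_k_on k S g \<Longrightarrow> C_k_on k S (\<lambda>x. f x * g x)"
proof (induction k arbitrary: f g)
  case 0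
  then show ?case by (simp add: continuous_on_mult)
next
  case (Suc k)
  note f = C_k_on_SucD[OF Suc.prems(1)] and g = C_k_on_SucD[OF Suc.prems(2)]
  note lower = Suc.prems[THEN C_k_on_Suc_lower]
  let ?f' = "\<lambda>x. frechet_derivative f (at x)" and ?g' = "\<lambda>x. frechet_derivative g (at x)"
  show ?case
  proof (rule C_k_on_SucI[where f' = "\<lambda>x v. f x * ?g' x v + ?f' x v * g x", OF S])
    show "((\<lambda>x. f x * g x) has_derivative (\<lambda>v. f x * ?g' x v + ?f' x v * g x)) (at x)"
      if "x \<in> S" for x
      by (rule has_derivative_mult[OF f(1)[OF that] g(1)[OF that]])
    show "C_k_on k S (\<lambda>x. f x * ?g' x v + ?f' x v * g x)" for v
      by (rule C_k_on_add[OF S Suc.IH[OF lower(1) g(2)] Suc.IH[OF f(2) lower(2)]])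
  qed
qed

lemma C_k_on_inverse:
  fixes f :: "'a::real_normed_vector \<Rightarrow> real"
  assumes S: "open S" and nz: "\<And>x. x \<in> S \<Longrightarrow> f x \<noteq> 0"
  shows "C_k_on k S f \<Longrightarrow> C_k_on k S (\<lambda>x. inverse (f x))"
proof (induction k)
  case 0
  then show ?case using nz by (simp add: continuous_on_inverse)
next
  case (Suc k)
  note f = C_k_on_SucD[OF Suc.prems]
  note lower = Suc.IH[OF C_k_on_Suc_lower[OF Suc.prems]]
  let ?f' = "\<lambda>x. frechet_derivative f (at x)"
  show ?case
  proof (rule C_k_on_SucI[where f' = "\<lambda>x v. (-1) * (inverse (f x) * ?f' x v * inverse (f x))", OF S])
    show "((\<lambda>x. inverse (f x)) has_derivative
        (\<lambda>v. (-1) * (inverse (f x) * ?f' x v * inverse (f x)))) (at x)" if "x \<in> S" for x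
      using Deriv.has_derivative_inverse[OF nz[OF that] f(1)[OF that]] unfolding mult_minus1 .
    show "C_k_on k S (\<lambda>x. (-1) * (inverse (f x) * ?f' x v * inverse (f x)))" for v
      by (rule C_k_on_mult[OF S C_k_on_const[OF S] C_k_on_mult[OF S C_k_on_mult[OF S lower f(2)] lower]])
  qed
qed

lemma smooth_const: "open S \<Longrightarrow> smooth_fun_on S (\<lambda>_. c)"
  by (simp add: smooth_fun_on_def C_k_on_const)

lemma smooth_add: "open S \<Longrightarrow> smooth_fun_on S f \<Longrightarrow> smooth_fun_on S g
    \<Longrightarrow> smooth_fun_on S (\<lambda>x. f x + g x)"
  by (simp add: smooth_fun_on_def C_k_on_add)

lemma smooth_linear: "bounded_linear L \<Longrightarrow> open S \<Longrightarrow> smooth_fun_on S f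
    \<Longrightarrow> smooth_fun_on S (\<lambda>x. L (f x))"
  by (simp add: smooth_fun_on_def C_k_on_linear)

lemma smooth_mult: "open S \<Longrightarrow> smooth_fun_on S f \<Longrightarrow> smooth_fun_on S g
    \<Longrightarrow> smooth_fun_on S (\<lambda>x. f x * g x :: real)"
  by (simp add: smooth_fun_on_def C_k_on_mult)

lemma smooth_inverse: "open S \<Longrightarrow> (\<And>x. x \<in> S \<Longrightarrow> h x \<noteq> 0) \<Longrightarrow> smooth_fun_on S h
    \<Longrightarrow> smooth_fun_on S (\<lambda>x. inverse (h x) :: real)"
  by (simp add: smooth_fun_on_def C_k_on_inverse)

lemma smooth_cong:
  assumes "open S" "\<And>x. x \<in> S \<Longrightarrow> f x = g x" "smooth_fun_on S f"
  shows "smooth_fun_on S g"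
  using assms(3) C_k_on_cong[OF assms(1,2)] unfolding smooth_fun_on_def by simp

lemma smooth_diff: "open S \<Longrightarrow> smooth_fun_on S f \<Longrightarrow> smooth_fun_on S g
    \<Longrightarrow> smooth_fun_on S (\<lambda>x. f x - g x :: real)"
  using smooth_add[of S f "\<lambda>x. (-1) * g x"] smooth_mult[of S "\<lambda>_. -1" g] smooth_const[of S "-1::real"]
  by simp

lemma smooth_sum: "open S \<Longrightarrow> (\<And>i. i \<in> I \<Longrightarrow> smooth_fun_on S (f i))
    \<Longrightarrow> smooth_fun_on S (\<lambda>x. \<Sum>i\<in>I. f i x :: real)"
  by (induction I rule: infinite_finite_induct) (auto intro: smooth_const smooth_add)

lemma smooth_prod: "open S \<Longrightarrow> (\<And>i. i \<in> I \<Longrightarrow> smooth_fun_on S (f i))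
    \<Longrightarrow> smooth_fun_on S (\<lambda>x. \<Prod>i\<in>I. f i x :: real)"
  by (induction I rule: infinite_finite_induct) (auto intro: smooth_const smooth_mult)

lemma smooth_differentiable:
  assumes "smooth_fun_on S f" "x \<in> S"
  shows "f differentiable (at x)"
proof -
  have "C_k_on (Suc 0) S f" using assms(1) unfolding smooth_fun_on_def by blast
  then show ?thesis using assms(2) by simp
qed

lemma smooth_continuous: "smooth_fun_on S f \<Longrightarrow> continuous_on S f"
  unfolding smooth_fun_on_def by (metis C_k_on.simps(1))

lemma smooth_partial:
  assumes "smooth_fun_on S f"
  shows "smooth_fun_on S (partial i f)"
proof -
  have "C_k_on (Suc k) S f" for k using assms unfolding smooth_fun_on_def by blast
  then have "C_k_on k S (\<lambda>x. frechet_derivative f (at x) (axis i 1))" for k by simp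
  then show ?thesis unfolding smooth_fun_on_def partial_def by blast
qed

lemma smooth_det:
  assumes "open S" "\<And>i j. smooth_fun_on S (\<lambda>x. M x $ i $ j)"
  shows "smooth_fun_on S (\<lambda>x. det (M x :: real^'n^'n))"
  unfolding det_def by (intro smooth_sum smooth_mult smooth_prod smooth_const assms)

lemma matrix_inv_nonsingular:
  fixes M :: "real^'n^'n"
  assumes "det M \<noteq> 0"
  shows "M ** matrix_inv M = mat 1" "matrix_inv M ** M = mat 1"
proof -
  have "\<exists>N. M ** N = mat 1 \<and> N ** M = mat 1"
    using assms invertible_det_nz[of M] unfolding invertible_def by simp
  from someI_ex[OF this] show "M ** matrix_inv M = mat 1" "matrix_inv M ** M = mat 1"
    unfolding matrix_inv_def by simp_all
qed

text \<open>Cramer's rule expresses the entries of the inverse by determinants.\<close>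

lemma smooth_matrix_inv:
  fixes M :: "'a::real_normed_vector \<Rightarrow> real^'n^'n"
  assumes "open S" "\<And>i j. smooth_fun_on S (\<lambda>x. M x $ i $ j)"
    and inv: "\<And>x. x \<in> S \<Longrightarrow> det (M x) \<noteq> 0"
  shows "smooth_fun_on S (\<lambda>x. matrix_inv (M x) $ k $ j)"
proof -
  let ?N = "\<lambda>x. (\<chi> a b. if b = k then axis j 1 $ a else M x $ a $ b) :: real^'n^'n"
  have eq: "matrix_inv (M x) $ k $ j = det (?N x) * inverse (det (M x))" if x: "x \<in> S" for x
  proof -
    have "M x ** matrix_inv (M x) = mat 1"
      using inv[OF x] matrix_inv_nonsingular(1) by blast
    then have "M x *v (matrix_inv (M x) *v axis j 1) = axis j 1"
      by (simp add: matrix_vector_mul_assoc)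
    then have "matrix_inv (M x) *v axis j 1
        = (\<chi> k. det (\<chi> a b. if b = k then axis j 1 $ a else M x $ a $ b) / det (M x))"
      using cramer[OF inv[OF x]] by blast
    then have "(matrix_inv (M x) *v axis j 1) $ k = det (?N x) / det (M x)" by simp
    then show ?thesis
      by (simp add: matrix_vector_mult_basis column_def divide_inverse)
  qed
  have N: "smooth_fun_on S (\<lambda>x. det (?N x))"
  proof (rule smooth_det[OF assms(1)])
    show "smooth_fun_on S (\<lambda>x. ?N x $ a $ b)" for a b
      by (cases "b = k") (simp_all add: assms smooth_const)
  qed
  have "smooth_fun_on S (\<lambda>x. det (?N x) * inverse (det (M x)))"
    by (intro smooth_mult smooth_inverse N smooth_det assms inv)
  then show ?thesis by (rule smooth_cong[OF assms(1), rotated]) (simp add: eq)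
qed

lemma partial_cong:
  assumes "open S" "x \<in> S" "\<And>y. y \<in> S \<Longrightarrow> f y = g y" "smooth_fun_on S f"
  shows "partial i f x = partial i g x"
  unfolding partial_def
  using frechet_derivative_transform_within_open[OF smooth_differentiable[OF assms(4,2)] assms(1-3)]
  by simp

lemma smooth_has_derivative:
  "smooth_fun_on S f \<Longrightarrow> x \<in> S \<Longrightarrow> (f has_derivative frechet_derivative f (at x)) (at x)"
  using smooth_differentiable frechet_derivative_works by blast

lemma partial_const: "partial i (\<lambda>_. c) x = 0"
  by (simp add: partial_def)

context
  fixes S :: "(real^'n) set" and x :: "real^'n"
  assumes x: "x \<in> S"
begin

lemma partial_add: "smooth_fun_on S f \<Longrightarrow> smooth_fun_on S g
    \<Longrightarrow> partial i (\<lambda>y. f y + g y) x = partial i f x + partial i g x"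
  unfolding partial_def
  by (rule frechet_derivativeI[OF has_derivative_add]) (auto intro: smooth_has_derivative x)

lemma partial_diff: "smooth_fun_on S f \<Longrightarrow> smooth_fun_on S g
    \<Longrightarrow> partial i (\<lambda>y. f y - g y) x = partial i f x - partial i g x"
  unfolding partial_def
  by (rule frechet_derivativeI[OF has_derivative_diff]) (auto intro: smooth_has_derivative x)

lemma partial_mult: "smooth_fun_on S f \<Longrightarrow> smooth_fun_on S g
    \<Longrightarrow> partial i (\<lambda>y. f y * g y) x = f x * partial i g x + partial i f x * g x"
  unfolding partial_def
  by (rule frechet_derivativeI[OF has_derivative_mult]) (auto intro: smooth_has_derivative x)

lemma partial_cmult: "smooth_fun_on S f \<Longrightarrow> partial i (\<lambda>y. c * f y) x = c * partial i f x"
  unfolding partial_def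
  by (rule frechet_derivativeI[OF has_derivative_mult_right]) (auto intro: smooth_has_derivative x)

lemma partial_sum: "(\<And>a. a \<in> I \<Longrightarrow> smooth_fun_on S (f a))
    \<Longrightarrow> partial i (\<lambda>y. \<Sum>a\<in>I. f a y) x = (\<Sum>a\<in>I. partial i (f a) x)"
  unfolding partial_def
  by (rule frechet_derivativeI) (auto intro!: has_derivative_sum smooth_has_derivative x)

end

text \<open>Mixed partial derivatives commute: applying the mean value theorem twice to the second
  difference of \<open>f\<close> over a small parallelogram gives a value of either mixed derivative, taken at
  a point close to \<open>x\<close>.\<close>

lemma second_difference:
  fixes f :: "'a::real_normed_vector \<Rightarrow> real"
  assumes d: "\<And>y. y \<in> S \<Longrightarrow> (f has_derivative f' y) (at y)"
    and d2: "\<And>y. y \<in> S \<Longrightarrow> ((\<lambda>z. f' z u) has_derivative f'' y) (at y)"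
    and t: "t > 0" and box: "\<And>a b. 0 \<le> a \<Longrightarrow> a \<le> t \<Longrightarrow> 0 \<le> b \<Longrightarrow> b \<le> t \<Longrightarrow> x + a *\<^sub>R u + b *\<^sub>R w \<in> S"
  obtains a b where "0 \<le> a" "a \<le> t" "0 \<le> b" "b \<le> t"
    "f (x + t *\<^sub>R u + t *\<^sub>R w) - f (x + t *\<^sub>R u) - f (x + t *\<^sub>R w) + f x
      = t * t * f'' (x + a *\<^sub>R u + b *\<^sub>R w) w"
proof -
  define \<phi> where "\<phi> s = f (x + s *\<^sub>R u + t *\<^sub>R w) - f (x + s *\<^sub>R u + 0 *\<^sub>R w)" for s
  have der: "((\<lambda>s. f (x + s *\<^sub>R u + b *\<^sub>R w)) has_derivative
      (\<lambda>r. r * f' (x + s *\<^sub>R u + b *\<^sub>R w) u)) (at s)" if "0 \<le> s" "s \<le> t" "0 \<le> b" "b \<le> t" for s b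
  proof -
    have y: "x + s *\<^sub>R u + b *\<^sub>R w \<in> S" using that box by blast
    have "((\<lambda>s. x + s *\<^sub>R u + b *\<^sub>R w) has_derivative (\<lambda>r. r *\<^sub>R u)) (at s)"
      by (auto intro!: derivative_eq_intros)
    from has_derivative_compose[OF this d[OF y]]
    show ?thesis
      by (simp only: linear_scale[OF has_derivative_linear[OF d[OF y]]] real_scaleR_def)
  qed
  have "(\<phi> has_derivative (\<lambda>r. r * f' (x + s *\<^sub>R u + t *\<^sub>R w) u
      - r * f' (x + s *\<^sub>R u + 0 *\<^sub>R w) u)) (at s within {0..t})" if "0 \<le> s" "s \<le> t" for s
    unfolding \<phi>_def
    by (rule has_derivative_diff[OF has_derivative_at_withinI[OF der]
          has_derivative_at_withinI[OF der]]) (use t that in simp_all)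
  from mvt_simple[of 0 t \<phi> "\<lambda>s r. r * f' (x + s *\<^sub>R u + t *\<^sub>R w) u
      - r * f' (x + s *\<^sub>R u + 0 *\<^sub>R w) u", OF t this]
  obtain a where a: "a \<in> {0<..<t}" and
    a_eq: "\<phi> t - \<phi> 0 = t * (f' (x + a *\<^sub>R u + t *\<^sub>R w) u - f' (x + a *\<^sub>R u + 0 *\<^sub>R w) u)"
    by (auto simp: right_diff_distrib)
  have der2: "((\<lambda>b. f' (x + a *\<^sub>R u + b *\<^sub>R w) u) has_derivative
      (\<lambda>r. r * f'' (x + a *\<^sub>R u + b *\<^sub>R w) w)) (at b)" if "0 \<le> b" "b \<le> t" for b
  proof -
    have y: "x + a *\<^sub>R u + b *\<^sub>R w \<in> S" using that box a by auto
    have "((\<lambda>b. x + a *\<^sub>R u + b *\<^sub>R w) has_derivative (\<lambda>r. r *\<^sub>R w)) (at b)"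
      by (auto intro!: derivative_eq_intros)
    from has_derivative_compose[OF this d2[OF y]]
    show ?thesis
      by (simp only: linear_scale[OF has_derivative_linear[OF d2[OF y]]] real_scaleR_def)
  qed
  from mvt_simple[of 0 t "\<lambda>b. f' (x + a *\<^sub>R u + b *\<^sub>R w) u"
      "\<lambda>b r. r * f'' (x + a *\<^sub>R u + b *\<^sub>R w) w", OF t has_derivative_at_withinI[OF der2]]
  obtain b where b: "b \<in> {0<..<t}" and
    b_eq: "f' (x + a *\<^sub>R u + t *\<^sub>R w) u - f' (x + a *\<^sub>R u + 0 *\<^sub>R w) u
      = t * f'' (x + a *\<^sub>R u + b *\<^sub>R w) w"
    by auto
  show thesis
    by (rule that[of a b]) (use a b a_eq b_eq in \<open>auto simp: \<phi>_def\<close>)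
qed

lemma partial_commute:
  fixes f :: "real^'n \<Rightarrow> real"
  assumes S: "open S" "x \<in> S" and f: "smooth_fun_on S f"
  shows "partial i (partial j f) x = partial j (partial i f) x"
proof -
  let ?u = "axis i 1 :: real^'n" and ?w = "axis j 1 :: real^'n"
  let ?P = "partial j (partial i f)" and ?Q = "partial i (partial j f)"
  have close: "\<bar>?P x - ?Q x\<bar> \<le> e" if e: "e > 0" for e
  proof -
    have cont: "continuous (at x) (partial k (partial l f))" for k l
      using continuous_on_eq_continuous_at[OF S(1), THEN iffD1,
          OF smooth_continuous[OF smooth_partial[OF smooth_partial[OF f]]]] S(2) by (rule bspec)
    have nbhd: "\<exists>d>0. \<forall>y. dist y x < d \<longrightarrow>
        dist (partial k (partial l f) y) (partial k (partial l f) x) < e/2" for k l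
      using cont[of k l, unfolded continuous_at_eps_delta, THEN spec, THEN mp, OF half_gt_zero[OF e]] .
    obtain d1 where d1: "d1 > 0" "\<forall>y. dist y x < d1 \<longrightarrow> dist (?P y) (?P x) < e/2"
      using nbhd[of j i] by (elim exE conjE)
    obtain d2 where d2: "d2 > 0" "\<forall>y. dist y x < d2 \<longrightarrow> dist (?Q y) (?Q x) < e/2"
      using nbhd[of i j] by (elim exE conjE)
    obtain r where r: "r > 0" "ball x r \<subseteq> S" using openE[OF S] by metis
    define t where "t = min r (min d1 d2) / 3"
    have t: "t > 0" using r d1 d2 by (simp add: t_def)
    have near: "dist (x + a *\<^sub>R ?u + b *\<^sub>R ?w) x < min r (min d1 d2)"
      "dist (x + a *\<^sub>R ?w + b *\<^sub>R ?u) x < min r (min d1 d2)"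
      if "0 \<le> a" "a \<le> t" "0 \<le> b" "b \<le> t" for a b
    proof -
      have le: "a + b < min r (min d1 d2)" using that t unfolding t_def by linarith
      show "dist (x + a *\<^sub>R ?u + b *\<^sub>R ?w) x < min r (min d1 d2)"
        using norm_triangle_ineq[of "a *\<^sub>R ?u" "b *\<^sub>R ?w"] le that by (simp add: dist_norm add.assoc)
      show "dist (x + a *\<^sub>R ?w + b *\<^sub>R ?u) x < min r (min d1 d2)"
        using norm_triangle_ineq[of "a *\<^sub>R ?w" "b *\<^sub>R ?u"] le that by (simp add: dist_norm add.assoc)
    qed
    have inS: "x + a *\<^sub>R ?u + b *\<^sub>R ?w \<in> S" "x + a *\<^sub>R ?w + b *\<^sub>R ?u \<in> S"
      if "0 \<le> a" "a \<le> t" "0 \<le> b" "b \<le> t" for a b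
      using near[OF that] r(2) by (auto simp: subset_iff dist_commute)
    have df: "(f has_derivative frechet_derivative f (at y)) (at y)" if "y \<in> S" for y
      using smooth_has_derivative[OF f that] .
    have dfp: "((\<lambda>z. frechet_derivative f (at z) (axis k 1)) has_derivative
        frechet_derivative (partial k f) (at y)) (at y)" if "y \<in> S" for y k
      using smooth_has_derivative[OF smooth_partial[OF f] that, of k] unfolding partial_def .
    obtain a b where ab: "0 \<le> a" "a \<le> t" "0 \<le> b" "b \<le> t"
      "f (x + t *\<^sub>R ?u + t *\<^sub>R ?w) - f (x + t *\<^sub>R ?u) - f (x + t *\<^sub>R ?w) + f x
        = t * t * ?P (x + a *\<^sub>R ?u + b *\<^sub>R ?w)"
      unfolding partial_def[of j "partial i f"]
      by (rule second_difference[of S f "\<lambda>y. frechet_derivative f (at y)" ?u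
            "\<lambda>y. frechet_derivative (partial i f) (at y)" t x ?w, OF df dfp t inS(1)])
    obtain a' b' where ab': "0 \<le> a'" "a' \<le> t" "0 \<le> b'" "b' \<le> t"
      "f (x + t *\<^sub>R ?w + t *\<^sub>R ?u) - f (x + t *\<^sub>R ?w) - f (x + t *\<^sub>R ?u) + f x
        = t * t * ?Q (x + a' *\<^sub>R ?w + b' *\<^sub>R ?u)"
      unfolding partial_def[of i "partial j f"]
      by (rule second_difference[of S f "\<lambda>y. frechet_derivative f (at y)" ?w
            "\<lambda>y. frechet_derivative (partial j f) (at y)" t x ?u, OF df dfp t inS(2)])
    have "t * t * ?P (x + a *\<^sub>R ?u + b *\<^sub>R ?w) = t * t * ?Q (x + a' *\<^sub>R ?w + b' *\<^sub>R ?u)"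
      using ab(5) ab'(5) by (simp add: algebra_simps)
    then have "?P (x + a *\<^sub>R ?u + b *\<^sub>R ?w) = ?Q (x + a' *\<^sub>R ?w + b' *\<^sub>R ?u)" using t by simp
    moreover have "dist (?P (x + a *\<^sub>R ?u + b *\<^sub>R ?w)) (?P x) < e/2"
      using d1(2) near(1)[OF ab(1-4)] by simp
    moreover have "dist (?Q (x + a' *\<^sub>R ?w + b' *\<^sub>R ?u)) (?Q x) < e/2"
      using d2(2) near(2)[OF ab'(1-4)] by simp
    ultimately show ?thesis unfolding dist_real_def by linarith
  qed
  then have "\<bar>?P x - ?Q x\<bar> \<le> 0" by (rule field_le_epsilon) simp
  then show ?thesis by simp
qed

section \<open>Tensor calculus in a coordinate chart\<close>

lemma sum_rotate: "(\<Sum>i\<in>A. \<Sum>j\<in>B. \<Sum>k\<in>C. F i j k) = (\<Sum>j\<in>B. \<Sum>k\<in>C. \<Sum>i\<in>A. F i j k)"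
  by (subst sum.swap) (intro sum.cong refl sum.swap)

lemma sum_swap_outer_inner:
  "(\<Sum>i\<in>A. \<Sum>j\<in>B. \<Sum>k\<in>C. F i j k) = (\<Sum>k\<in>C. \<Sum>j\<in>B. \<Sum>i\<in>A. F i j k)"
  unfolding sum_rotate[of _ A] by (rule sum.swap)

lemma sum_swap_pairs:
  "(\<Sum>i\<in>A. \<Sum>j\<in>B. \<Sum>k\<in>C. \<Sum>l\<in>D. F i j k l) = (\<Sum>k\<in>C. \<Sum>l\<in>D. \<Sum>i\<in>A. \<Sum>j\<in>B. F i j k l)"
proof -
  have "(\<Sum>i\<in>A. \<Sum>j\<in>B. \<Sum>k\<in>C. \<Sum>l\<in>D. F i j k l) = (\<Sum>i\<in>A. \<Sum>k\<in>C. \<Sum>l\<in>D. \<Sum>j\<in>B. F i j k l)"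
    by (intro sum.cong refl sum_rotate)
  then show ?thesis by (simp only: sum_rotate[where A = A])
qed

locale metric_chart =
  fixes S :: "(real^'n::finite) set" and G :: "'n field2"
  assumes open_S: "open S"
    and smooth_G: "\<And>i j. smooth_fun_on S (\<lambda>x. G x $ i $ j)"
    and sym_G: "\<And>x i j. x \<in> S \<Longrightarrow> G x $ i $ j = G x $ j $ i"
    and pos_G: "\<And>x u. x \<in> S \<Longrightarrow> u \<noteq> 0 \<Longrightarrow> u \<bullet> (G x *v u) > 0"
begin

abbreviation g :: "'n \<Rightarrow> 'n \<Rightarrow> real^'n \<Rightarrow> real" where "g i j x \<equiv> G x $ i $ j"
abbreviation h :: "'n \<Rightarrow> 'n \<Rightarrow> real^'n \<Rightarrow> real" where "h i j x \<equiv> Ginv G x $ i $ j"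
abbreviation \<Gamma> :: "'n \<Rightarrow> 'n \<Rightarrow> 'n \<Rightarrow> real^'n \<Rightarrow> real" where "\<Gamma> \<equiv> christoffel G"

lemma det_G: assumes "x \<in> S" shows "det (G x) \<noteq> 0"
proof -
  have "u = 0" if "G x *v u = 0" for u
    using pos_G[OF assms, of u] that by (cases "u = 0") simp_all
  then obtain B where "B ** G x = mat 1" using matrix_left_invertible_ker[of "G x"] by blast
  then have "invertible (G x)" unfolding invertible_def using matrix_left_right_inverse by blast
  then show ?thesis by (simp add: invertible_det_nz)
qed

lemma smooth_h: "smooth_fun_on S (h i j)"
  unfolding Ginv_def by (rule smooth_matrix_inv[OF open_S smooth_G det_G])

lemma sum_delta_mult:
  "(\<Sum>k\<in>UNIV. (if (i::'n) = k then 1 else 0) * X k) = (X i :: real)"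
  "(\<Sum>k\<in>UNIV. (if k = (i::'n) then 1 else 0) * X k) = (X i :: real)"
  "(\<Sum>k\<in>UNIV. X k * (if (i::'n) = k then 1 else 0)) = (X i :: real)"
  "(\<Sum>k\<in>UNIV. X k * (if k = (i::'n) then 1 else 0)) = (X i :: real)"
  by (simp_all add: if_distrib[of "\<lambda>c. c * _"] if_distrib[of "\<lambda>c. _ * c"] sum.delta sum.delta'
      cong: if_cong)

lemma h_g: assumes "x \<in> S" shows "(\<Sum>j\<in>UNIV. h i j x * g j k x) = (if i = k then 1 else 0)"
proof -
  have "(Ginv G x ** G x) $ i $ k = mat 1 $ i $ k"
    unfolding Ginv_def by (simp add: matrix_inv_nonsingular det_G assms)
  then show ?thesis by (simp add: matrix_matrix_mult_def mat_def)
qed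

lemma g_h: assumes "x \<in> S" shows "(\<Sum>j\<in>UNIV. g i j x * h j k x) = (if i = k then 1 else 0)"
proof -
  have "(G x ** Ginv G x) $ i $ k = mat 1 $ i $ k"
    unfolding Ginv_def by (simp add: matrix_inv_nonsingular det_G assms)
  then show ?thesis by (simp add: matrix_matrix_mult_def mat_def)
qed

lemma lower_raise:
  assumes x: "x \<in> S" shows "(\<Sum>k\<in>UNIV. g i k x * (\<Sum>m\<in>UNIV. h k m x * X m)) = X i"
proof -
  have "(\<Sum>k\<in>UNIV. g i k x * (\<Sum>m\<in>UNIV. h k m x * X m))
      = (\<Sum>m\<in>UNIV. (\<Sum>k\<in>UNIV. g i k x * h k m x) * X m)"
    by (subst sum_distrib_right, subst sum.swap) (simp add: sum_distrib_left mult.assoc)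
  then show ?thesis by (simp add: g_h[OF x] sum_delta_mult)
qed

lemma raise_lower:
  assumes x: "x \<in> S" shows "(\<Sum>k\<in>UNIV. h i k x * (\<Sum>m\<in>UNIV. g k m x * X m)) = X i"
proof -
  have "(\<Sum>k\<in>UNIV. h i k x * (\<Sum>m\<in>UNIV. g k m x * X m))
      = (\<Sum>m\<in>UNIV. (\<Sum>k\<in>UNIV. h i k x * g k m x) * X m)"
    by (subst sum_distrib_right, subst sum.swap) (simp add: sum_distrib_left mult.assoc)
  then show ?thesis by (simp add: h_g[OF x] sum_delta_mult)
qed

lemma sym_h: assumes x: "x \<in> S" shows "h i j x = h j i x"
proof -
  have "h i j x = (\<Sum>k\<in>UNIV. h i k x * (\<Sum>m\<in>UNIV. g k m x * h m j x))"
    by (simp add: raise_lower[OF x])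
  also have "\<dots> = (\<Sum>k\<in>UNIV. h i k x * (\<Sum>m\<in>UNIV. h j m x * g m k x))"
    by (rule sum.cong[OF refl]) (auto simp: g_h[OF x] h_g[OF x])
  also have "\<dots> = (\<Sum>m\<in>UNIV. h j m x * (\<Sum>k\<in>UNIV. h i k x * g k m x))"
    by (simp only: sum_distrib_left, subst sum.swap) (simp add: mult_ac sym_G[OF x])
  also have "\<dots> = h j i x"
    unfolding h_g[OF x] sum_delta_mult ..
  finally show ?thesis .
qed

lemma smooth_\<Gamma>: "smooth_fun_on S (\<Gamma> k i j)"
  unfolding christoffel_def
  by (intro smooth_mult[OF open_S] smooth_const[OF open_S] smooth_sum[OF open_S] smooth_diff[OF open_S]
      smooth_add[OF open_S] smooth_partial smooth_h smooth_G)

lemma partial_g_sym: "x \<in> S \<Longrightarrow> partial k (g i j) x = partial k (g j i) x"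
  by (rule partial_cong[OF open_S _ sym_G smooth_G])

lemma sym_\<Gamma>: "x \<in> S \<Longrightarrow> \<Gamma> k i j x = \<Gamma> k j i x"
  unfolding christoffel_def using partial_g_sym[of x _ i j] by (simp add: add.commute)

text \<open>\<open>act k x\<close> is the zeroth-order part of \<open>-\<nabla>\<^sub>k\<close> in one covariant slot; writing covariant
  derivatives with it keeps the sum over the dummy index out of sight.\<close>

definition act :: "'n \<Rightarrow> real^'n \<Rightarrow> ('n \<Rightarrow> real) \<Rightarrow> 'n \<Rightarrow> real" where
  "act k x X i = (\<Sum>l\<in>UNIV. \<Gamma> l k i x * X l)"

definition D1 :: "('n \<Rightarrow> real^'n \<Rightarrow> real) \<Rightarrow> 'n \<Rightarrow> 'n \<Rightarrow> real^'n \<Rightarrow> real" where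
  "D1 T i k x = partial k (T i) x - act k x (\<lambda>a. T a x) i"

definition D2 :: "('n \<Rightarrow> 'n \<Rightarrow> real^'n \<Rightarrow> real) \<Rightarrow> 'n \<Rightarrow> 'n \<Rightarrow> 'n \<Rightarrow> real^'n \<Rightarrow> real" where
  "D2 T i j k x = partial k (T i j) x - act k x (\<lambda>a. T a j x) i - act k x (\<lambda>a. T i a x) j"

definition D3 :: "('n \<Rightarrow> 'n \<Rightarrow> 'n \<Rightarrow> real^'n \<Rightarrow> real) \<Rightarrow> 'n \<Rightarrow> 'n \<Rightarrow> 'n \<Rightarrow> 'n \<Rightarrow> real^'n \<Rightarrow> real" where
  "D3 T i j l k x = partial k (T i j l) x - act k x (\<lambda>a. T a j l x) i - act k x (\<lambda>a. T i a l x) j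
     - act k x (\<lambda>a. T i j a x) l"

definition D4 :: "('n \<Rightarrow> 'n \<Rightarrow> 'n \<Rightarrow> 'n \<Rightarrow> real^'n \<Rightarrow> real) \<Rightarrow> 'n \<Rightarrow> 'n \<Rightarrow> 'n \<Rightarrow> 'n \<Rightarrow> 'n \<Rightarrow> real^'n \<Rightarrow> real"
  where "D4 T i j l m k x = partial k (T i j l m) x - act k x (\<lambda>a. T a j l m x) i
     - act k x (\<lambda>a. T i a l m x) j - act k x (\<lambda>a. T i j a m x) l - act k x (\<lambda>a. T i j l a x) m"

lemma act_diff: "act k x (\<lambda>a. X a - Y a) i = act k x X i - act k x Y i"
  by (simp add: act_def right_diff_distrib sum_subtractf)

lemma act_add: "act k x (\<lambda>a. X a + Y a) i = act k x X i + act k x Y i"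
  by (simp add: act_def distrib_left sum.distrib)

lemma act_cmult: "act k x (\<lambda>a. c * X a) i = c * act k x X i"
  unfolding act_def sum_distrib_left by (simp add: mult_ac)

lemma act_cmult_right: "act k x (\<lambda>a. X a * c) i = act k x X i * c"
  unfolding act_def sum_distrib_right by (simp add: mult_ac)

lemma act_sum: "act k x (\<lambda>a. \<Sum>b\<in>I. X a b) i = (\<Sum>b\<in>I. act k x (\<lambda>a. X a b) i)"
  unfolding act_def sum_distrib_left by (rule sum.swap)

lemma act_zero: "act k x (\<lambda>a. 0) i = 0"
  by (simp add: act_def)

lemma act_swap: "act k x (\<lambda>a. act l x (\<lambda>b. X a b) j) i = act l x (\<lambda>b. act k x (\<lambda>a. X a b) i) j"
  unfolding act_def sum_distrib_left by (subst sum.swap) (simp add: mult_ac)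

lemma act_sym: "x \<in> S \<Longrightarrow> act k x X j = act j x X k"
  unfolding act_def using sym_\<Gamma> by simp

lemma smooth_act: "(\<And>a. smooth_fun_on S (X a)) \<Longrightarrow> smooth_fun_on S (\<lambda>x. act k x (\<lambda>a. X a x) i)"
  unfolding act_def by (intro smooth_sum[OF open_S] smooth_mult[OF open_S] smooth_\<Gamma>)

lemma smooth_D1: "(\<And>i. smooth_fun_on S (T i)) \<Longrightarrow> smooth_fun_on S (D1 T i k)"
  unfolding D1_def by (intro smooth_diff[OF open_S] smooth_partial smooth_act)

lemma smooth_D2: "(\<And>i j. smooth_fun_on S (T i j)) \<Longrightarrow> smooth_fun_on S (D2 T i j k)"
  unfolding D2_def by (intro smooth_diff[OF open_S] smooth_partial smooth_act)

lemma smooth_riem: "smooth_fun_on S (riem G l k i j)"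
  unfolding riem_def
  by (intro smooth_add[OF open_S] smooth_diff[OF open_S] smooth_sum[OF open_S] smooth_mult[OF open_S]
      smooth_partial smooth_\<Gamma>)

lemma partial_act:
  assumes x: "x \<in> S" and X: "\<And>a. smooth_fun_on S (X a)"
  shows "partial k (\<lambda>y. act j y (\<lambda>a. X a y) i) x
    = act j x (\<lambda>a. partial k (X a) x) i + (\<Sum>a\<in>UNIV. partial k (\<Gamma> a j i) x * X a x)"
  unfolding act_def
  by (simp add: partial_sum[OF x] partial_mult[OF x] smooth_mult[OF open_S] smooth_\<Gamma> X sum.distrib)

subsection \<open>Compatibility with the metric\<close>

lemma lower_\<Gamma>:
  assumes x: "x \<in> S"
  shows "(\<Sum>k\<in>UNIV. g l k x * \<Gamma> k i j x)
    = (1/2) * (partial i (g j l) x + partial j (g i l) x - partial l (g i j) x)"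
proof -
  have "(\<Sum>k\<in>UNIV. g l k x * \<Gamma> k i j x) = (\<Sum>k\<in>UNIV. g l k x * (\<Sum>m\<in>UNIV. h k m x *
      ((1/2) * (partial i (g j m) x + partial j (g i m) x - partial m (g i j) x))))"
    unfolding christoffel_def by (simp add: sum_distrib_left mult_ac)
  then show ?thesis by (simp only: lower_raise[OF x])
qed

lemma partial_g:
  assumes x: "x \<in> S"
  shows "partial k (g i j) x = act k x (\<lambda>a. g a j x) i + act k x (\<lambda>a. g i a x) j"
proof -
  have "act k x (\<lambda>a. g a j x) i = (\<Sum>a\<in>UNIV. g j a x * \<Gamma> a k i x)"
    "act k x (\<lambda>a. g i a x) j = (\<Sum>a\<in>UNIV. g i a x * \<Gamma> a k j x)"
    unfolding act_def using sym_G[OF x] by (simp_all add: mult_ac)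
  then show ?thesis
    using partial_g_sym[OF x] by (simp add: lower_\<Gamma>[OF x])
qed

lemma D2_g: "x \<in> S \<Longrightarrow> D2 g i j k x = 0"
  by (simp add: D2_def partial_g)

lemma partial_h:
  assumes x: "x \<in> S"
  shows "partial k (h i m) x = - (\<Sum>l\<in>UNIV. \<Gamma> i k l x * h l m x) - (\<Sum>l\<in>UNIV. \<Gamma> m k l x * h i l x)"
proof -
  have 0: "(\<Sum>j\<in>UNIV. partial k (h i j) x * g j l x) = - (\<Sum>j\<in>UNIV. h i j x * partial k (g j l) x)" for l
  proof -
    have "partial k (\<lambda>y. \<Sum>j\<in>UNIV. h i j y * g j l y) x = partial k (\<lambda>y. if i = l then 1 else 0) x"
      by (rule partial_cong[OF open_S x]) (auto simp: h_g intro!: smooth_sum smooth_mult open_S smooth_h smooth_G)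
    then show ?thesis
      by (simp add: partial_const partial_sum[OF x] partial_mult[OF x] smooth_mult[OF open_S] smooth_h
          smooth_G sum.distrib)
  qed
  have "partial k (h i m) x = (\<Sum>l\<in>UNIV. (\<Sum>j\<in>UNIV. partial k (h i j) x * g j l x) * h l m x)"
  proof -
    have "(\<Sum>l\<in>UNIV. (\<Sum>j\<in>UNIV. partial k (h i j) x * g j l x) * h l m x)
        = (\<Sum>j\<in>UNIV. (\<Sum>l\<in>UNIV. g j l x * h l m x) * partial k (h i j) x)"
      by (simp only: sum_distrib_right, subst sum.swap) (simp add: mult_ac)
    then show ?thesis by (simp add: g_h[OF x] sum_delta_mult)
  qed
  also have "\<dots> = - (\<Sum>l\<in>UNIV. (\<Sum>j\<in>UNIV. h i j x * act k x (\<lambda>a. g a l x) j) * h l m x)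
      - (\<Sum>l\<in>UNIV. (\<Sum>j\<in>UNIV. h i j x * act k x (\<lambda>a. g j a x) l) * h l m x)"
    by (simp add: 0 partial_g[OF x] distrib_left distrib_right left_diff_distrib sum.distrib sum_negf
        sum_subtractf)
  also have "(\<Sum>l\<in>UNIV. (\<Sum>j\<in>UNIV. h i j x * act k x (\<lambda>a. g a l x) j) * h l m x)
      = (\<Sum>j\<in>UNIV. h i j x * act k x (\<lambda>a. (\<Sum>l\<in>UNIV. g a l x * h l m x)) j)"
    by (simp only: sum_distrib_right sum_distrib_left act_sum, subst sum.swap)
       (simp add: act_cmult_right mult_ac)
  also have "\<dots> = (\<Sum>l\<in>UNIV. \<Gamma> m k l x * h i l x)"
    unfolding g_h[OF x] act_def sum_delta_mult by (intro sum.cong refl mult.commute)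
  also have "(\<Sum>l\<in>UNIV. (\<Sum>j\<in>UNIV. h i j x * act k x (\<lambda>a. g j a x) l) * h l m x)
      = (\<Sum>l\<in>UNIV. act k x (\<lambda>a. \<Sum>j\<in>UNIV. h i j x * g j a x) l * h l m x)"
    by (simp only: act_sum act_cmult)
  also have "\<dots> = (\<Sum>l\<in>UNIV. \<Gamma> i k l x * h l m x)"
    unfolding h_g[OF x] act_def sum_delta_mult ..
  finally show ?thesis by simp
qed

text \<open>Since \<open>\<nabla>g\<^sup>-\<^sup>1 = 0\<close>, contraction commutes with covariant differentiation. Further slots of
  the tensor, as in \<open>D1_contract\<close> and \<open>D2_contract\<close>, only add terms linear in it.\<close>

lemma partial_contract:
  assumes x: "x \<in> S" and T: "\<And>i j. smooth_fun_on S (T i j)"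
  shows "partial k (\<lambda>y. \<Sum>i\<in>UNIV. \<Sum>j\<in>UNIV. h i j y * T i j y) x
    = (\<Sum>i\<in>UNIV. \<Sum>j\<in>UNIV. h i j x * D2 T i j k x)"
proof -
  have 1: "(\<Sum>i\<in>UNIV. \<Sum>j\<in>UNIV. (\<Sum>l\<in>UNIV. \<Gamma> i k l x * h l j x) * T i j x)
      = (\<Sum>i\<in>UNIV. \<Sum>j\<in>UNIV. h i j x * act k x (\<lambda>a. T a j x) i)"
    unfolding act_def sum_distrib_right sum_distrib_left
    by (subst sum_swap_outer_inner) (simp add: mult_ac)
  have 2: "(\<Sum>i\<in>UNIV. \<Sum>j\<in>UNIV. (\<Sum>l\<in>UNIV. \<Gamma> j k l x * h i l x) * T i j x)
      = (\<Sum>i\<in>UNIV. \<Sum>j\<in>UNIV. h i j x * act k x (\<lambda>a. T i a x) j)"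
    unfolding act_def sum_distrib_right sum_distrib_left
    by (rule sum.cong[OF refl], subst sum.swap) (simp add: mult_ac)
  have "partial k (\<lambda>y. \<Sum>i\<in>UNIV. \<Sum>j\<in>UNIV. h i j y * T i j y) x
      = (\<Sum>i\<in>UNIV. \<Sum>j\<in>UNIV. h i j x * partial k (T i j) x)
        + (\<Sum>i\<in>UNIV. \<Sum>j\<in>UNIV. partial k (h i j) x * T i j x)"
    by (simp add: partial_sum[OF x] partial_mult[OF x] smooth_sum[OF open_S] smooth_mult[OF open_S]
        smooth_h T sum.distrib)
  then show ?thesis
    unfolding partial_h[OF x] D2_def left_diff_distrib right_diff_distrib sum_subtractf
      mult_minus_left sum_negf 1 2 by simp
qed

lemma D1_contract:
  assumes x: "x \<in> S" and T: "\<And>p i j. smooth_fun_on S (T p i j)"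
  shows "D1 (\<lambda>p y. \<Sum>i\<in>UNIV. \<Sum>j\<in>UNIV. h i j y * T p i j y) p k x
    = (\<Sum>i\<in>UNIV. \<Sum>j\<in>UNIV. h i j x * D3 T p i j k x)"
  unfolding D1_def partial_contract[OF x T] act_sum act_cmult sum_subtractf[symmetric]
  by (simp add: D2_def D3_def algebra_simps)

lemma D2_contract:
  assumes x: "x \<in> S" and T: "\<And>p q i j. smooth_fun_on S (T p q i j)"
  shows "D2 (\<lambda>p q y. \<Sum>i\<in>UNIV. \<Sum>j\<in>UNIV. h i j y * T p q i j y) p q k x
    = (\<Sum>i\<in>UNIV. \<Sum>j\<in>UNIV. h i j x * D4 T p q i j k x)"
  unfolding D2_def[of "\<lambda>p q y. \<Sum>i\<in>UNIV. _ p q i y"] partial_contract[OF x T] act_sum act_cmult sum_subtractf[symmetric]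
  by (simp add: D2_def D4_def algebra_simps)

subsection \<open>Curvature\<close>

text \<open>The curvature is what \<open>[\<nabla>\<^sub>k, \<nabla>\<^sub>j]\<close> does to a single slot; stating it for one slot makes the
  Ricci identities for all ranks instances of the same computation.\<close>

lemma slot_curvature:
  "act k x (\<lambda>a. act j x X a) i - act j x (\<lambda>a. act k x X a) i
    - (\<Sum>a\<in>UNIV. partial k (\<Gamma> a j i) x * X a) + (\<Sum>a\<in>UNIV. partial j (\<Gamma> a k i) x * X a)
   = - (\<Sum>a\<in>UNIV. riem G a i k j x * X a)"
proof -
  have "act k x (\<lambda>a. act j x X a) i = (\<Sum>a\<in>UNIV. (\<Sum>m\<in>UNIV. \<Gamma> a j m x * \<Gamma> m k i x) * X a)" for k j
    unfolding act_def sum_distrib_left sum_distrib_right by (subst sum.swap) (simp add: mult_ac)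
  then show ?thesis
    by (simp add: riem_def sum.distrib sum_subtractf algebra_simps)
qed

text \<open>Partial derivatives commute and the symmetry of \<open>\<Gamma>\<close> removes the terms in which a connection
  acts on the slot created by the inner derivative; only the curvature of the slot of \<open>w\<close> is left.\<close>

lemma ricci_identity1:
  assumes x: "x \<in> S" and w: "\<And>i. smooth_fun_on S (w i)"
  shows "D2 (D1 w) i j k x - D2 (D1 w) i k j x = - (\<Sum>a\<in>UNIV. riem G a i k j x * w a x)"
proof -
  have p: "partial k (D1 w i j) x = partial k (partial j (w i)) x
      - act j x (\<lambda>a. partial k (w a) x) i - (\<Sum>a\<in>UNIV. partial k (\<Gamma> a j i) x * w a x)" for k j
    unfolding D1_def
    by (simp add: partial_diff[OF x] smooth_partial smooth_act w partial_act[OF x])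
  have e: "D2 (D1 w) i j k x = partial k (partial j (w i)) x
      - act j x (\<lambda>a. partial k (w a) x) i - (\<Sum>a\<in>UNIV. partial k (\<Gamma> a j i) x * w a x)
      - (act k x (\<lambda>a. partial j (w a) x) i - act k x (\<lambda>a. act j x (\<lambda>b. w b x) a) i)
      - act k x (\<lambda>a. D1 w i a x) j" for j k
    unfolding D2_def p by (simp add: D1_def act_diff)
  show ?thesis
    unfolding e slot_curvature[symmetric]
    using partial_commute[OF open_S x w[of i], of k j] act_sym[OF x, of k "\<lambda>a. D1 w i a x" j] by simp
qed

text \<open>With two slots there are also products of connection terms in different slots; these commute
  (\<open>act_swap\<close>).\<close>

lemma ricci_identity2:
  assumes x: "x \<in> S" and T: "\<And>i j. smooth_fun_on S (T i j)"
  shows "D3 (D2 T) i j k l x - D3 (D2 T) i j l k x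
    = - (\<Sum>a\<in>UNIV. riem G a i l k x * T a j x) - (\<Sum>a\<in>UNIV. riem G a j l k x * T i a x)"
proof -
  have p: "partial l (D2 T i j k) x = partial l (partial k (T i j)) x
      - act k x (\<lambda>a. partial l (T a j) x) i - (\<Sum>a\<in>UNIV. partial l (\<Gamma> a k i) x * T a j x)
      - act k x (\<lambda>a. partial l (T i a) x) j - (\<Sum>a\<in>UNIV. partial l (\<Gamma> a k j) x * T i a x)" for k l
    unfolding D2_def
    by (simp add: partial_diff[OF x] smooth_diff[OF open_S] smooth_partial smooth_act T partial_act[OF x])
  have e: "D3 (D2 T) i j k l x = partial l (partial k (T i j)) x
      - act k x (\<lambda>a. partial l (T a j) x) i - (\<Sum>a\<in>UNIV. partial l (\<Gamma> a k i) x * T a j x)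
      - act k x (\<lambda>a. partial l (T i a) x) j - (\<Sum>a\<in>UNIV. partial l (\<Gamma> a k j) x * T i a x)
      - (act l x (\<lambda>a. partial k (T a j) x) i - act l x (\<lambda>a. act k x (\<lambda>b. T b j x) a) i
          - act l x (\<lambda>a. act k x (\<lambda>b. T a b x) j) i)
      - (act l x (\<lambda>a. partial k (T i a) x) j - act l x (\<lambda>a. act k x (\<lambda>b. T b a x) i) j
          - act l x (\<lambda>a. act k x (\<lambda>b. T i b x) a) j)
      - act l x (\<lambda>a. D2 T i j a x) k" for k l
    unfolding D3_def p by (simp add: D2_def act_diff)
  show ?thesis
    unfolding e
    using slot_curvature[of l x k "\<lambda>a. T a j x" i] slot_curvature[of l x k "\<lambda>a. T i a x" j]
      partial_commute[OF open_S x T[of i j], of l k] act_sym[OF x, of l "\<lambda>a. D2 T i j a x" k]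
      act_swap[of l x k "\<lambda>a b. T a b x" j i] act_swap[of k x l "\<lambda>a b. T a b x" j i] by simp
qed

definition Rm :: "'n \<Rightarrow> 'n \<Rightarrow> 'n \<Rightarrow> 'n \<Rightarrow> real^'n \<Rightarrow> real" where
  "Rm i j k l x = (\<Sum>a\<in>UNIV. g i a x * riem G a j k l x)"

abbreviation ric :: "'n \<Rightarrow> 'n \<Rightarrow> real^'n \<Rightarrow> real" where "ric i j x \<equiv> ricci G x $ i $ j"

lemma smooth_Rm: "smooth_fun_on S (Rm i j k l)"
  unfolding Rm_def by (intro smooth_sum[OF open_S] smooth_mult[OF open_S] smooth_G smooth_riem)

lemma smooth_ric: "smooth_fun_on S (ric i j)"
  unfolding ricci_def by (simp add: smooth_sum[OF open_S] smooth_riem)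

lemma riem_eq_Rm: "x \<in> S \<Longrightarrow> riem G a j k l x = (\<Sum>b\<in>UNIV. h a b x * Rm b j k l x)"
  by (simp add: Rm_def raise_lower)

lemma riem_antisym: "riem G a i k l x = - riem G a i l k x"
  by (simp add: riem_def sum_subtractf)

lemma Rm_antisym_right: "Rm i j k l x = - Rm i j l k x"
  unfolding Rm_def by (subst riem_antisym) (simp add: sum_negf)

text \<open>The Ricci identity for the parallel tensor \<open>g\<close>.\<close>

lemma Rm_antisym_left:
  assumes x: "x \<in> S" shows "Rm i j k l x = - Rm j i k l x"
proof -
  have "partial l (D2 g i j k) y = 0" if "y \<in> S" for i j k l y
  proof -
    have "partial l (D2 g i j k) y = partial l (\<lambda>_. 0) y"
      by (rule partial_cong[OF open_S that]) (auto simp: D2_g intro!: smooth_D2 smooth_G)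
    then show ?thesis by (simp add: partial_const)
  qed
  then have "D3 (D2 g) i j k l x = 0" for i j k l
    by (simp add: D3_def x D2_g act_zero)
  then show ?thesis
    using ricci_identity2[of x g i j l k, OF x smooth_G] sym_G[OF x]
    unfolding Rm_def by (simp add: mult.commute)
qed

lemma partial_\<Gamma>_sym: "x \<in> S \<Longrightarrow> partial m (\<Gamma> k i j) x = partial m (\<Gamma> k j i) x"
  by (rule partial_cong[OF open_S _ sym_\<Gamma> smooth_\<Gamma>])

lemma Rm_cyclic:
  assumes x: "x \<in> S" shows "Rm a i j k x + Rm a j k i x + Rm a k i j x = 0"
proof -
  have "riem G l i j k x + riem G l j k i x + riem G l k i j x = 0" for l
    unfolding riem_def sum_subtractf
    using sym_\<Gamma>[OF x] partial_\<Gamma>_sym[OF x] by simp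
  then show ?thesis
    unfolding Rm_def sum.distrib[symmetric] distrib_left[symmetric] by simp
qed

text \<open>The octahedron argument: four instances of the cyclic identity.\<close>

lemma Rm_pair: "x \<in> S \<Longrightarrow> Rm i j k l x = Rm k l i j x"
  using Rm_cyclic[of x i j k l] Rm_cyclic[of x j k l i] Rm_cyclic[of x k l i j] Rm_cyclic[of x l i j k]
    Rm_antisym_left[of x] Rm_antisym_right by smt

lemma ric_eq_Rm: assumes x: "x \<in> S" shows "ric i j x = (\<Sum>a\<in>UNIV. \<Sum>b\<in>UNIV. h a b x * Rm a j b i x)"
proof -
  have "ric i j x = (\<Sum>a\<in>UNIV. \<Sum>b\<in>UNIV. h a b x * Rm b j a i x)"
    by (simp add: ricci_def riem_eq_Rm[OF x])
  then show ?thesis by (subst (asm) sum.swap) (simp add: sym_h[OF x])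
qed

lemma ric_sym: assumes x: "x \<in> S" shows "ric i j x = ric j i x"
  unfolding ric_eq_Rm[OF x] Rm_pair[OF x, of _ j]
  by (subst sum.swap) (simp add: sym_h[OF x])

subsection \<open>The contracted second Bianchi identity\<close>

text \<open>The covariant derivative of the curvature with its first index kept upstairs: in this form the
  curvature is the matrix-valued two-form \<open>d\<Gamma> + \<Gamma> \<and> \<Gamma>\<close>, for which the second Bianchi identity
  reduces to \<open>d\<^sup>2 = 0\<close> and the Jacobi identity for commutators of matrices.\<close>

definition Driem :: "'n \<Rightarrow> 'n \<Rightarrow> 'n \<Rightarrow> 'n \<Rightarrow> 'n \<Rightarrow> real^'n \<Rightarrow> real" where
  "Driem l k i j m x = partial m (riem G l k i j) x + (\<Sum>a\<in>UNIV. \<Gamma> l m a x * riem G a k i j x)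
     - act m x (\<lambda>a. riem G l a i j x) k - act m x (\<lambda>a. riem G l k a j x) i
     - act m x (\<lambda>a. riem G l k i a x) j"

lemma second_bianchi:
  assumes x: "x \<in> S"
  shows "Driem l k i j m x + Driem l k j m i x + Driem l k m i j x = 0"
proof -
  define P where "P m i j = (\<Sum>a\<in>UNIV. \<Gamma> l m a x * partial i (\<Gamma> a j k) x)" for m i j
  define Q where "Q i j m = (\<Sum>a\<in>UNIV. partial i (\<Gamma> l j a) x * \<Gamma> a m k x)" for i j m
  define C where "C i j m = (\<Sum>a\<in>UNIV. \<Sum>b\<in>UNIV. \<Gamma> l i a x * \<Gamma> a j b x * \<Gamma> b m k x)" for i j m
  have d: "partial m (riem G l k i j) x = partial m (partial i (\<Gamma> l j k)) x
      - partial m (partial j (\<Gamma> l i k)) x + Q m i j + P i m j - Q m j i - P j m i" for i j m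
    unfolding riem_def P_def Q_def
    by (simp add: partial_add[OF x] partial_diff[OF x] partial_sum[OF x] partial_mult[OF x]
        smooth_add[OF open_S] smooth_diff[OF open_S] smooth_sum[OF open_S] smooth_mult[OF open_S]
        smooth_partial smooth_\<Gamma> sum.distrib sum_subtractf)
  have u: "(\<Sum>a\<in>UNIV. \<Gamma> l m a x * riem G a k i j x) = P m i j - P m j i + C m i j - C m j i" for i j m
    unfolding riem_def P_def C_def
    by (simp add: sum.distrib sum_subtractf algebra_simps sum_distrib_left)
  have s: "(\<Sum>a\<in>UNIV. \<Sum>b\<in>UNIV. \<Gamma> a m k x * (\<Gamma> l i b x * \<Gamma> b j a x)) = C i j m" for i j m
    unfolding C_def by (subst sum.swap) (simp add: mult_ac)
  have v: "act m x (\<lambda>a. riem G l a i j x) k = Q i j m - Q j i m + C i j m - C j i m" for i j m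
  proof -
    have "act m x (\<lambda>a. riem G l a i j x) k = Q i j m - Q j i m
        + (\<Sum>a\<in>UNIV. \<Sum>b\<in>UNIV. \<Gamma> a m k x * (\<Gamma> l i b x * \<Gamma> b j a x))
        - (\<Sum>a\<in>UNIV. \<Sum>b\<in>UNIV. \<Gamma> a m k x * (\<Gamma> l j b x * \<Gamma> b i a x))"
      unfolding riem_def Q_def act_def
      by (simp add: sum.distrib sum_subtractf algebra_simps sum_distrib_left)
    then show ?thesis by (simp only: s)
  qed
  have t: "act m x (\<lambda>a. riem G l k a j x) i = - act i x (\<lambda>a. riem G l k j a x) m" for i j m
    unfolding act_def using sym_\<Gamma>[OF x] by (subst riem_antisym) (simp add: sum_negf)
  show ?thesis
    unfolding Driem_def d u v
    using t[of m j i] t[of i m j] t[of j i m]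
      partial_commute[OF open_S x smooth_\<Gamma>[of l j k], of m i]
      partial_commute[OF open_S x smooth_\<Gamma>[of l i k], of m j]
      partial_commute[OF open_S x smooth_\<Gamma>[of l m k], of i j] by simp
qed

lemma D4_Rm:
  assumes x: "x \<in> S"
  shows "D4 Rm a k i j m x = (\<Sum>l\<in>UNIV. g a l x * Driem l k i j m x)"
proof -
  have p: "partial m (Rm a k i j) x = (\<Sum>l\<in>UNIV. g a l x * partial m (riem G l k i j) x)
      + (\<Sum>l\<in>UNIV. act m x (\<lambda>b. g b l x) a * riem G l k i j x)
      + (\<Sum>l\<in>UNIV. act m x (\<lambda>b. g a b x) l * riem G l k i j x)"
    unfolding Rm_def
    by (simp add: partial_sum[OF x] partial_mult[OF x] smooth_mult[OF open_S] smooth_G smooth_riem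
        partial_g[OF x] sum.distrib distrib_right)
  have q: "(\<Sum>l\<in>UNIV. act m x (\<lambda>b. g a b x) l * riem G l k i j x)
      = (\<Sum>l\<in>UNIV. g a l x * (\<Sum>b\<in>UNIV. \<Gamma> l m b x * riem G b k i j x))"
    unfolding act_def sum_distrib_left sum_distrib_right by (subst sum.swap) (simp add: mult_ac)
  show ?thesis
    unfolding D4_def p q Driem_def Rm_def act_sum act_cmult act_cmult_right
    by (simp add: sum.distrib sum_subtractf algebra_simps)
qed

lemma D4_Rm_cyclic:
  "x \<in> S \<Longrightarrow> D4 Rm a k i j m x + D4 Rm a k j m i x + D4 Rm a k m i j x = 0"
  by (simp add: D4_Rm sum.distrib[symmetric] distrib_left[symmetric] second_bianchi)

lemma D4_Rm_antisym_right: "D4 Rm a k i j m x = - D4 Rm a k j i m x" if x: "x \<in> S"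
proof -
  have "riem G l k i j = (\<lambda>y. - 1 * riem G l k j i y)" for l
    by (rule ext) (subst riem_antisym, simp)
  then have "partial m (Rm a k i j) x = partial m (\<lambda>y. - 1 * Rm a k j i y) x"
    by (metis Rm_antisym_right mult_minus1)
  then have "partial m (Rm a k i j) x = - partial m (Rm a k j i) x"
    by (simp only: partial_cmult[OF x smooth_Rm])
  then show ?thesis
    unfolding D4_def Rm_antisym_right[of _ _ i] Rm_antisym_right[of _ _ _ j]
    by (simp add: act_cmult[of _ _ "-1", simplified])
qed

lemma D4_Rm_antisym_left: "D4 Rm a k i j m x = - D4 Rm k a i j m x" if x: "x \<in> S"
proof -
  have "partial m (Rm a k i j) x = partial m (\<lambda>y. - 1 * Rm k a i j y) x"
  proof (rule partial_cong[OF open_S x _ smooth_Rm])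
    show "Rm a k i j y = - 1 * Rm k a i j y" if "y \<in> S" for y
      using Rm_antisym_left[OF that, of a k i j] by simp
  qed
  then have "partial m (Rm a k i j) x = - partial m (Rm k a i j) x"
    by (simp only: partial_cmult[OF x smooth_Rm])
  then show ?thesis
    unfolding D4_def Rm_antisym_left[OF x, of a] Rm_antisym_left[OF x, of _ k]
    by (simp add: act_cmult[of _ _ "-1", simplified])
qed

lemma D2_ric:
  assumes x: "x \<in> S"
  shows "D2 ric i j k x = (\<Sum>a\<in>UNIV. \<Sum>b\<in>UNIV. h a b x * D4 Rm a j b i k x)"
proof -
  have "D2 ric i j k x = D2 (\<lambda>p q y. \<Sum>a\<in>UNIV. \<Sum>b\<in>UNIV. h a b y * Rm a q b p y) i j k x"
    unfolding D2_def using x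
    by (simp add: ric_eq_Rm partial_cong[OF open_S x, OF ric_eq_Rm smooth_ric])
  then show ?thesis
    unfolding D2_contract[OF x smooth_Rm] by (simp add: D4_def algebra_simps)
qed

lemma partial_scalar_curv:
  assumes x: "x \<in> S"
  shows "partial k (scalar_curv G) x = (\<Sum>i\<in>UNIV. \<Sum>j\<in>UNIV. h i j x * D2 ric i j k x)"
  using partial_contract[OF x smooth_ric]
  unfolding scalar_curv_def metric_trace_def[abs_def] by simp

text \<open>Contracting the second Bianchi identity twice turns one of its terms into \<open>dR\<close> and each of the
  other two into minus the divergence of \<open>Ric\<close>.\<close>

lemma contracted_bianchi:
  assumes x: "x \<in> S"
  shows "partial m (scalar_curv G) x = 2 * (\<Sum>i\<in>UNIV. \<Sum>j\<in>UNIV. h i j x * D2 ric m i j x)"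
proof -
  let ?Y = "\<lambda>a k i j m. D4 Rm a k i j m x"
  have b: "?Y a k i j m = ?Y k a j m i + ?Y a k i m j" for a k i j
    using D4_Rm_cyclic[OF x, of a k i j m] D4_Rm_antisym_left[OF x, of a k j m i]
      D4_Rm_antisym_right[OF x, of a k m i j] by simp
  have "partial m (scalar_curv G) x
      = (\<Sum>j\<in>UNIV. \<Sum>k\<in>UNIV. \<Sum>a\<in>UNIV. \<Sum>i\<in>UNIV. h j k x * (h a i x * ?Y a k i j m))"
    unfolding partial_scalar_curv[OF x] D2_ric[OF x] sum_distrib_left ..
  also have "\<dots> = (\<Sum>j\<in>UNIV. \<Sum>k\<in>UNIV. \<Sum>a\<in>UNIV. \<Sum>i\<in>UNIV. h j k x * (h a i x * ?Y k a j m i))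
      + (\<Sum>j\<in>UNIV. \<Sum>k\<in>UNIV. \<Sum>a\<in>UNIV. \<Sum>i\<in>UNIV. h j k x * (h a i x * ?Y a k i m j))"
    unfolding b distrib_left sum.distrib ..
  also have "(\<Sum>j\<in>UNIV. \<Sum>k\<in>UNIV. \<Sum>a\<in>UNIV. \<Sum>i\<in>UNIV. h j k x * (h a i x * ?Y a k i m j))
      = (\<Sum>j\<in>UNIV. \<Sum>k\<in>UNIV. h j k x * D2 ric m k j x)"
    unfolding D2_ric[OF x] sum_distrib_left ..
  also have "(\<Sum>j\<in>UNIV. \<Sum>k\<in>UNIV. \<Sum>a\<in>UNIV. \<Sum>i\<in>UNIV. h j k x * (h a i x * ?Y k a j m i))
      = (\<Sum>a\<in>UNIV. \<Sum>i\<in>UNIV. h a i x * D2 ric m a i x)"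
    unfolding D2_ric[OF x] sum_distrib_left
  proof (rule trans[OF sum_swap_pairs], rule sum.cong[OF refl], rule sum.cong[OF refl])
    fix a i
    show "(\<Sum>j\<in>UNIV. \<Sum>k\<in>UNIV. h j k x * (h a i x * ?Y k a j m i))
        = (\<Sum>k\<in>UNIV. \<Sum>j\<in>UNIV. h a i x * (h k j x * ?Y k a j m i))"
      by (rule trans[OF sum.swap]) (intro sum.cong refl, simp add: sym_h[OF x])
  qed
  finally show ?thesis
    by (subst (asm) (2) sum.swap) (simp add: sym_h[OF x])
qed

end

section \<open>Orthonormal frames at a point\<close>

text \<open>In an orthonormal basis every contraction becomes a plain sum, so that the identities that
  are special to dimension three can be checked component by component. The functions below turn
  coordinate components of a tensor at one point into components with respect to the basis whose
  \<open>a\<close>-th vector has the coordinates \<open>P i a\<close>.\<close>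

definition fr1 :: "('n::finite \<Rightarrow> 'n \<Rightarrow> real) \<Rightarrow> ('n \<Rightarrow> real) \<Rightarrow> 'n \<Rightarrow> real" where
  "fr1 P X a = (\<Sum>i\<in>UNIV. P i a * X i)"

definition fr2 :: "('n::finite \<Rightarrow> 'n \<Rightarrow> real) \<Rightarrow> ('n \<Rightarrow> 'n \<Rightarrow> real) \<Rightarrow> 'n \<Rightarrow> 'n \<Rightarrow> real" where
  "fr2 P T a b = fr1 P (\<lambda>i. fr1 P (T i) b) a"

definition fr3 :: "('n::finite \<Rightarrow> 'n \<Rightarrow> real) \<Rightarrow> ('n \<Rightarrow> 'n \<Rightarrow> 'n \<Rightarrow> real) \<Rightarrow> 'n \<Rightarrow> 'n \<Rightarrow> 'n \<Rightarrow> real" where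
  "fr3 P T a b c = fr1 P (\<lambda>i. fr2 P (T i) b c) a"

definition fr4 :: "('n::finite \<Rightarrow> 'n \<Rightarrow> real) \<Rightarrow> ('n \<Rightarrow> 'n \<Rightarrow> 'n \<Rightarrow> 'n \<Rightarrow> real)
    \<Rightarrow> 'n \<Rightarrow> 'n \<Rightarrow> 'n \<Rightarrow> 'n \<Rightarrow> real" where
  "fr4 P T a b c d = fr1 P (\<lambda>i. fr3 P (T i) b c d) a"

lemma fr1_add: "fr1 P (\<lambda>i. X i + Y i) a = fr1 P X a + fr1 P Y a"
  and fr1_diff: "fr1 P (\<lambda>i. X i - Y i) a = fr1 P X a - fr1 P Y a"
  and fr1_minus: "fr1 P (\<lambda>i. - X i) a = - fr1 P X a"
  by (simp_all add: fr1_def distrib_left right_diff_distrib sum.distrib sum_subtractf sum_negf)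

lemma fr1_cmult: "fr1 P (\<lambda>i. c * X i) a = c * fr1 P X a"
  and fr1_cmult_right: "fr1 P (\<lambda>i. X i * c) a = fr1 P X a * c"
  unfolding fr1_def sum_distrib_left sum_distrib_right by (simp_all add: mult_ac)

lemma fr1_sum: "fr1 P (\<lambda>i. \<Sum>b\<in>I. X i b) a = (\<Sum>b\<in>I. fr1 P (\<lambda>i. X i b) a)"
  unfolding fr1_def sum_distrib_left by (rule sum.swap)

lemma fr1_zero: "fr1 P (\<lambda>i. 0) a = 0"
  by (simp add: fr1_def)

lemmas fr_linear = fr1_add fr1_diff fr1_minus fr1_cmult fr1_cmult_right fr1_zero

lemma fr1_swap: "fr1 P (\<lambda>i. fr1 P (\<lambda>j. T i j) b) a = fr1 P (\<lambda>j. fr1 P (\<lambda>i. T i j) a) b"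
  unfolding fr1_def sum_distrib_left by (subst sum.swap) (simp add: mult_ac)

lemma fr2_transpose: "fr2 P (\<lambda>i j. T j i) a b = fr2 P T b a"
  unfolding fr2_def by (rule fr1_swap)

lemma fr3_swap12: "fr3 P (\<lambda>i j k. T j i k) a b c = fr3 P T b a c"
  unfolding fr3_def fr2_def by (rule fr1_swap)

lemma fr3_swap23: "fr3 P (\<lambda>i j k. T i k j) a b c = fr3 P T a c b"
  unfolding fr3_def by (rule arg_cong[of _ _ "\<lambda>X. fr1 P X a"], rule ext, rule fr2_transpose)

lemma fr4_swap12: "fr4 P (\<lambda>i j k l. T j i k l) a b c d = fr4 P T b a c d"
  unfolding fr4_def fr3_def by (rule fr1_swap)

lemma fr4_swap23: "fr4 P (\<lambda>i j k l. T i k j l) a b c d = fr4 P T a c b d"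
  unfolding fr4_def by (rule arg_cong[of _ _ "\<lambda>X. fr1 P X a"], rule ext, rule fr3_swap12)

lemma fr4_swap34: "fr4 P (\<lambda>i j k l. T i j l k) a b c d = fr4 P T a b d c"
  unfolding fr4_def by (rule arg_cong[of _ _ "\<lambda>X. fr1 P X a"], rule ext, rule fr3_swap23)

lemma contract_frame:
  assumes h: "\<And>i j. h i j = (\<Sum>a\<in>UNIV. P i a * P j a)"
  shows "(\<Sum>i\<in>UNIV. \<Sum>j\<in>UNIV. h i j * T i j) = (\<Sum>a\<in>UNIV. fr2 P T a a)"
proof -
  have "(\<Sum>i\<in>UNIV. \<Sum>j\<in>UNIV. h i j * T i j) = (\<Sum>i\<in>UNIV. \<Sum>j\<in>UNIV. \<Sum>a\<in>UNIV. P i a * (P j a * T i j))"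
    unfolding h sum_distrib_right by (simp add: mult.assoc)
  also have "\<dots> = (\<Sum>a\<in>UNIV. \<Sum>i\<in>UNIV. \<Sum>j\<in>UNIV. P i a * (P j a * T i j))"
    by (rule sum_rotate[symmetric])
  finally show ?thesis unfolding fr2_def fr1_def sum_distrib_left .
qed

lemma fr4_minus: "fr4 P (\<lambda>i j k l. - T i j k l) a b c d = - fr4 P T a b c d"
  by (simp add: fr4_def fr3_def fr2_def fr1_minus)

lemma fr4_swap_pairs: "fr4 P (\<lambda>i j k l. T k l i j) a b c d = fr4 P T c d a b"
proof -
  have "fr4 P (\<lambda>i j k l. T k l i j) a b c d = fr4 P (\<lambda>i j k l. T j l i k) a c b d"
    by (rule fr4_swap23[of P "\<lambda>i j k l. T j l i k" a b c d])
  also have "\<dots> = fr4 P (\<lambda>i j k l. T i l j k) c a b d"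
    by (rule fr4_swap12[of P "\<lambda>i j k l. T i l j k" a c b d])
  also have "\<dots> = fr4 P (\<lambda>i j k l. T i k j l) c a d b"
    by (rule fr4_swap34[of P "\<lambda>i j k l. T i k j l" c a b d])
  also have "\<dots> = fr4 P T c d a b"
    by (rule fr4_swap23)
  finally show ?thesis .
qed

lemma fr4_swap_contraction: "fr4 P (\<lambda>i j k l. T k j l i) a b c d = fr4 P T c b d a"
proof -
  have "fr4 P (\<lambda>i j k l. T k j l i) a b c d = fr4 P (\<lambda>i j k l. T k i l j) b a c d"
    by (rule fr4_swap12[of P "\<lambda>i j k l. T k i l j" a b c d])
  also have "\<dots> = fr4 P (\<lambda>i j k l. T j i l k) b c a d"
    by (rule fr4_swap23[of P "\<lambda>i j k l. T j i l k" b a c d])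
  also have "\<dots> = fr4 P (\<lambda>i j k l. T i j l k) c b a d"
    by (rule fr4_swap12[of P "\<lambda>i j k l. T i j l k" b c a d])
  also have "\<dots> = fr4 P T c b d a"
    by (rule fr4_swap34)
  finally show ?thesis .
qed

lemma fr1_fr2: "fr1 P (\<lambda>k. fr2 P (\<lambda>i j. T i j k) a b) c = fr3 P T a b c"
proof -
  have "fr1 P (\<lambda>k. fr2 P (\<lambda>i j. T i j k) a b) c = fr1 P (\<lambda>i. fr1 P (\<lambda>k. fr1 P (\<lambda>j. T i j k) b) c) a"
    unfolding fr2_def by (rule fr1_swap)
  also have "\<dots> = fr3 P T a b c"
    unfolding fr3_def fr2_def by (rule arg_cong[of _ _ "\<lambda>X. fr1 P X a"], rule ext, rule fr1_swap)
  finally show ?thesis .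
qed

lemma fr1_fr3: "fr1 P (\<lambda>l. fr3 P (\<lambda>i j k. T i j k l) a b c) d = fr4 P T a b c d"
proof -
  have "fr1 P (\<lambda>l. fr3 P (\<lambda>i j k. T i j k l) a b c) d
      = fr1 P (\<lambda>i. fr1 P (\<lambda>l. fr2 P (\<lambda>j k. T i j k l) b c) d) a"
    unfolding fr3_def by (rule fr1_swap)
  also have "\<dots> = fr4 P T a b c d"
    unfolding fr4_def by (rule arg_cong[of _ _ "\<lambda>X. fr1 P X a"], rule ext, rule fr1_fr2)
  finally show ?thesis .
qed

lemma fr2_add: "fr2 P (\<lambda>i j. T i j + U i j) a b = fr2 P T a b + fr2 P U a b"
  and fr2_cmult: "fr2 P (\<lambda>i j. c * T i j) a b = c * fr2 P T a b"
  and fr2_cmult_right: "fr2 P (\<lambda>i j. T i j * c) a b = fr2 P T a b * c"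
  and fr2_prod: "fr2 P (\<lambda>i j. X i * Y j) a b = fr1 P X a * fr1 P Y b"
  by (simp_all only: fr2_def fr_linear)

lemma fr2_sum: "fr2 P (\<lambda>i j. \<Sum>p\<in>I. T i j p) a b = (\<Sum>p\<in>I. fr2 P (\<lambda>i j. T i j p) a b)"
  by (simp only: fr2_def fr1_sum)

lemma fr2_fr1: "fr2 P (\<lambda>i j. fr1 P (\<lambda>p. T p i j) c) a b = fr3 P T c a b"
proof -
  have "fr2 P (\<lambda>i j. fr1 P (\<lambda>p. T p i j) c) a b = fr1 P (\<lambda>i. fr1 P (\<lambda>p. fr1 P (T p i) b) c) a"
    unfolding fr2_def by (rule arg_cong[of _ _ "\<lambda>X. fr1 P X a"], rule ext, rule fr1_swap)
  also have "\<dots> = fr3 P T c a b" unfolding fr3_def fr2_def by (rule fr1_swap)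
  finally show ?thesis .
qed

lemma fr3_fr1: "fr3 P (\<lambda>i j k. fr1 P (\<lambda>p. T p i j k) d) a b c = fr4 P T d a b c"
proof -
  have "fr3 P (\<lambda>i j k. fr1 P (\<lambda>p. T p i j k) d) a b c = fr1 P (\<lambda>i. fr1 P (\<lambda>p. fr2 P (T p i) b c) d) a"
    unfolding fr3_def[of P "\<lambda>i j k. fr1 P (\<lambda>p. T p i j k) d"] fr2_fr1 unfolding fr3_def ..
  also have "\<dots> = fr4 P T d a b c" unfolding fr4_def fr3_def by (rule fr1_swap)
  finally show ?thesis .
qed

lemma fr2_fr2: "fr2 P (\<lambda>i j. fr2 P (\<lambda>p q. T p q j i) b c) d a = fr4 P T b c a d"
  unfolding fr2_def[of P "\<lambda>i j. fr2 P (\<lambda>p q. T p q j i) b c"] fr1_fr2 by (rule fr1_fr3)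

lemma fr3_diff: "fr3 P (\<lambda>i j k. T i j k - U i j k) a b c = fr3 P T a b c - fr3 P U a b c"
  by (simp only: fr3_def fr2_def fr_linear)

lemma fr4_diff: "fr4 P (\<lambda>i j k l. T i j k l - U i j k l) a b c d = fr4 P T a b c d - fr4 P U a b c d"
  by (simp only: fr4_def fr3_def fr2_def fr_linear)

lemma fr4_sum: "fr4 P (\<lambda>i j k l. \<Sum>p\<in>I. T i j k l p) a b c d = (\<Sum>p\<in>I. fr4 P (\<lambda>i j k l. T i j k l p) a b c d)"
  by (simp only: fr4_def fr3_def fr2_def fr1_sum)

lemma fr4_prod: "fr4 P (\<lambda>i j k l. T i k l * w j) a b c d = fr3 P T a c d * fr1 P w b"
  "fr4 P (\<lambda>i j k l. T j k l * w i) a b c d = fr3 P T b c d * fr1 P w a"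
  by (simp_all only: fr4_def fr3_def fr2_def fr_linear)

context metric_chart
begin

definition orthonormal_frame :: "real^'n \<Rightarrow> ('n \<Rightarrow> 'n \<Rightarrow> real) \<Rightarrow> bool" where
  "orthonormal_frame x P \<longleftrightarrow> (\<forall>i j. h i j x = (\<Sum>a\<in>UNIV. P i a * P j a))
     \<and> (\<forall>a b. fr2 P (\<lambda>i j. g i j x) a b = (if a = b then 1 else 0))"

text \<open>Gram-Schmidt: as long as fewer vectors than the dimension have been chosen there is a nonzero
  vector orthogonal to all of them.\<close>

lemma orthonormal_family:
  assumes x: "x \<in> S" and J: "finite J"
  shows "\<exists>e :: 'n \<Rightarrow> real^'n. \<forall>a\<in>J. \<forall>b\<in>J. e a \<bullet> (G x *v e b) = (if a = b then 1 else 0)"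
  using J
proof (induction J)
  case (insert c J)
  then obtain e :: "'n \<Rightarrow> real^'n"
    where e: "\<forall>a\<in>J. \<forall>b\<in>J. e a \<bullet> (G x *v e b) = (if a = b then 1 else 0)" by auto
  have sym: "u \<bullet> (G x *v w) = w \<bullet> (G x *v u)" for u w
  proof -
    have "transpose (G x) = G x" by (simp add: vec_eq_iff transpose_def sym_G[OF x])
    then show ?thesis by (metis dot_lmul_matrix inner_commute transpose_matrix_vector)
  qed
  have "dim ((\<lambda>a. G x *v e a) ` J) \<le> card J"
    by (rule order_trans[OF dim_le_card' card_image_le]) (simp_all add: insert.hyps)
  also have "card J < card (insert c J)" using insert.hyps by simp
  also have "card (insert c J) \<le> CARD('n)" by (rule card_mono) simp_all
  finally have "dim ((\<lambda>a. G x *v e a) ` J) < DIM(real^'n)" by simp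
  then obtain u where u: "u \<noteq> 0" "\<And>y. y \<in> span ((\<lambda>a. G x *v e a) ` J) \<Longrightarrow> orthogonal u y"
    by (rule orthogonal_to_subspace_exists) blast
  define r where "r = sqrt (u \<bullet> (G x *v u))"
  have r: "r > 0" "r * r = u \<bullet> (G x *v u)" using pos_G[OF x u(1)] by (simp_all add: r_def)
  define w where "w = (1/r) *\<^sub>R u"
  have "w \<bullet> (G x *v w) = (1/r) * (1/r) * (u \<bullet> (G x *v u))"
    by (simp add: w_def matrix_vector_mult_scaleR)
  also have "\<dots> = 1" unfolding r(2)[symmetric] using r(1) by simp
  finally have ww: "w \<bullet> (G x *v w) = 1" .
  have we: "w \<bullet> (G x *v e a) = 0" if "a \<in> J" for a
    using u(2)[OF span_base[OF imageI[OF that]]] by (simp add: w_def orthogonal_def)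
  have ew: "e a \<bullet> (G x *v w) = 0" if "a \<in> J" for a
    using we[OF that] sym by simp
  have "\<forall>a\<in>insert c J. \<forall>b\<in>insert c J.
      (e(c := w)) a \<bullet> (G x *v (e(c := w)) b) = (if a = b then 1 else 0)"
    using e ww we ew insert.hyps by auto
  then show ?case by blast
qed simp

lemma orthonormal_frame_exists:
  assumes x: "x \<in> S" shows "\<exists>P. orthonormal_frame x P"
proof -
  obtain e :: "'n \<Rightarrow> real^'n" where
    e: "\<And>a b. e a \<bullet> (G x *v e b) = (if a = b then 1 else 0)"
    using orthonormal_family[OF x finite_class.finite_UNIV] by auto
  define P where "P i a = e a $ i" for i a
  define Q :: "real^'n^'n" where "Q = (\<chi> i a. P i a)"
  have f: "fr2 P (\<lambda>i j. g i j x) a b = (if a = b then 1 else 0)" for a b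
    unfolding e[of a b, symmetric] fr2_def fr1_def
    by (simp add: P_def inner_vec_def matrix_vector_mult_def mult_ac)
  have "(transpose Q ** (G x ** Q)) $ a $ b = fr2 P (\<lambda>i j. g i j x) a b" for a b
    by (simp add: matrix_matrix_mult_def transpose_def Q_def fr2_def fr1_def mult.commute[of "P _ b"])
  then have "transpose Q ** (G x ** Q) = mat 1"
    by (simp add: vec_eq_iff mat_def f)
  then have "transpose Q ** G x ** Q = mat 1" by (simp only: matrix_mul_assoc)
  then have "Q ** (transpose Q ** G x) = mat 1" using matrix_left_right_inverse by blast
  then have "Q ** transpose Q ** G x ** Ginv G x = mat 1 ** Ginv G x"
    by (simp only: matrix_mul_assoc)
  then have "Q ** transpose Q = Ginv G x"
    unfolding matrix_mul_assoc[symmetric] Ginv_def matrix_inv_nonsingular(1)[OF det_G[OF x]] by simp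
  then have "h i j x = (Q ** transpose Q) $ i $ j" for i j by simp
  then have "h i j x = (\<Sum>a\<in>UNIV. P i a * P j a)" for i j
    by (simp add: matrix_matrix_mult_def transpose_def Q_def)
  with f show ?thesis unfolding orthonormal_frame_def by blast
qed

text \<open>A frame spans, so tensor identities may be verified in a frame and read off in coordinates.\<close>

lemma fr1_inject:
  assumes x: "x \<in> S" and P: "orthonormal_frame x P" and eq: "\<And>a. fr1 P X a = fr1 P Y a"
  shows "X = Y"
proof
  fix i
  have recover: "X i = (\<Sum>k\<in>UNIV. g i k x * (\<Sum>a\<in>UNIV. P k a * fr1 P X a))" for X
  proof -
    have "(\<Sum>a\<in>UNIV. P k a * fr1 P X a) = (\<Sum>m\<in>UNIV. h k m x * X m)" for k
      unfolding fr1_def sum_distrib_left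
      by (subst sum.swap) (use P in \<open>simp add: orthonormal_frame_def sum_distrib_right mult.assoc\<close>)
    then show ?thesis using lower_raise[OF x, of i X] by simp
  qed
  have "X i = (\<Sum>k\<in>UNIV. g i k x * (\<Sum>a\<in>UNIV. P k a * fr1 P Y a))"
    using recover[of X] unfolding eq .
  then show "X i = Y i" using recover[of Y] by simp
qed

lemma fr4_inject:
  assumes x: "x \<in> S" and P: "orthonormal_frame x P" and eq: "\<And>a b c d. fr4 P T a b c d = fr4 P U a b c d"
  shows "T i j k l = U i j k l"
proof -
  have "(\<lambda>i. fr3 P (T i) b c d) = (\<lambda>i. fr3 P (U i) b c d)" for b c d
    by (rule fr1_inject[OF x P]) (rule eq[unfolded fr4_def])
  then have e3: "fr3 P (T i) b c d = fr3 P (U i) b c d" for b c d by (rule fun_cong)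
  have "(\<lambda>j. fr2 P (T i j) c d) = (\<lambda>j. fr2 P (U i j) c d)" for c d
    by (rule fr1_inject[OF x P]) (rule e3[unfolded fr3_def])
  then have e2: "fr2 P (T i j) c d = fr2 P (U i j) c d" for c d by (rule fun_cong)
  have "(\<lambda>k. fr1 P (T i j k) d) = (\<lambda>k. fr1 P (U i j k) d)" for d
    by (rule fr1_inject[OF x P]) (rule e2[unfolded fr2_def])
  then have e1: "fr1 P (T i j k) d = fr1 P (U i j k) d" for d by (rule fun_cong)
  have "T i j k = U i j k" by (rule fr1_inject[OF x P e1])
  then show ?thesis by (rule fun_cong)
qed

lemma frame_h: "orthonormal_frame x P \<Longrightarrow> h i j x = (\<Sum>a\<in>UNIV. P i a * P j a)"
  unfolding orthonormal_frame_def by blast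

lemma frame_g: "orthonormal_frame x P \<Longrightarrow> fr2 P (\<lambda>i j. g i j x) a b = (if a = b then 1 else 0)"
  unfolding orthonormal_frame_def by blast

lemma contract_h:
  assumes "orthonormal_frame x P"
  shows "(\<Sum>i\<in>UNIV. \<Sum>j\<in>UNIV. h i j x * T i j) = (\<Sum>a\<in>UNIV. fr2 P T a a)"
  by (rule contract_frame[of "\<lambda>i j. h i j x", OF frame_h[OF assms]])

lemma norm3_sq_frame:
  assumes P: "orthonormal_frame x P"
  shows "norm3_sq G T x = (\<Sum>a\<in>UNIV. \<Sum>b\<in>UNIV. \<Sum>c\<in>UNIV.
    fr3 P (\<lambda>i j k. T i j k x) a b c * fr3 P (\<lambda>i j k. T i j k x) a b c)"
proof -
  have "norm3_sq G T x = (\<Sum>i\<in>UNIV. \<Sum>a\<in>UNIV. h i a x * (\<Sum>j\<in>UNIV. \<Sum>b\<in>UNIV. h j b x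
      * (\<Sum>k\<in>UNIV. \<Sum>c\<in>UNIV. h k c x * (T i j k x * T a b c x))))"
    unfolding norm3_sq_def sum_distrib_left
  proof (rule sum.cong[OF refl])
    fix i
    let ?F = "\<lambda>j k a b c. h i a x * h j b x * h k c x * T i j k x * T a b c x"
    have "(\<Sum>j\<in>UNIV. \<Sum>k\<in>UNIV. \<Sum>a\<in>UNIV. \<Sum>b\<in>UNIV. \<Sum>c\<in>UNIV. ?F j k a b c)
        = (\<Sum>a\<in>UNIV. \<Sum>j\<in>UNIV. \<Sum>k\<in>UNIV. \<Sum>b\<in>UNIV. \<Sum>c\<in>UNIV. ?F j k a b c)"
      by (rule sum_rotate[symmetric])
    also have "\<dots> = (\<Sum>a\<in>UNIV. \<Sum>j\<in>UNIV. \<Sum>b\<in>UNIV. \<Sum>k\<in>UNIV. \<Sum>c\<in>UNIV. ?F j k a b c)"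
      by (rule sum.cong[OF refl], rule sum.cong[OF refl], rule sum.swap)
    finally show "(\<Sum>j\<in>UNIV. \<Sum>k\<in>UNIV. \<Sum>a\<in>UNIV. \<Sum>b\<in>UNIV. \<Sum>c\<in>UNIV. ?F j k a b c)
        = (\<Sum>a\<in>UNIV. \<Sum>j\<in>UNIV. \<Sum>b\<in>UNIV. \<Sum>k\<in>UNIV. \<Sum>c\<in>UNIV.
            h i a x * (h j b x * (h k c x * (T i j k x * T a b c x))))"
      by (simp only: mult.assoc)
  qed
  then show ?thesis
    unfolding contract_h[OF P] by (simp add: fr3_def fr2_def fr1_sum fr_linear)
qed

lemma endo_det_frame:
  assumes P: "orthonormal_frame x P"
  shows "endo_det G T x = det (\<chi> a b. fr2 P (\<lambda>i j. T x $ i $ j) a b)"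
proof -
  define Q :: "real^'n^'n" where "Q = (\<chi> i a. P i a)"
  have "Ginv G x = Q ** transpose Q"
    using frame_h[OF P] by (simp add: vec_eq_iff matrix_matrix_mult_def transpose_def Q_def)
  moreover have "(\<chi> a b. fr2 P (\<lambda>i j. T x $ i $ j) a b) = transpose Q ** (T x ** Q)"
    by (simp add: vec_eq_iff matrix_matrix_mult_def transpose_def Q_def fr2_def fr1_def mult.commute[of "P _ _" "_ $ _"])
  ultimately show ?thesis by (simp add: endo_det_def det_mul)
qed


lemma ricci_identity2_frame:
  assumes x: "x \<in> S" and P: "orthonormal_frame x P" and T: "\<And>i j. smooth_fun_on S (T i j)"
  shows "fr4 P (\<lambda>i j k l. D3 (D2 T) i j k l x) a b c d - fr4 P (\<lambda>i j k l. D3 (D2 T) i j k l x) a b d c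
    = - (\<Sum>p\<in>UNIV. fr4 P (\<lambda>i j k l. Rm i j k l x) p a d c * fr2 P (\<lambda>i j. T i j x) p b
        + fr4 P (\<lambda>i j k l. Rm i j k l x) p b d c * fr2 P (\<lambda>i j. T i j x) a p)"
proof -
  have low: "(\<Sum>p\<in>UNIV. riem G p i l k x * X p) = (\<Sum>p\<in>UNIV. fr1 P (\<lambda>a. Rm a i l k x) p * fr1 P X p)" for i l k X
  proof -
    have "(\<Sum>p\<in>UNIV. riem G p i l k x * X p) = (\<Sum>a\<in>UNIV. \<Sum>b\<in>UNIV. h a b x * (Rm a i l k x * X b))"
      unfolding riem_eq_Rm[OF x] sum_distrib_right
      by (subst sum.swap) (simp add: sym_h[OF x] mult_ac)
    then show ?thesis unfolding contract_h[OF P] fr2_prod .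
  qed
  have "fr4 P (\<lambda>i j k l. D3 (D2 T) i j k l x) a b c d - fr4 P (\<lambda>i j k l. D3 (D2 T) i j l k x) a b c d
      = fr4 P (\<lambda>i j k l. - (\<Sum>p\<in>UNIV. fr1 P (\<lambda>a. Rm a i l k x) p * fr1 P (\<lambda>a. T a j x) p)
        - (\<Sum>p\<in>UNIV. fr1 P (\<lambda>a. Rm a j l k x) p * fr1 P (\<lambda>a. T i a x) p)) a b c d"
    unfolding fr4_diff[symmetric] ricci_identity2[of x T, OF x T] low ..
  also have "\<dots> = - (\<Sum>p\<in>UNIV. fr3 P (\<lambda>i k l. fr1 P (\<lambda>a. Rm a i l k x) p) a c d * fr1 P (\<lambda>j. fr1 P (\<lambda>a. T a j x) p) b)
      - (\<Sum>p\<in>UNIV. fr3 P (\<lambda>j k l. fr1 P (\<lambda>a. Rm a j l k x) p) b c d * fr1 P (\<lambda>i. fr1 P (\<lambda>a. T i a x) p) a)"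
    by (simp only: fr4_diff fr4_minus fr4_sum fr4_prod)
  finally have e: "fr4 P (\<lambda>i j k l. D3 (D2 T) i j k l x) a b c d - fr4 P (\<lambda>i j k l. D3 (D2 T) i j l k x) a b c d
    = - (\<Sum>p\<in>UNIV. fr3 P (\<lambda>i k l. fr1 P (\<lambda>a. Rm a i l k x) p) a c d * fr1 P (\<lambda>j. fr1 P (\<lambda>a. T a j x) p) b)
      - (\<Sum>p\<in>UNIV. fr3 P (\<lambda>j k l. fr1 P (\<lambda>a. Rm a j l k x) p) b c d * fr1 P (\<lambda>i. fr1 P (\<lambda>a. T i a x) p) a)" .
  have r1: "fr3 P (\<lambda>i k l. fr1 P (\<lambda>a. Rm a i l k x) p) a c d = fr4 P (\<lambda>i j k l. Rm i j k l x) p a d c" for p a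
    unfolding fr3_swap23[of P "\<lambda>i l k. fr1 P (\<lambda>a. Rm a i l k x) p"] by (rule fr3_fr1)
  have r2: "fr1 P (\<lambda>j. fr1 P (\<lambda>a. T a j x) p) b = fr2 P (\<lambda>i j. T i j x) p b" for p
    unfolding fr2_def by (rule fr1_swap)
  have r3: "fr1 P (\<lambda>i. fr1 P (\<lambda>a. T i a x) p) a = fr2 P (\<lambda>i j. T i j x) a p" for p
    unfolding fr2_def ..
  show ?thesis
    using e unfolding r1 r2 r3 fr4_swap34[of P "\<lambda>i j k l. D3 (D2 T) i j k l x"]
    by (simp add: sum.distrib)
qed

section \<open>Leibniz rules, divergence and norms\<close>

lemma D2_cong:
  assumes "x \<in> S" "\<And>i j y. y \<in> S \<Longrightarrow> T i j y = U i j y" "\<And>i j. smooth_fun_on S (T i j)"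
  shows "D2 T i j k x = D2 U i j k x"
  unfolding D2_def using partial_cong[OF open_S assms(1), of "T i j" "U i j"] assms by simp

lemma D3_cong:
  assumes "x \<in> S" "\<And>i j k y. y \<in> S \<Longrightarrow> T i j k y = U i j k y" "\<And>i j k. smooth_fun_on S (T i j k)"
  shows "D3 T i j k l x = D3 U i j k l x"
  unfolding D3_def using partial_cong[OF open_S assms(1), of "T i j k" "U i j k"] assms by simp

context
  fixes x :: "real^'n"
  assumes x: "x \<in> S"
begin

lemma D2_diff: "(\<And>i j. smooth_fun_on S (T i j)) \<Longrightarrow> (\<And>i j. smooth_fun_on S (U i j))
  \<Longrightarrow> D2 (\<lambda>i j y. T i j y - U i j y) i j k x = D2 T i j k x - D2 U i j k x"
  by (simp add: D2_def partial_diff[OF x] act_diff)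

lemma D2_scale: "smooth_fun_on S s \<Longrightarrow> (\<And>i j. smooth_fun_on S (T i j))
  \<Longrightarrow> D2 (\<lambda>i j y. s y * T i j y) i j k x = s x * D2 T i j k x + partial k s x * T i j x"
  by (simp add: D2_def partial_mult[OF x] act_cmult algebra_simps)

lemma D1_scale: "smooth_fun_on S s \<Longrightarrow> (\<And>i. smooth_fun_on S (w i))
  \<Longrightarrow> D1 (\<lambda>i y. s y * w i y) i k x = s x * D1 w i k x + partial k s x * w i x"
  by (simp add: D1_def partial_mult[OF x] act_cmult algebra_simps)

lemma D3_diff: "(\<And>i j k. smooth_fun_on S (T i j k)) \<Longrightarrow> (\<And>i j k. smooth_fun_on S (U i j k))
  \<Longrightarrow> D3 (\<lambda>i j k y. T i j k y - U i j k y) i j k l x = D3 T i j k l x - D3 U i j k l x"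
  by (simp add: D3_def partial_diff[OF x] act_diff)

lemma D3_add: "(\<And>i j k. smooth_fun_on S (T i j k)) \<Longrightarrow> (\<And>i j k. smooth_fun_on S (U i j k))
  \<Longrightarrow> D3 (\<lambda>i j k y. T i j k y + U i j k y) i j k l x = D3 T i j k l x + D3 U i j k l x"
  by (simp add: D3_def partial_add[OF x] act_add)

lemma D3_scale: "smooth_fun_on S s \<Longrightarrow> (\<And>i j k. smooth_fun_on S (T i j k))
  \<Longrightarrow> D3 (\<lambda>i j k y. s y * T i j k y) i j k l x = s x * D3 T i j k l x + partial l s x * T i j k x"
  by (simp add: D3_def partial_mult[OF x] act_cmult algebra_simps)

lemma D3_cmult: "(\<And>i j k. smooth_fun_on S (T i j k))
  \<Longrightarrow> D3 (\<lambda>i j k y. c * T i j k y) i j k l x = c * D3 T i j k l x"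
  by (simp add: D3_def partial_cmult[OF x] act_cmult algebra_simps)

lemma D3_swap: "D3 (\<lambda>i j k. T i k j) i j k l x = D3 T i k j l x"
  by (simp add: D3_def)

lemma D3_prod: "(\<And>i j. smooth_fun_on S (T i j)) \<Longrightarrow> (\<And>i. smooth_fun_on S (w i))
  \<Longrightarrow> D3 (\<lambda>i j k y. T i j y * w k y) i j k l x = D2 T i j l x * w k x + T i j x * D1 w k l x"
  by (simp add: D3_def D2_def D1_def partial_mult[OF x] act_cmult act_cmult_right algebra_simps)

lemma D4_prod: "(\<And>i j. smooth_fun_on S (T i j)) \<Longrightarrow> (\<And>i j. smooth_fun_on S (U i j))
  \<Longrightarrow> D4 (\<lambda>i a j b y. T i j y * U a b y) i a j b k x = D2 T i j k x * U a b x + T i j x * D2 U a b k x"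
  by (simp add: D4_def D2_def partial_mult[OF x] act_cmult act_cmult_right algebra_simps)

text \<open>The divergence of a vector field is the trace of the covariant derivative of the dual covector
  field. It comes from the formula for \<open>\<partial>g\<^sup>-\<^sup>1\<close>, one term of which cancels the trace of \<open>\<Gamma>\<close> in the
  definition of the divergence.\<close>

lemma divergence_raise:
  assumes w: "\<And>i. smooth_fun_on S (w i)"
  shows "divergence G (\<lambda>y. \<chi> i. \<Sum>j\<in>UNIV. h i j y * w j y) x
    = (\<Sum>i\<in>UNIV. \<Sum>j\<in>UNIV. h i j x * D1 w j i x)"
proof -
  have 1: "(\<Sum>i\<in>UNIV. \<Sum>j\<in>UNIV. (\<Sum>l\<in>UNIV. \<Gamma> j i l x * h i l x) * w j x)
      = (\<Sum>i\<in>UNIV. \<Sum>j\<in>UNIV. h i j x * act i x (\<lambda>a. w a x) j)"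
    unfolding act_def sum_distrib_right sum_distrib_left
    by (rule sum.cong[OF refl], subst sum.swap) (simp add: mult_ac)
  have 2: "(\<Sum>i\<in>UNIV. \<Sum>j\<in>UNIV. (\<Sum>l\<in>UNIV. \<Gamma> i i l x * h l j x) * w j x)
      = (\<Sum>i\<in>UNIV. \<Sum>j\<in>UNIV. \<Gamma> i i j x * (\<Sum>l\<in>UNIV. h j l x * w l x))"
    unfolding sum_distrib_right sum_distrib_left
    by (rule sum.cong[OF refl], subst sum.swap) (simp add: mult_ac)
  have "divergence G (\<lambda>y. \<chi> i. \<Sum>j\<in>UNIV. h i j y * w j y) x
      = (\<Sum>i\<in>UNIV. \<Sum>j\<in>UNIV. h i j x * partial i (w j) x)
        + (\<Sum>i\<in>UNIV. \<Sum>j\<in>UNIV. partial i (h i j) x * w j x)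
        + (\<Sum>i\<in>UNIV. \<Sum>j\<in>UNIV. \<Gamma> i i j x * (\<Sum>l\<in>UNIV. h j l x * w l x))"
    unfolding divergence_def
    by (simp add: partial_sum[OF x] partial_mult[OF x] smooth_mult[OF open_S] smooth_h w sum.distrib)
  then show ?thesis
    unfolding partial_h[OF x] D1_def left_diff_distrib right_diff_distrib sum_subtractf
      mult_minus_left sum_negf 1 2 by simp
qed

lemma divergence_scaled_grad:
  assumes v: "smooth_fun_on S v" and f: "smooth_fun_on S f"
  shows "divergence G (\<lambda>y. v y *\<^sub>R grad G f y) x
    = (\<Sum>i\<in>UNIV. \<Sum>j\<in>UNIV. h i j x * (v x * D1 (\<lambda>k. partial k f) j i x + partial i v x * partial j f x))"
proof -
  have "(\<lambda>y. v y *\<^sub>R grad G f y) = (\<lambda>y. \<chi> i. \<Sum>j\<in>UNIV. h i j y * (v y * partial j f y))"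
    by (rule ext) (simp add: grad_def vec_eq_iff sum_distrib_left mult_ac)
  then show ?thesis
    by (simp add: divergence_raise smooth_mult[OF open_S] v f smooth_partial D1_scale)
qed

end

text \<open>The contractions are nested so that each of them is of the form treated in \<open>partial_contract\<close> and
  \<open>D2_contract\<close>.\<close>

definition ip2 :: "real^'n \<Rightarrow> ('n \<Rightarrow> 'n \<Rightarrow> real) \<Rightarrow> ('n \<Rightarrow> 'n \<Rightarrow> real) \<Rightarrow> real" where
  "ip2 x T U = (\<Sum>i\<in>UNIV. \<Sum>a\<in>UNIV. h i a x * (\<Sum>j\<in>UNIV. \<Sum>b\<in>UNIV. h j b x * (T i j * U a b)))"

lemma norm2_sq_ip2: "norm2_sq G T x = ip2 x (\<lambda>i j. T x $ i $ j) (\<lambda>i j. T x $ i $ j)"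
  unfolding norm2_sq_def ip2_def sum_distrib_left
  by (rule sum.cong[OF refl], subst sum.swap) (simp add: mult_ac)

lemma ip2_frame:
  assumes P: "orthonormal_frame x P"
  shows "ip2 x T U = (\<Sum>a\<in>UNIV. \<Sum>b\<in>UNIV. fr2 P T a b * fr2 P U a b)"
proof -
  have h: "h i j x = (\<Sum>a\<in>UNIV. P i a * P j a)" for i j
    using P unfolding orthonormal_frame_def by blast
  note c = contract_frame[of "\<lambda>i j. h i j x" P, OF h]
  show ?thesis
    unfolding ip2_def c by (simp add: fr2_def fr1_sum fr_linear)
qed

lemma ip2_commute: "x \<in> S \<Longrightarrow> ip2 x T U = ip2 x U T"
  using orthonormal_frame_exists[of x] by (auto simp: ip2_frame mult.commute)

lemma ip2_add: "ip2 x T (\<lambda>i j. U i j + W i j) = ip2 x T U + ip2 x T W"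
  by (simp add: ip2_def distrib_left sum.distrib)

lemma ip2_act: "ip2 x T (\<lambda>i j. act l x (\<lambda>a. U i j a) k) = act l x (\<lambda>a. ip2 x T (\<lambda>i j. U i j a)) k"
  unfolding ip2_def act_sum act_cmult ..

lemma smooth_ip2:
  assumes "\<And>i j. smooth_fun_on S (T i j)" "\<And>i j. smooth_fun_on S (U i j)"
  shows "smooth_fun_on S (\<lambda>y. ip2 y (\<lambda>i j. T i j y) (\<lambda>i j. U i j y))"
  unfolding ip2_def by (intro smooth_sum[OF open_S] smooth_mult[OF open_S] smooth_h assms)

lemma partial_ip2:
  assumes x: "x \<in> S" and T: "\<And>i j. smooth_fun_on S (T i j)" and U: "\<And>i j. smooth_fun_on S (U i j)"
  shows "partial k (\<lambda>y. ip2 y (\<lambda>i j. T i j y) (\<lambda>i j. U i j y)) x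
    = ip2 x (\<lambda>i j. D2 T i j k x) (\<lambda>i j. U i j x) + ip2 x (\<lambda>i j. T i j x) (\<lambda>i j. D2 U i j k x)"
proof -
  let ?Q = "\<lambda>i a y. \<Sum>j\<in>UNIV. \<Sum>b\<in>UNIV. h j b y * (T i j y * U a b y)"
  have Q: "smooth_fun_on S (?Q i a)" for i a
    by (intro smooth_sum[OF open_S] smooth_mult[OF open_S] smooth_h T U)
  have "D2 ?Q i a k x = (\<Sum>j\<in>UNIV. \<Sum>b\<in>UNIV. h j b x * (D2 T i j k x * U a b x + T i j x * D2 U a b k x))" for i a
    using D2_contract[OF x, of "\<lambda>i a j b y. T i j y * U a b y"]
    by (simp add: smooth_mult[OF open_S] T U D4_prod[OF x])
  then show ?thesis
    unfolding ip2_def partial_contract[OF x Q] by (simp add: distrib_left sum.distrib)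
qed

text \<open>First and second derivatives of a squared norm; the Hessian is the one that enters
  Bochner's formula.\<close>

lemma partial_norm2:
  assumes x: "x \<in> S" and T: "\<And>i j. smooth_fun_on S (T i j)"
  shows "partial k (\<lambda>y. ip2 y (\<lambda>i j. T i j y) (\<lambda>i j. T i j y)) x
    = 2 * ip2 x (\<lambda>i j. T i j x) (\<lambda>i j. D2 T i j k x)"
  unfolding partial_ip2[OF x T T]
  using ip2_commute[OF x, of "\<lambda>i j. D2 T i j k x" "\<lambda>i j. T i j x"] by simp

lemma hessian_norm2:
  assumes x: "x \<in> S" and T: "\<And>i j. smooth_fun_on S (T i j)"
  shows "D1 (\<lambda>k. partial k (\<lambda>y. ip2 y (\<lambda>i j. T i j y) (\<lambda>i j. T i j y))) k l x
    = 2 * ip2 x (\<lambda>i j. D2 T i j l x) (\<lambda>i j. D2 T i j k x)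
      + 2 * ip2 x (\<lambda>i j. T i j x) (\<lambda>i j. D3 (D2 T) i j k l x)"
proof -
  let ?f = "\<lambda>y. ip2 y (\<lambda>i j. T i j y) (\<lambda>i j. T i j y)"
  let ?f' = "\<lambda>k y. ip2 y (\<lambda>i j. T i j y) (\<lambda>i j. D2 T i j k y)"
  have s: "smooth_fun_on S (?f' k)" for k by (rule smooth_ip2[OF T smooth_D2[OF T]])
  have f: "smooth_fun_on S ?f" by (rule smooth_ip2[OF T T])
  have "partial l (partial k ?f) x = partial l (\<lambda>y. 2 * ?f' k y) x"
    by (rule partial_cong[OF open_S x partial_norm2[OF _ T] smooth_partial[OF f]])
  also have "\<dots> = 2 * partial l (?f' k) x" by (rule partial_cmult[OF x s])
  also have "partial l (?f' k) x = ip2 x (\<lambda>i j. D2 T i j l x) (\<lambda>i j. D2 T i j k x)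
      + ip2 x (\<lambda>i j. T i j x) (\<lambda>i j. D2 (\<lambda>i j. D2 T i j k) i j l x)"
    by (rule partial_ip2[OF x T smooth_D2[OF T]])
  also have "(\<lambda>i j. D2 (\<lambda>i j. D2 T i j k) i j l x)
      = (\<lambda>i j. D3 (D2 T) i j k l x + act l x (\<lambda>a. D2 T i j a x) k)"
    by (simp add: D2_def[of "\<lambda>i j. D2 T i j k"] D3_def)
  finally show ?thesis
    by (simp add: D1_def ip2_add ip2_act partial_norm2[OF x T] act_cmult)
qed

lemma cov_deriv_D2: "cov_deriv G T i j k x = D2 (\<lambda>i j y. T y $ i $ j) i j k x"
  by (simp add: cov_deriv_def D2_def act_def sum.distrib)

lemma D2_transpose:
  assumes x: "x \<in> S" and sym: "\<And>i j y. y \<in> S \<Longrightarrow> T i j y = T j i y"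
    and T: "\<And>i j. smooth_fun_on S (T i j)"
  shows "D2 T i j k x = D2 T j i k x"
proof -
  have "D2 T i j k x = D2 (\<lambda>i j. T j i) i j k x" by (rule D2_cong[OF x sym T])
  then show ?thesis by (simp add: D2_def)
qed

lemma trace_g: "x \<in> S \<Longrightarrow> (\<Sum>i\<in>UNIV. \<Sum>j\<in>UNIV. h i j x * g i j x) = CARD('n)"
  using h_g[of x] sym_G[of x] by simp

end

section \<open>Algebra of three-dimensional curvature\<close>

abbreviation kd :: "3 \<Rightarrow> 3 \<Rightarrow> real" where "kd a b \<equiv> (if a = b then 1 else 0)"

text \<open>An algebraic curvature tensor in dimension three has six independent components, as many as its
  Ricci contraction \<open>r\<close>, and is therefore determined by \<open>r\<close>.\<close>

lemma curvature_dim3: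
  fixes K :: "3 \<Rightarrow> 3 \<Rightarrow> 3 \<Rightarrow> 3 \<Rightarrow> real"
  assumes a: "\<And>a b c d. K a b c d = - K b a c d" and b: "\<And>a b c d. K a b c d = - K a b d c"
    and p: "\<And>a b c d. K a b c d = K c d a b"
    and r: "\<And>b d. r b d = (\<Sum>a\<in>UNIV. K a b a d)" and s: "s = (\<Sum>a\<in>UNIV. r a a)"
    and e: "\<And>a b. e a b = r a b - s / 3 * kd a b"
  shows "K a b c d = e a c * kd b d + e b d * kd a c - e a d * kd b c - e b c * kd a d
    + s / 6 * (kd a c * kd b d - kd a d * kd b c)"
proof -
  have z: "K i i c d = 0" "K c d i i = 0" for i c d using a[of i i c d] b[of c d i i] by simp_all
  have l: "K 2 1 c d = - K 1 2 c d" "K 3 1 c d = - K 1 3 c d" "K 3 2 c d = - K 2 3 c d"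
    "K c d 2 1 = - K c d 1 2" "K c d 3 1 = - K c d 1 3" "K c d 3 2 = - K c d 2 3" for c d
    using a b by blast+
  have q: "K 1 3 1 2 = K 1 2 1 3" "K 2 3 1 2 = K 1 2 2 3" "K 2 3 1 3 = K 1 3 2 3"
    using p by blast+
  have "\<forall>a b c d. K a b c d = e a c * kd b d + e b d * kd a c - e a d * kd b c - e b c * kd a d
    + s / 6 * (kd a c * kd b d - kd a d * kd b c)"
    unfolding e s r forall_3 sum_3 by (simp add: z l q field_simps)
  then show ?thesis by blast
qed

text \<open>For a trace-free matrix with eigenvalues \<open>x, y, z\<close> this is \<open>x\<^sup>3 + y\<^sup>3 + z\<^sup>3 = 3 x y z\<close> when
  \<open>x + y + z = 0\<close>.\<close>

lemma trace_cube_dim3: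
  fixes e :: "3 \<Rightarrow> 3 \<Rightarrow> real"
  assumes sym: "\<And>a b. e a b = e b a" and tr: "(\<Sum>a\<in>UNIV. e a a) = 0"
  shows "(\<Sum>a\<in>UNIV. \<Sum>b\<in>UNIV. \<Sum>c\<in>UNIV. e a b * e b c * e c a) = 3 * det (\<chi> a b. e a b)"
proof -
  have t: "e 3 3 = - e 1 1 - e 2 2" using tr by (simp add: sum_3)
  have s: "e 2 1 = e 1 2" "e 3 1 = e 1 3" "e 3 2 = e 2 3" using sym by blast+
  show ?thesis unfolding det_3 sum_3 by (simp add: s t) algebra
qed

text \<open>The curvature terms that appear when the derivatives in \<open>\<nabla>\<^sub>c\<nabla>\<^sub>b E\<^sub>a\<^sub>c\<close> are interchanged,
  contracted with \<open>E\<^sub>a\<^sub>b\<close>; they equal \<open>3 tr E\<^sup>3 + R/2 |E|\<^sup>2\<close>.\<close>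

lemma commutator_dim3:
  fixes e :: "3 \<Rightarrow> 3 \<Rightarrow> real"
  assumes sym: "\<And>a b. e a b = e b a" and tr: "(\<Sum>a\<in>UNIV. e a a) = 0"
    and K: "\<And>a b c d. K a b c d = e a c * kd b d + e b d * kd a c - e a d * kd b c - e b c * kd a d
      + s / 6 * (kd a c * kd b d - kd a d * kd b c)"
  shows "- (\<Sum>a\<in>UNIV. \<Sum>b\<in>UNIV. e a b * (\<Sum>c\<in>UNIV. \<Sum>p\<in>UNIV. K p a c b * e p c + K p c c b * e a p))
    = 9 * det (\<chi> a b. e a b) + s / 2 * (\<Sum>a\<in>UNIV. \<Sum>b\<in>UNIV. e a b * e a b)"
proof -
  have t: "e 3 3 = - e 1 1 - e 2 2" using tr by (simp add: sum_3)
  have sy: "e 2 1 = e 1 2" "e 3 1 = e 1 3" "e 3 2 = e 2 3" using sym by blast+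
  define q where "q = (\<Sum>a\<in>UNIV. \<Sum>b\<in>UNIV. e a b * e a b)"
  have inner: "(\<Sum>c\<in>UNIV. \<Sum>p\<in>UNIV. K p a c b * e p c + K p c c b * e a p)
      = q * kd a b - 3 * (\<Sum>c\<in>UNIV. e a c * e c b) - s / 2 * e a b" for a b
    using exhaust_3[of a] exhaust_3[of b]
    by (elim disjE) (simp_all add: K sum_3 q_def t sy field_simps)
  have "(\<Sum>a\<in>UNIV. \<Sum>b\<in>UNIV. e a b * (\<Sum>c\<in>UNIV. \<Sum>p\<in>UNIV. K p a c b * e p c + K p c c b * e a p))
      = q * (\<Sum>a\<in>UNIV. e a a) - 3 * (\<Sum>a\<in>UNIV. \<Sum>b\<in>UNIV. \<Sum>c\<in>UNIV. e a b * e b c * e c a)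
        - s / 2 * q"
    unfolding inner by (simp add: q_def sum_3 sy algebra_simps)
  then show ?thesis
    unfolding trace_cube_dim3[of e, OF sym tr] tr q_def by simp
qed

text \<open>The pointwise identity behind the theorem, in an orthonormal basis: \<open>e\<close>, \<open>n\<close>, \<open>m\<close> stand for
  \<open>E\<close>, \<open>\<nabla>E\<close>, \<open>\<nabla>\<nabla>E\<close> and \<open>V\<close>, \<open>H\<close> for the differential and the Hessian of the potential, whose value
  is \<open>v\<close>. Let \<open>C\<^sub>a\<^sub>b\<^sub>c = n\<^sub>a\<^sub>b\<^sub>c - n\<^sub>a\<^sub>c\<^sub>b\<close>. The trace of \<open>C2\<close> over the last two slots, contracted with \<open>e\<close>,
  trades \<open>v \<langle>E, \<Delta>E\<rangle>\<close> for \<open>v e\<^sub>a\<^sub>b m\<^sub>a\<^sub>c\<^sub>b\<^sub>c\<close> and terms of lower order. In \<open>v e\<^sub>a\<^sub>b m\<^sub>a\<^sub>c\<^sub>b\<^sub>c\<close> the Ricci identity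
  produces a derivative of the divergence, whose product with \<open>v\<close> vanishes, and \<open>v (3 tr e\<^sup>3 + s/2 |e|\<^sup>2)\<close>; the Hessian terms
  give another \<open>v (3 tr e\<^sup>3 + s/2 |e|\<^sup>2)\<close>. The terms with \<open>n V e\<close> that remain after adding \<open>\<langle>\<nabla>\<^sub>V E, E\<rangle>\<close> combine
  to \<open>-2 X\<close> with \<open>X = e\<^sub>a\<^sub>b V\<^sub>c C\<^sub>a\<^sub>b\<^sub>c\<close>, and contracting \<open>C1\<close> with \<open>C\<close> shows \<open>v |C|\<^sup>2 = -4 X\<close>.\<close>

lemma static_algebra_dim3:
  fixes e :: "3 \<Rightarrow> 3 \<Rightarrow> real" and v s :: real
  assumes esym: "\<And>a b. e a b = e b a" and etr: "(\<Sum>a\<in>UNIV. e a a) = 0"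
    and nsym: "\<And>a b c. n a b c = n b a c" and ntr: "\<And>c. (\<Sum>a\<in>UNIV. n a a c) = 0"
    and ndiv: "\<And>a. (\<Sum>b\<in>UNIV. n a b b) = 0"
    and mdiv: "\<And>a d. v * (\<Sum>b\<in>UNIV. m a b b d) = 0"
    and C1: "\<And>a b c. v * (n a b c - n a c b)
      = w b * kd a c - w c * kd a b + 2 * (e a c * V b) - 2 * (e a b * V c)"
    and C2: "\<And>a b c d. V d * (n a b c - n a c b) + v * (m a b c d - m a c b d)
      = dw b d * kd a c - dw c d * kd a b + 2 * (n a c d * V b + e a c * H b d)
        - 2 * (n a b d * V c + e a b * H c d)"
    and dw: "\<And>b d. dw b d = (\<Sum>p\<in>UNIV. n b p d * V p + e b p * H p d)"
    and H: "\<And>a b. H a b = v * (e a b - s / 6 * kd a b)"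
    and ricci_id: "\<And>a b c d. m a b c d - m a b d c
      = - (\<Sum>p\<in>UNIV. K p a d c * e p b + K p b d c * e a p)"
    and K: "\<And>a b c d. K a b c d = e a c * kd b d + e b d * kd a c - e a d * kd b c - e b c * kd a d
      + s / 6 * (kd a c * kd b d - kd a d * kd b c)"
  shows "(\<Sum>c\<in>UNIV. V c * (\<Sum>a\<in>UNIV. \<Sum>b\<in>UNIV. e a b * n a b c))
      + v * (\<Sum>c\<in>UNIV. (\<Sum>a\<in>UNIV. \<Sum>b\<in>UNIV. n a b c * n a b c) + (\<Sum>a\<in>UNIV. \<Sum>b\<in>UNIV. e a b * m a b c c))
    = ((\<Sum>a\<in>UNIV. \<Sum>b\<in>UNIV. \<Sum>c\<in>UNIV. n a b c * n a b c)
        + (\<Sum>a\<in>UNIV. \<Sum>b\<in>UNIV. \<Sum>c\<in>UNIV. (n a b c - n a c b) * (n a b c - n a c b)) / 2) * v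
      + (s * (\<Sum>a\<in>UNIV. \<Sum>b\<in>UNIV. e a b * e a b) + 18 * det (\<chi> a b. e a b)) * v"
proof -
  define c where "c a b d = n a b d - n a d b" for a b d
  define q where "q = (\<Sum>a\<in>UNIV. \<Sum>b\<in>UNIV. e a b * e a b)"
  define \<Delta> where "\<Delta> = det (\<chi> a b. e a b)"
  define X where "X = (\<Sum>a\<in>UNIV. \<Sum>b\<in>UNIV. \<Sum>d\<in>UNIV. e a b * V d * c a b d)"
  define Y where "Y = (\<Sum>a\<in>UNIV. \<Sum>b\<in>UNIV. \<Sum>d\<in>UNIV. e a b * n a b d * V d)"
  define Z where "Z = (\<Sum>a\<in>UNIV. \<Sum>b\<in>UNIV. \<Sum>d\<in>UNIV. e a b * n a d b * V d)"
  have X: "X = Y - Z" unfolding X_def Y_def Z_def c_def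
    by (simp add: sum_subtractf[symmetric] algebra_simps)
  have sy: "e 2 1 = e 1 2" "e 3 1 = e 1 3" "e 3 2 = e 2 3" using esym by blast+
  have nsy: "n 2 1 d = n 1 2 d" "n 3 1 d = n 1 3 d" "n 3 2 d = n 2 3 d" for d using nsym by blast+
  have cube: "(\<Sum>a\<in>UNIV. \<Sum>b\<in>UNIV. \<Sum>d\<in>UNIV. e a b * e a d * H b d) = v * (3 * \<Delta> - s / 6 * q)"
  proof -
    have "(\<Sum>a\<in>UNIV. \<Sum>b\<in>UNIV. \<Sum>d\<in>UNIV. e a b * e a d * H b d)
        = v * ((\<Sum>a\<in>UNIV. \<Sum>b\<in>UNIV. \<Sum>d\<in>UNIV. e a b * e b d * e d a) - s / 6 * q)"
      unfolding H q_def by (simp add: sum_3 sy algebra_simps)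
    then show ?thesis unfolding trace_cube_dim3[of e, OF esym etr] \<Delta>_def .
  qed
  have trH: "(\<Sum>a\<in>UNIV. H a a) = - (v * s / 2)"
  proof -
    have "(\<Sum>a\<in>UNIV. H a a) = v * (\<Sum>a\<in>UNIV. e a a) - v * s / 2"
      unfolding H by (simp add: sum_3 algebra_simps)
    then show ?thesis unfolding etr by simp
  qed
  \<comment> \<open>\<open>C\<close> is trace-free in every pair of slots, which kills the terms of \<open>v C\<close> with \<open>kd\<close> in \<open>v |C|\<^sup>2\<close>.\<close>
  have cc: "v * (\<Sum>a\<in>UNIV. \<Sum>b\<in>UNIV. \<Sum>d\<in>UNIV. c a b d * c a b d) = - 4 * X"
  proof -
    have ctr: "(\<Sum>a\<in>UNIV. c a b a) = 0" "(\<Sum>a\<in>UNIV. c a a b) = 0" for b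
    proof -
      have "(\<Sum>a\<in>UNIV. n a b a) = 0" using ndiv[of b] nsym[of b] by simp
      then show "(\<Sum>a\<in>UNIV. c a b a) = 0" "(\<Sum>a\<in>UNIV. c a a b) = 0"
        using ntr[of b] by (simp_all add: c_def sum_subtractf)
    qed
    have "v * (\<Sum>a\<in>UNIV. \<Sum>b\<in>UNIV. \<Sum>d\<in>UNIV. c a b d * c a b d)
        = (\<Sum>a\<in>UNIV. \<Sum>b\<in>UNIV. \<Sum>d\<in>UNIV. c a b d * (v * c a b d))"
      by (simp add: sum_distrib_left mult_ac)
    also have "\<dots> = (\<Sum>a\<in>UNIV. \<Sum>b\<in>UNIV. \<Sum>d\<in>UNIV. c a b d * (w b * kd a d))
        - (\<Sum>a\<in>UNIV. \<Sum>b\<in>UNIV. \<Sum>d\<in>UNIV. c a b d * (w d * kd a b))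
        + 2 * (\<Sum>a\<in>UNIV. \<Sum>b\<in>UNIV. \<Sum>d\<in>UNIV. c a b d * (e a d * V b))
        - 2 * (\<Sum>a\<in>UNIV. \<Sum>b\<in>UNIV. \<Sum>d\<in>UNIV. c a b d * (e a b * V d))"
      unfolding c_def[of _ _ _, symmetric] C1[folded c_def]
      by (simp add: sum.distrib sum_subtractf sum_distrib_left distrib_left right_diff_distrib mult_ac)
    also have "(\<Sum>a\<in>UNIV. \<Sum>b\<in>UNIV. \<Sum>d\<in>UNIV. c a b d * (w b * kd a d)) = (\<Sum>b\<in>UNIV. w b * (\<Sum>a\<in>UNIV. c a b a))"
      by (simp add: sum_3 algebra_simps)
    also have "(\<Sum>a\<in>UNIV. \<Sum>b\<in>UNIV. \<Sum>d\<in>UNIV. c a b d * (w d * kd a b)) = (\<Sum>d\<in>UNIV. w d * (\<Sum>a\<in>UNIV. c a a d))"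
      by (simp add: sum_3 algebra_simps)
    also have "(\<Sum>a\<in>UNIV. \<Sum>b\<in>UNIV. \<Sum>d\<in>UNIV. c a b d * (e a d * V b)) = - X"
      unfolding X_def c_def by (simp add: sum_3 algebra_simps)
    also have "(\<Sum>a\<in>UNIV. \<Sum>b\<in>UNIV. \<Sum>d\<in>UNIV. c a b d * (e a b * V d)) = X"
      unfolding X_def by (simp add: mult_ac)
    finally show ?thesis by (simp add: ctr)
  qed
  \<comment> \<open>Commuting the derivatives brings the divergence of \<open>e\<close> inside, where \<open>v\<close> times its derivative vanishes.\<close>
  have commuted: "(\<Sum>a\<in>UNIV. \<Sum>b\<in>UNIV. e a b * (v * (\<Sum>d\<in>UNIV. m a d b d))) = v * (9 * \<Delta> + s / 2 * q)"
  proof -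
    have "v * (\<Sum>d\<in>UNIV. m a d b d) = - (v * (\<Sum>d\<in>UNIV. \<Sum>p\<in>UNIV. K p a d b * e p d + K p d d b * e a p))" for a b
    proof -
      have "m a d b d = m a d d b - (\<Sum>p\<in>UNIV. K p a d b * e p d + K p d d b * e a p)" for d
        using ricci_id[of a d b d] by simp
      then have "v * (\<Sum>d\<in>UNIV. m a d b d) = v * (\<Sum>d\<in>UNIV. m a d d b)
          - v * (\<Sum>d\<in>UNIV. \<Sum>p\<in>UNIV. K p a d b * e p d + K p d d b * e a p)"
        by (simp add: sum_subtractf right_diff_distrib)
      then show ?thesis by (simp only: mdiv)
    qed
    then have "(\<Sum>a\<in>UNIV. \<Sum>b\<in>UNIV. e a b * (v * (\<Sum>d\<in>UNIV. m a d b d)))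
        = v * - (\<Sum>a\<in>UNIV. \<Sum>b\<in>UNIV. e a b * (\<Sum>d\<in>UNIV. \<Sum>p\<in>UNIV. K p a d b * e p d + K p d d b * e a p))"
      by (simp add: sum_distrib_left sum_negf mult_ac)
    then show ?thesis unfolding commutator_dim3[of e K s, OF esym etr K] \<Delta>_def q_def .
  qed
  \<comment> \<open>The contraction of the right hand side of \<open>C2\<close> with \<open>e\<close>; the Hessian of the potential contributes the
    second half of the cubic term.\<close>
  have rhs: "(\<Sum>a\<in>UNIV. \<Sum>b\<in>UNIV. e a b * (\<Sum>d\<in>UNIV. dw b d * kd a d - dw d d * kd a b
        + 2 * (n a d d * V b + e a d * H b d) - 2 * (n a b d * V d + e a b * H d d)))
      = Z - 2 * Y + 3 * (v * (3 * \<Delta> - s / 6 * q)) + q * (v * s)"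
  proof -
    have inner: "(\<Sum>d\<in>UNIV. dw b d * kd a d - dw d d * kd a b
        + 2 * (n a d d * V b + e a d * H b d) - 2 * (n a b d * V d + e a b * H d d))
      = dw b a - (\<Sum>d\<in>UNIV. dw d d) * kd a b + 2 * (\<Sum>d\<in>UNIV. n a d d) * V b
        + 2 * (\<Sum>d\<in>UNIV. e a d * H b d) - 2 * (\<Sum>d\<in>UNIV. n a b d * V d) - 2 * e a b * (\<Sum>d\<in>UNIV. H d d)" for a b
      using exhaust_3[of a] by (elim disjE) (simp_all add: sum_3 algebra_simps)
    have "(\<Sum>a\<in>UNIV. \<Sum>b\<in>UNIV. e a b * (\<Sum>d\<in>UNIV. dw b d * kd a d - dw d d * kd a b
        + 2 * (n a d d * V b + e a d * H b d) - 2 * (n a b d * V d + e a b * H d d)))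
      = (\<Sum>a\<in>UNIV. \<Sum>b\<in>UNIV. e a b * dw b a) - (\<Sum>d\<in>UNIV. dw d d) * (\<Sum>a\<in>UNIV. e a a)
        + 2 * (\<Sum>a\<in>UNIV. \<Sum>b\<in>UNIV. \<Sum>d\<in>UNIV. e a b * e a d * H b d) - 2 * Y + q * (v * s)"
      unfolding inner ndiv trH Y_def q_def by (simp add: sum_3 algebra_simps)
    also have "(\<Sum>a\<in>UNIV. \<Sum>b\<in>UNIV. e a b * dw b a)
        = Z + (\<Sum>a\<in>UNIV. \<Sum>b\<in>UNIV. \<Sum>d\<in>UNIV. e a b * e a d * H b d)"
      unfolding dw Z_def H by (simp add: sum_3 sy nsy algebra_simps)
    finally show ?thesis unfolding cube etr by simp
  qed
  have "v * (\<Sum>a\<in>UNIV. \<Sum>b\<in>UNIV. e a b * (\<Sum>d\<in>UNIV. m a b d d))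
      = (\<Sum>a\<in>UNIV. \<Sum>b\<in>UNIV. e a b * (v * (\<Sum>d\<in>UNIV. m a d b d)))
        + (\<Sum>a\<in>UNIV. \<Sum>b\<in>UNIV. e a b * (\<Sum>d\<in>UNIV. dw b d * kd a d - dw d d * kd a b
          + 2 * (n a d d * V b + e a d * H b d) - 2 * (n a b d * V d + e a b * H d d))) - X"
  proof -
    have "v * m a b d d = v * m a d b d + (dw b d * kd a d - dw d d * kd a b
          + 2 * (n a d d * V b + e a d * H b d) - 2 * (n a b d * V d + e a b * H d d)) - V d * c a b d" for a b d
      using C2[of d a b d] unfolding c_def right_diff_distrib by linarith
    then have "v * (\<Sum>d\<in>UNIV. m a b d d) = v * (\<Sum>d\<in>UNIV. m a d b d)
        + (\<Sum>d\<in>UNIV. dw b d * kd a d - dw d d * kd a b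
          + 2 * (n a d d * V b + e a d * H b d) - 2 * (n a b d * V d + e a b * H d d))
        - (\<Sum>d\<in>UNIV. V d * c a b d)" for a b
      unfolding sum_distrib_left by (simp only: sum.distrib sum_subtractf)
    then have "e a b * (v * (\<Sum>d\<in>UNIV. m a b d d)) = e a b * (v * (\<Sum>d\<in>UNIV. m a d b d))
        + e a b * (\<Sum>d\<in>UNIV. dw b d * kd a d - dw d d * kd a b
          + 2 * (n a d d * V b + e a d * H b d) - 2 * (n a b d * V d + e a b * H d d))
        - (\<Sum>d\<in>UNIV. e a b * V d * c a b d)" for a b
      by (simp only: distrib_left right_diff_distrib sum_distrib_left mult.assoc)
    then have "(\<Sum>a\<in>UNIV. \<Sum>b\<in>UNIV. e a b * (v * (\<Sum>d\<in>UNIV. m a b d d)))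
        = (\<Sum>a\<in>UNIV. \<Sum>b\<in>UNIV. e a b * (v * (\<Sum>d\<in>UNIV. m a d b d)))
        + (\<Sum>a\<in>UNIV. \<Sum>b\<in>UNIV. e a b * (\<Sum>d\<in>UNIV. dw b d * kd a d - dw d d * kd a b
          + 2 * (n a d d * V b + e a d * H b d) - 2 * (n a b d * V d + e a b * H d d))) - X"
      unfolding X_def by (simp only: sum.distrib sum_subtractf)
    then show ?thesis by (simp add: sum_distrib_left mult.left_commute)
  qed
  then have em: "v * (\<Sum>a\<in>UNIV. \<Sum>b\<in>UNIV. e a b * (\<Sum>d\<in>UNIV. m a b d d))
      = v * (18 * \<Delta> + s * q) - Y - 2 * X"
    unfolding commuted rhs X by (simp add: field_simps)
  have 1: "(\<Sum>c\<in>UNIV. V c * (\<Sum>a\<in>UNIV. \<Sum>b\<in>UNIV. e a b * n a b c)) = Y"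
    unfolding Y_def sum_distrib_left by (rule trans[OF sum_rotate]) (simp add: mult_ac)
  have 2: "(\<Sum>c\<in>UNIV. (\<Sum>a\<in>UNIV. \<Sum>b\<in>UNIV. n a b c * n a b c))
      = (\<Sum>a\<in>UNIV. \<Sum>b\<in>UNIV. \<Sum>c\<in>UNIV. n a b c * n a b c)"
    by (rule sum_rotate)
  have 3: "(\<Sum>c\<in>UNIV. (\<Sum>a\<in>UNIV. \<Sum>b\<in>UNIV. e a b * m a b c c))
      = (\<Sum>a\<in>UNIV. \<Sum>b\<in>UNIV. e a b * (\<Sum>d\<in>UNIV. m a b d d))"
    unfolding sum_distrib_left by (rule sum_rotate)
  show ?thesis
    unfolding sum.distrib 1 2 3 distrib_left em
    using cc unfolding c_def q_def \<Delta>_def by (simp add: algebra_simps)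
qed

section \<open>Three-dimensional charts\<close>

locale metric_chart3 = metric_chart S G for S :: "(real^3) set" and G
begin

abbreviation E :: "3 \<Rightarrow> 3 \<Rightarrow> real^3 \<Rightarrow> real" where "E i j x \<equiv> tracefree_ricci G x $ i $ j"
abbreviation R :: "real^3 \<Rightarrow> real" where "R \<equiv> scalar_curv G"

lemma E_eq: "E i j x = ric i j x - (1/3 * R x) * g i j x"
  by (simp add: tracefree_ricci_def)

lemma smooth_R: "smooth_fun_on S R"
  unfolding scalar_curv_def metric_trace_def[abs_def]
  by (intro smooth_sum[OF open_S] smooth_mult[OF open_S] smooth_h smooth_ric)

lemma smooth_E: "smooth_fun_on S (E i j)"
  unfolding E_eq
  by (intro smooth_diff[OF open_S] smooth_mult[OF open_S] smooth_const[OF open_S] smooth_R smooth_ric smooth_G)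

lemma sym_E: "x \<in> S \<Longrightarrow> E i j x = E j i x"
  unfolding E_eq by (simp add: ric_sym[of x i j] sym_G[of x i j])

lemma trace_E: assumes x: "x \<in> S" shows "(\<Sum>i\<in>UNIV. \<Sum>j\<in>UNIV. h i j x * E i j x) = 0"
proof -
  have "(\<Sum>i\<in>UNIV. \<Sum>j\<in>UNIV. h i j x * E i j x) = (\<Sum>i\<in>UNIV. \<Sum>j\<in>UNIV. h i j x * ric i j x)
      - 1/3 * R x * (\<Sum>i\<in>UNIV. \<Sum>j\<in>UNIV. h i j x * g i j x)"
    unfolding E_eq by (simp add: right_diff_distrib sum_subtractf sum_distrib_left mult_ac)
  then show ?thesis unfolding trace_g[OF x] by (simp add: scalar_curv_def metric_trace_def)
qed

lemma Rm_frame: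
  assumes x: "x \<in> S" and P: "orthonormal_frame x P"
  shows "fr4 P (\<lambda>i j k l. Rm i j k l x) a b c d
    = fr2 P (\<lambda>i j. E i j x) a c * kd b d + fr2 P (\<lambda>i j. E i j x) b d * kd a c
      - fr2 P (\<lambda>i j. E i j x) a d * kd b c - fr2 P (\<lambda>i j. E i j x) b c * kd a d
      + R x / 6 * (kd a c * kd b d - kd a d * kd b c)"
proof (rule curvature_dim3[where r = "fr2 P (\<lambda>i j. ric i j x)"])
  let ?K = "fr4 P (\<lambda>i j k l. Rm i j k l x)"
  show "?K a b c d = - ?K b a c d" for a b c d
  proof -
    have "(\<lambda>i j k l. Rm i j k l x) = (\<lambda>i j k l. - Rm j i k l x)"
      by (intro ext) (rule Rm_antisym_left[OF x])
    then have "?K a b c d = - fr4 P (\<lambda>i j k l. Rm j i k l x) a b c d"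
      by (simp only: fr4_minus)
    then show ?thesis by (simp only: fr4_swap12[of P "\<lambda>i j k l. Rm i j k l x"])
  qed
  show "?K a b c d = - ?K a b d c" for a b c d
  proof -
    have "(\<lambda>i j k l. Rm i j k l x) = (\<lambda>i j k l. - Rm i j l k x)"
      by (intro ext) (rule Rm_antisym_right)
    then have "?K a b c d = - fr4 P (\<lambda>i j k l. Rm i j l k x) a b c d"
      by (simp only: fr4_minus)
    then show ?thesis by (simp only: fr4_swap34[of P "\<lambda>i j k l. Rm i j k l x"])
  qed
  show pair: "?K a b c d = ?K c d a b" for a b c d
  proof -
    have "(\<lambda>i j k l. Rm i j k l x) = (\<lambda>i j k l. Rm k l i j x)"
      by (intro ext) (rule Rm_pair[OF x])
    then have "?K a b c d = fr4 P (\<lambda>i j k l. Rm k l i j x) a b c d" by simp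
    then show ?thesis by (simp only: fr4_swap_pairs[of P "\<lambda>i j k l. Rm i j k l x"])
  qed
  show "fr2 P (\<lambda>i j. ric i j x) b d = (\<Sum>a\<in>UNIV. ?K a b a d)" for b d
  proof -
    have "fr2 P (\<lambda>i j. ric i j x) b d = (\<Sum>a\<in>UNIV. fr4 P (\<lambda>i j k l. Rm k j l i x) b d a a)"
      unfolding ric_eq_Rm[OF x] contract_h[OF P]
      by (simp add: fr4_def fr3_def fr2_def fr1_sum)
    also have "\<dots> = (\<Sum>a\<in>UNIV. ?K a d a b)"
      by (simp only: fr4_swap_contraction[of P "\<lambda>i j k l. Rm i j k l x"])
    also have "\<dots> = (\<Sum>a\<in>UNIV. ?K a b a d)"
      by (rule sum.cong[OF refl], rule pair)
    finally show ?thesis .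
  qed
  show "R x = (\<Sum>a\<in>UNIV. fr2 P (\<lambda>i j. ric i j x) a a)"
    using contract_h[OF P, of "\<lambda>i j. ric i j x"] by (simp add: scalar_curv_def metric_trace_def)
  show "fr2 P (\<lambda>i j. E i j x) a b = fr2 P (\<lambda>i j. ric i j x) a b - R x / 3 * kd a b" for a b
    unfolding E_eq frame_g[OF P, symmetric] by (simp only: fr2_def fr_linear)
qed

text \<open>The formula is needed in coordinates and not only in a frame at one point, because its consequence
  \<open>static_cotton\<close> is going to be differentiated.\<close>

lemma Rm_dim3:
  assumes x: "x \<in> S"
  shows "Rm i j k l x = E i k x * g j l x + E j l x * g i k x - E i l x * g j k x - E j k x * g i l x
    + R x / 6 * (g i k x * g j l x - g i l x * g j k x)"
proof -
  obtain P where P: "orthonormal_frame x P" using orthonormal_frame_exists[OF x] by blast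
  show ?thesis
  proof (rule fr4_inject[OF x P, of "\<lambda>i j k l. Rm i j k l x" "\<lambda>i j k l. E i k x * g j l x
      + E j l x * g i k x - E i l x * g j k x - E j k x * g i l x
      + R x / 6 * (g i k x * g j l x - g i l x * g j k x)"])
    fix a b c d
    show "fr4 P (\<lambda>i j k l. Rm i j k l x) a b c d = fr4 P (\<lambda>i j k l. E i k x * g j l x
      + E j l x * g i k x - E i l x * g j k x - E j k x * g i l x
      + R x / 6 * (g i k x * g j l x - g i l x * g j k x)) a b c d"
      unfolding Rm_frame[OF x P] frame_g[OF P, symmetric]
      by (simp only: fr4_def fr3_def fr2_def fr_linear)
  qed
qed

lemma D2_E: assumes x: "x \<in> S" shows "D2 E i j k x = D2 ric i j k x - 1/3 * partial k R x * g i j x"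
proof -
  have s: "smooth_fun_on S (\<lambda>y. 1/3 * R y)"
    by (intro smooth_mult[OF open_S] smooth_const[OF open_S] smooth_R)
  have "E = (\<lambda>i j y. ric i j y - (1/3 * R y) * g i j y)" by (intro ext) (rule E_eq)
  then have "D2 E i j k x = D2 (\<lambda>i j y. ric i j y - (1/3 * R y) * g i j y) i j k x" by simp
  also have "\<dots> = D2 ric i j k x - D2 (\<lambda>i j y. (1/3 * R y) * g i j y) i j k x"
    by (rule D2_diff[OF x smooth_ric smooth_mult[OF open_S s smooth_G]])
  also have "D2 (\<lambda>i j y. (1/3 * R y) * g i j y) i j k x = 1/3 * partial k R x * g i j x"
    unfolding D2_scale[OF x s smooth_G] D2_g[OF x] partial_cmult[OF x smooth_R] by simp
  finally show ?thesis .
qed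

lemma D2_E_sym: "x \<in> S \<Longrightarrow> D2 E i j k x = D2 E j i k x"
  by (rule D2_transpose[OF _ sym_E smooth_E])

lemma trace_D2_E: assumes x: "x \<in> S" shows "(\<Sum>i\<in>UNIV. \<Sum>j\<in>UNIV. h i j x * D2 E i j k x) = 0"
proof -
  have "partial k (\<lambda>y. \<Sum>i\<in>UNIV. \<Sum>j\<in>UNIV. h i j y * E i j y) x = partial k (\<lambda>_. 0) x"
    by (rule partial_cong[OF open_S x], rule trace_E, assumption)
       (intro smooth_sum[OF open_S] smooth_mult[OF open_S] smooth_h smooth_E)
  then show ?thesis unfolding partial_contract[OF x smooth_E] partial_const .
qed

text \<open>The contracted Bianchi identity gives \<open>1/2 - 1/3\<close> times \<open>dR\<close>.\<close>

lemma divergence_E: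
  assumes x: "x \<in> S"
  shows "(\<Sum>j\<in>UNIV. \<Sum>k\<in>UNIV. h j k x * D2 E i j k x) = 1/6 * partial i R x"
proof -
  have "(\<Sum>j\<in>UNIV. \<Sum>k\<in>UNIV. h j k x * (partial k R x * g i j x))
      = (\<Sum>j\<in>UNIV. g i j x * (\<Sum>k\<in>UNIV. h j k x * partial k R x))"
    unfolding sum_distrib_left by (simp add: mult_ac)
  also have "\<dots> = partial i R x" by (rule lower_raise[OF x])
  finally have e: "(\<Sum>j\<in>UNIV. \<Sum>k\<in>UNIV. h j k x * (partial k R x * g i j x)) = partial i R x" .
  have "(\<Sum>j\<in>UNIV. \<Sum>k\<in>UNIV. h j k x * (1/3 * partial k R x * g i j x))
      = 1/3 * (\<Sum>j\<in>UNIV. \<Sum>k\<in>UNIV. h j k x * (partial k R x * g i j x))"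
    unfolding sum_distrib_left by (simp only: mult.assoc mult.left_commute[of _ "1/3"])
  then have "(\<Sum>j\<in>UNIV. \<Sum>k\<in>UNIV. h j k x * (1/3 * partial k R x * g i j x)) = 1/3 * partial i R x"
    unfolding e .
  then show ?thesis
    unfolding D2_E[OF x] right_diff_distrib sum_subtractf using contracted_bianchi[OF x, of i] by simp
qed

context
  fixes x P
  assumes x: "x \<in> S" and P: "orthonormal_frame x P"
begin

lemma frame_E_sym: "fr2 P (\<lambda>i j. E i j x) a b = fr2 P (\<lambda>i j. E i j x) b a"
  using fr2_transpose[of P "\<lambda>i j. E i j x" b a] by (simp only: sym_E[OF x])

lemma frame_E_trace: "(\<Sum>a\<in>UNIV. fr2 P (\<lambda>i j. E i j x) a a) = 0"
  using contract_h[OF P, of "\<lambda>i j. E i j x"] trace_E[OF x] by simp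

lemma frame_DE_sym: "fr3 P (\<lambda>i j k. D2 E i j k x) a b c = fr3 P (\<lambda>i j k. D2 E i j k x) b a c"
  using fr3_swap12[of P "\<lambda>i j k. D2 E i j k x" b a c] by (simp only: D2_E_sym[OF x])

lemma frame_DE_trace: "(\<Sum>a\<in>UNIV. fr3 P (\<lambda>i j k. D2 E i j k x) a a c) = 0"
proof -
  have "fr1 P (\<lambda>k. \<Sum>a\<in>UNIV. fr2 P (\<lambda>i j. D2 E i j k x) a a) c = fr1 P (\<lambda>k. 0) c"
    unfolding contract_h[OF P, symmetric] trace_D2_E[OF x] ..
  then show ?thesis
    by (simp only: fr1_sum fr1_fr2[of P "\<lambda>i j k. D2 E i j k x"] fr1_zero)
qed

lemma frame_DE_div:
  "(\<Sum>b\<in>UNIV. fr3 P (\<lambda>i j k. D2 E i j k x) a b b) = 1/6 * fr1 P (\<lambda>k. partial k R x) a"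
proof -
  have "fr1 P (\<lambda>i. \<Sum>b\<in>UNIV. fr2 P (\<lambda>j k. D2 E i j k x) b b) a = fr1 P (\<lambda>i. 1/6 * partial i R x) a"
    unfolding contract_h[OF P, symmetric] divergence_E[OF x] ..
  then show ?thesis by (simp only: fr1_sum fr3_def fr_linear)
qed

end

end

section \<open>Static potentials in a chart\<close>

locale static_chart = metric_chart3 S G for S :: "(real^3) set" and G +
  fixes v :: "real^3 \<Rightarrow> real"
  assumes smooth_v: "smooth_fun_on S v"
    and static: "\<And>x. x \<in> S \<Longrightarrow> hess G v x - laplacian G v x *\<^sub>R G x - v x *\<^sub>R ricci G x = 0"
begin

abbreviation dv :: "3 \<Rightarrow> real^3 \<Rightarrow> real" where "dv k \<equiv> partial k v"

lemma smooth_dv: "smooth_fun_on S (dv k)"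
  by (rule smooth_partial[OF smooth_v])

lemma hess_D1: "hess G f x $ i $ j = D1 (\<lambda>k. partial k f) j i x"
  by (simp add: hess_def D1_def act_def)

text \<open>The trace of the static equation is \<open>\<Delta>V = - R V / 2\<close>, which eliminates the Laplacian.\<close>

lemma D1_dv:
  assumes x: "x \<in> S" shows "D1 dv i j x = v x * (E i j x - (1/6 * R x) * g i j x)"
proof -
  have st: "hess G v x $ i $ j = laplacian G v x * g i j x + v x * ric i j x" for i j
  proof -
    have "(hess G v x - laplacian G v x *\<^sub>R G x - v x *\<^sub>R ricci G x) $ i $ j = 0"
      unfolding static[OF x] by simp
    then show ?thesis by simp
  qed
  have "laplacian G v x = (\<Sum>i\<in>UNIV. \<Sum>j\<in>UNIV. h i j x * (laplacian G v x * g i j x + v x * ric i j x))"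
    unfolding st[symmetric] by (simp add: laplacian_def metric_trace_def)
  also have "\<dots> = laplacian G v x * (\<Sum>i\<in>UNIV. \<Sum>j\<in>UNIV. h i j x * g i j x)
      + v x * (\<Sum>i\<in>UNIV. \<Sum>j\<in>UNIV. h i j x * ric i j x)"
    unfolding sum_distrib_left distrib_left sum.distrib
    by (simp only: mult.left_commute[of _ "laplacian G v x"] mult.left_commute[of _ "v x"])
  also have "\<dots> = 3 * laplacian G v x + v x * R x"
    unfolding trace_g[OF x] by (simp add: scalar_curv_def metric_trace_def)
  finally have lap: "laplacian G v x = - (1/2 * (v x * R x))" by simp
  have "D1 dv i j x = hess G v x $ j $ i" by (simp only: hess_D1)
  also have "\<dots> = v x * (E i j x - (1/6 * R x) * g i j x)"
    unfolding st lap E_eq ric_sym[OF x, of j i] sym_G[OF x, of j i] by (simp add: algebra_simps)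
  finally show ?thesis .
qed

text \<open>The covector field \<open>E(\<nabla>V)\<close>.\<close>

definition W :: "3 \<Rightarrow> real^3 \<Rightarrow> real" where
  "W j x = (\<Sum>a\<in>UNIV. \<Sum>b\<in>UNIV. h a b x * (E j a x * dv b x))"

lemma smooth_W: "smooth_fun_on S (W j)"
  unfolding W_def by (intro smooth_sum[OF open_S] smooth_mult[OF open_S] smooth_h smooth_E smooth_dv)

text \<open>Commuting the derivatives in \<open>\<nabla>\<nabla>dV\<close> and inserting the static equation and the
  three-dimensional form of the curvature.\<close>

lemma static_commutator:
  assumes x: "x \<in> S"
  shows "v x * (D2 E i j k x - D2 E i k j x)
      + 1/6 * (v x * partial j R x * g i k x - v x * partial k R x * g i j x)
    = W j x * g i k x - W k x * g i j x + 2 * (E i k x * dv j x) - 2 * (E i j x * dv k x)"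
proof -
  have s: "smooth_fun_on S (\<lambda>y. 1/6 * R y)"
    by (intro smooth_mult[OF open_S] smooth_const[OF open_S] smooth_R)
  have s2: "smooth_fun_on S (\<lambda>y. E i j y - (1/6 * R y) * g i j y)" for i j
    by (intro smooth_diff[OF open_S] smooth_E smooth_mult[OF open_S s smooth_G])
  have "D2 (D1 dv) i j k x = D2 (\<lambda>i j y. v y * (E i j y - (1/6 * R y) * g i j y)) i j k x" for i j k
    by (rule D2_cong[OF x D1_dv smooth_D1[OF smooth_dv]])
  also have "D2 (\<lambda>i j y. v y * (E i j y - (1/6 * R y) * g i j y)) i j k x
      = v x * (D2 E i j k x - 1/6 * partial k R x * g i j x) + dv k x * (E i j x - (1/6 * R x) * g i j x)" for i j k
    unfolding D2_scale[OF x smooth_v s2] D2_diff[OF x smooth_E smooth_mult[OF open_S s smooth_G]]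
      D2_scale[OF x s smooth_G] D2_g[OF x] partial_cmult[OF x smooth_R] by simp
  finally have lhs: "D2 (D1 dv) i j k x = v x * (D2 E i j k x - 1/6 * partial k R x * g i j x)
      + dv k x * (E i j x - (1/6 * R x) * g i j x)" for i j k .
  have raise: "(\<Sum>a\<in>UNIV. \<Sum>b\<in>UNIV. h a b x * (g j a x * dv b x)) = dv j x" for j
    using lower_raise[OF x, of j "\<lambda>b. dv b x"] by (simp add: sum_distrib_left mult_ac)
  have "(\<Sum>a\<in>UNIV. riem G a i k j x * dv a x)
      = (\<Sum>a\<in>UNIV. \<Sum>b\<in>UNIV. h a b x * (Rm a i k j x * dv b x))"
    unfolding riem_eq_Rm[OF x] sum_distrib_right
    by (subst sum.swap) (simp add: sym_h[OF x] mult_ac)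
  also have "\<dots> = (\<Sum>a\<in>UNIV. \<Sum>b\<in>UNIV. g i j x * (h a b x * (E k a x * dv b x)) + E i j x * (h a b x * (g k a x * dv b x))
      - g i k x * (h a b x * (E j a x * dv b x)) - E i k x * (h a b x * (g j a x * dv b x))
      + R x / 6 * (g i j x * (h a b x * (g k a x * dv b x)) - g i k x * (h a b x * (g j a x * dv b x))))"
    unfolding Rm_dim3[OF x] sym_E[OF x, of _ k] sym_E[OF x, of _ j] sym_G[OF x, of _ k] sym_G[OF x, of _ j]
    by (intro sum.cong refl) algebra
  also have "\<dots> = g i j x * W k x + E i j x * dv k x - g i k x * W j x - E i k x * dv j x
      + R x / 6 * (g i j x * dv k x - g i k x * dv j x)"
    by (simp only: sum.distrib sum_subtractf sum_distrib_left[symmetric] raise W_def[symmetric])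
  finally show ?thesis
    using ricci_identity1[of x dv i j k, OF x smooth_dv] unfolding lhs by (simp add: field_simps)
qed

text \<open>In the trace of the previous identity over the first two slots the right hand side cancels, and
  \<open>div E = dR / 6\<close> turns the left hand side into \<open>- V dR / 2\<close>.\<close>

lemma v_dR:
  assumes x: "x \<in> S" shows "v x * partial k R x = 0"
proof -
  obtain P where P: "orthonormal_frame x P" using orthonormal_frame_exists[OF x] by blast
  let ?n = "fr3 P (\<lambda>i j k. D2 E i j k x)" and ?e = "fr2 P (\<lambda>i j. E i j x)"
  let ?r = "fr1 P (\<lambda>k. partial k R x)" and ?V = "fr1 P (\<lambda>k. dv k x)" and ?w = "fr1 P (\<lambda>k. W k x)"
  have f1: "fr3 P (\<lambda>i j k. v x * (D2 E i j k x - D2 E i k j x)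
      + 1/6 * (v x * partial j R x * g i k x - v x * partial k R x * g i j x)) a b c
    = fr3 P (\<lambda>i j k. W j x * g i k x - W k x * g i j x + 2 * (E i k x * dv j x) - 2 * (E i j x * dv k x)) a b c" for a b c
    by (simp only: static_commutator[OF x])
  have f2: "fr3 P (\<lambda>i j k. v x * (D2 E i j k x - D2 E i k j x)
      + 1/6 * (v x * partial j R x * g i k x - v x * partial k R x * g i j x)) a b c
      = v x * (?n a b c - fr3 P (\<lambda>i j k. D2 E i k j x) a b c)
        + 1/6 * (v x * ?r b * kd a c - v x * ?r c * kd a b)" for a b c
    unfolding frame_g[OF P, symmetric] by (simp only: fr3_def fr2_def fr_linear)
  have f3: "fr3 P (\<lambda>i j k. W j x * g i k x - W k x * g i j x + 2 * (E i k x * dv j x) - 2 * (E i j x * dv k x)) a b c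
      = ?w b * kd a c - ?w c * kd a b + 2 * (?e a c * ?V b) - 2 * (?e a b * ?V c)" for a b c
    unfolding frame_g[OF P, symmetric] by (simp only: fr3_def fr2_def fr_linear)
  have f4: "fr3 P (\<lambda>i j k. D2 E i k j x) a b c = ?n a c b" for a b c
    by (rule fr3_swap23)
  have eq: "v x * (?n a b c - ?n a c b) + 1/6 * (v x * ?r b * kd a c - v x * ?r c * kd a b)
      = ?w b * kd a c - ?w c * kd a b + 2 * (?e a c * ?V b) - 2 * (?e a b * ?V c)" for a b c
    using f1[of a b c] unfolding f2 f3 f4 .
  have w: "?w c = (\<Sum>p\<in>UNIV. ?e c p * ?V p)" for c
    unfolding W_def contract_h[OF P] by (simp only: fr1_sum fr2_def fr_linear)
  have "v x * ?r c = 0" for c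
  proof -
    have "(\<Sum>a\<in>UNIV. v x * (?n a a c - ?n a c a) + 1/6 * (v x * ?r a * kd a c - v x * ?r c * kd a a))
        = v x * ((\<Sum>a\<in>UNIV. ?n a a c) - (\<Sum>a\<in>UNIV. ?n a c a)) - 1/3 * (v x * ?r c)"
      using exhaust_3[of c] by (elim disjE) (simp_all add: sum_3 algebra_simps)
    moreover have "(\<Sum>a\<in>UNIV. ?w a * kd a c - ?w c * kd a a + 2 * (?e a c * ?V a) - 2 * (?e a a * ?V c))
        = - 2 * ?w c + 2 * (\<Sum>a\<in>UNIV. ?e a c * ?V a) - 2 * ?V c * (\<Sum>a\<in>UNIV. ?e a a)"
      using exhaust_3[of c] by (elim disjE) (simp_all add: sum_3 algebra_simps)
    moreover have "(\<Sum>a\<in>UNIV. ?n a c a) = 1/6 * ?r c"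
      unfolding frame_DE_div[OF x P, symmetric] by (intro sum.cong refl frame_DE_sym[OF x P])
    moreover have "(\<Sum>a\<in>UNIV. ?e a c * ?V a) = ?w c"
      unfolding w by (intro sum.cong refl arg_cong2[of _ _ _ _ "(*)"] frame_E_sym[OF x P])
    ultimately show ?thesis unfolding eq frame_E_trace[OF x P] frame_DE_trace[OF x P] by simp
  qed
  then have "fr1 P (\<lambda>k. v x * partial k R x) c = fr1 P (\<lambda>k. 0) c" for c
    by (simp only: fr_linear)
  from fr1_inject[OF x P this] show ?thesis by (rule fun_cong)
qed

lemma static_cotton:
  assumes x: "x \<in> S"
  shows "v x * (D2 E i j k x - D2 E i k j x)
    = W j x * g i k x - W k x * g i j x + 2 * (E i k x * dv j x) - 2 * (E i j x * dv k x)"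
  using static_commutator[OF x, of i j k] by (simp add: v_dR[OF x])

text \<open>The trace of this identity over \<open>k\<close> and \<open>l\<close> is where \<open>V \<Delta>E\<close> comes from. Since \<open>static_cotton\<close>
  holds throughout the chart, it may be differentiated at zeros of \<open>V\<close> as well.\<close>

lemma D_static_cotton:
  assumes x: "x \<in> S"
  shows "dv l x * (D2 E i j k x - D2 E i k j x) + v x * (D3 (D2 E) i j k l x - D3 (D2 E) i k j l x)
    = D1 W j l x * g i k x - D1 W k l x * g i j x
      + 2 * (D2 E i k l x * dv j x + E i k x * D1 dv j l x) - 2 * (D2 E i j l x * dv k x + E i j x * D1 dv k l x)"
proof -
  note sm = smooth_mult[OF open_S]
  have sN: "smooth_fun_on S (D2 E i j k)" for i j k by (rule smooth_D2[OF smooth_E])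
  have sC: "smooth_fun_on S (\<lambda>y. D2 E i j k y - D2 E i k j y)" for i j k
    by (rule smooth_diff[OF open_S sN sN])
  have prod: "D3 (\<lambda>i j k y. T i j y * w k y) i j k l x = D2 T i j l x * w k x + T i j x * D1 w k l x"
    "D3 (\<lambda>i j k y. T i k y * w j y) i j k l x = D2 T i k l x * w j x + T i k x * D1 w j l x"
    if "\<And>i j. smooth_fun_on S (T i j)" "\<And>i. smooth_fun_on S (w i)" for T w
    using D3_prod[OF x that] D3_swap[OF x, of "\<lambda>i j k y. T i j y * w k y"] by simp_all
  have "dv l x * (D2 E i j k x - D2 E i k j x) + v x * (D3 (D2 E) i j k l x - D3 (D2 E) i k j l x)
      = D3 (\<lambda>i j k y. v y * (D2 E i j k y - D2 E i k j y)) i j k l x"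
    unfolding D3_scale[OF x smooth_v sC] D3_diff[OF x sN sN] D3_swap[OF x, of "D2 E"] by simp
  also have "\<dots> = D3 (\<lambda>i j k y. g i k y * W j y - g i j y * W k y
      + 2 * (E i k y * dv j y) - 2 * (E i j y * dv k y)) i j k l x"
    by (rule D3_cong[OF x _ sm[OF smooth_v sC]]) (simp add: static_cotton mult.commute)
  also have "\<dots> = D3 (\<lambda>i j k y. g i k y * W j y) i j k l x - D3 (\<lambda>i j k y. g i j y * W k y) i j k l x
      + 2 * D3 (\<lambda>i j k y. E i k y * dv j y) i j k l x - 2 * D3 (\<lambda>i j k y. E i j y * dv k y) i j k l x"
    by (simp only: D3_diff[OF x] D3_add[OF x] D3_cmult[OF x] smooth_diff[OF open_S] smooth_add[OF open_S]
        sm smooth_const[OF open_S] smooth_G smooth_E smooth_W smooth_dv)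
  finally show ?thesis
    unfolding prod[OF smooth_G smooth_W] prod[OF smooth_E smooth_dv] D2_g[OF x] by (simp add: mult.commute)
qed

lemma D1_W:
  assumes x: "x \<in> S"
  shows "D1 W j l x = (\<Sum>a\<in>UNIV. \<Sum>b\<in>UNIV. h a b x * (D2 E j a l x * dv b x + E j a x * D1 dv b l x))"
proof -
  have "W = (\<lambda>p y. \<Sum>a\<in>UNIV. \<Sum>b\<in>UNIV. h a b y * (E p a y * dv b y))"
    by (intro ext) (rule W_def)
  then show ?thesis
    by (simp only: D1_contract[OF x smooth_mult[OF open_S smooth_E smooth_dv]]
        D3_prod[OF x smooth_E smooth_dv])
qed

text \<open>The divergence of \<open>E\<close> is \<open>dR / 6\<close>. The factor \<open>V\<close> makes it possible to
  differentiate \<open>V dR = 0\<close>, which holds near \<open>x\<close>, while \<open>dR = 0\<close> is assumed at \<open>x\<close> only.\<close>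

lemma div_D3_E:
  assumes x: "x \<in> S" and dR: "\<And>k. partial k R x = 0"
  shows "v x * (\<Sum>j\<in>UNIV. \<Sum>k\<in>UNIV. h j k x * D3 (D2 E) i j k l x) = 0"
proof -
  let ?dR = "\<lambda>i. partial i R"
  have s: "smooth_fun_on S (?dR i)" for i by (rule smooth_partial[OF smooth_R])
  have "D1 (\<lambda>i y. \<Sum>j\<in>UNIV. \<Sum>k\<in>UNIV. h j k y * D2 E i j k y) i l x
      = (\<Sum>j\<in>UNIV. \<Sum>k\<in>UNIV. h j k x * D3 (D2 E) i j k l x)"
    by (rule D1_contract[OF x smooth_D2[OF smooth_E]])
  moreover have "D1 (\<lambda>i y. \<Sum>j\<in>UNIV. \<Sum>k\<in>UNIV. h j k y * D2 E i j k y) i l x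
      = 1/6 * partial l (?dR i) x"
  proof -
    have "partial l (\<lambda>y. \<Sum>j\<in>UNIV. \<Sum>k\<in>UNIV. h j k y * D2 E i j k y) x = partial l (\<lambda>y. 1/6 * ?dR i y) x"
      by (rule partial_cong[OF open_S x], rule divergence_E, assumption)
         (intro smooth_sum[OF open_S] smooth_mult[OF open_S] smooth_h smooth_D2 smooth_E)
    then show ?thesis
      unfolding D1_def partial_cmult[OF x s] divergence_E[OF x] dR by (simp add: act_zero)
  qed
  moreover have "v x * partial l (?dR i) x = 0"
  proof -
    have "partial l (\<lambda>y. v y * ?dR i y) x = partial l (\<lambda>_. 0) x"
      by (rule partial_cong[OF open_S x], rule v_dR, assumption) (rule smooth_mult[OF open_S smooth_v s])
    then show ?thesis unfolding partial_mult[OF x smooth_v s] partial_const dR by simp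
  qed
  ultimately show ?thesis by simp
qed

text \<open>At a zero of \<open>V\<close> the derivative of \<open>V dR = 0\<close> reads \<open>dV \<otimes> dR = 0\<close>.\<close>

lemma dR_zero:
  assumes x: "x \<in> S" and nz: "v x \<noteq> 0 \<or> (\<exists>l. dv l x \<noteq> 0)"
  shows "partial k R x = 0"
proof (cases "v x = 0")
  case True
  then obtain l where l: "dv l x \<noteq> 0" using nz by blast
  have s: "smooth_fun_on S (partial k R)" by (rule smooth_partial[OF smooth_R])
  have "partial l (\<lambda>y. v y * partial k R y) x = partial l (\<lambda>_. 0) x"
    by (rule partial_cong[OF open_S x], rule v_dR, assumption) (rule smooth_mult[OF open_S smooth_v s])
  then show ?thesis unfolding partial_mult[OF x smooth_v s] partial_const True using l by simp
next
  case False
  then show ?thesis using v_dR[OF x, of k] by simp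
qed

lemma cotton_eq:
  assumes x: "x \<in> S" and dR: "\<And>k. partial k R x = 0"
  shows "cotton G i j k x = D2 E i j k x - D2 E i k j x"
  by (simp add: cotton_def cov_deriv_D2 D2_E[OF x] dR)

text \<open>Where \<open>V\<close> and \<open>dV\<close> both vanish, both sides are zero. Elsewhere \<open>dR = 0\<close>, and all terms can be
  computed in an orthonormal frame from Bochner's formula for \<open>|E|\<^sup>2\<close>.\<close>

lemma bochner_static:
  assumes x: "x \<in> S"
  shows "(1/2) * divergence G (\<lambda>y. v y *\<^sub>R grad G (norm2_sq G (tracefree_ricci G)) y) x
    = (norm3_sq G (cov_deriv G (tracefree_ricci G)) x + norm3_sq G (cotton G) x / 2) * v x
      + (R x * norm2_sq G (tracefree_ricci G) x + 18 * endo_det G (tracefree_ricci G) x) * v x"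
proof -
  let ?f = "\<lambda>y. ip2 y (\<lambda>i j. E i j y) (\<lambda>i j. E i j y)"
  have f: "norm2_sq G (tracefree_ricci G) = ?f" by (rule ext) (rule norm2_sq_ip2)
  have sf: "smooth_fun_on S ?f" by (rule smooth_ip2[OF smooth_E smooth_E])
  note lhs = divergence_scaled_grad[OF x smooth_v sf]
  show ?thesis
  proof (cases "v x \<noteq> 0 \<or> (\<exists>l. dv l x \<noteq> 0)")
    case False
    then show ?thesis unfolding f lhs by simp
  next
    case True
    note dR = dR_zero[OF x True]
    obtain P where P: "orthonormal_frame x P" using orthonormal_frame_exists[OF x] by blast
    let ?e = "fr2 P (\<lambda>i j. E i j x)" and ?n = "fr3 P (\<lambda>i j k. D2 E i j k x)"
    let ?m = "fr4 P (\<lambda>i j k l. D3 (D2 E) i j k l x)" and ?K = "fr4 P (\<lambda>i j k l. Rm i j k l x)"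
    let ?V = "fr1 P (\<lambda>k. dv k x)" and ?w = "fr1 P (\<lambda>k. W k x)"
    let ?H = "fr2 P (\<lambda>i j. D1 dv i j x)" and ?dw = "fr2 P (\<lambda>i j. D1 W i j x)"
    have algebra: "(\<Sum>c\<in>UNIV. ?V c * (\<Sum>a\<in>UNIV. \<Sum>b\<in>UNIV. ?e a b * ?n a b c))
      + v x * (\<Sum>c\<in>UNIV. (\<Sum>a\<in>UNIV. \<Sum>b\<in>UNIV. ?n a b c * ?n a b c) + (\<Sum>a\<in>UNIV. \<Sum>b\<in>UNIV. ?e a b * ?m a b c c))
    = ((\<Sum>a\<in>UNIV. \<Sum>b\<in>UNIV. \<Sum>c\<in>UNIV. ?n a b c * ?n a b c)
        + (\<Sum>a\<in>UNIV. \<Sum>b\<in>UNIV. \<Sum>c\<in>UNIV. (?n a b c - ?n a c b) * (?n a b c - ?n a c b)) / 2) * v x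
      + (R x * (\<Sum>a\<in>UNIV. \<Sum>b\<in>UNIV. ?e a b * ?e a b) + 18 * det (\<chi> a b. ?e a b)) * v x"
    proof (rule static_algebra_dim3[where e = ?e and n = ?n and m = ?m and v = "v x" and s = "R x"
          and w = ?w and V = ?V and dw = ?dw and H = ?H and K = ?K])
      show "?e a b = ?e b a" "(\<Sum>a\<in>UNIV. ?e a a) = 0" "?n a b c = ?n b a c" "(\<Sum>a\<in>UNIV. ?n a a c) = 0" for a b c
        by (rule frame_E_sym[OF x P], rule frame_E_trace[OF x P], rule frame_DE_sym[OF x P],
            rule frame_DE_trace[OF x P])
      show "(\<Sum>b\<in>UNIV. ?n a b b) = 0" for a
        unfolding frame_DE_div[OF x P] dR fr1_zero by simp
      show "v x * (\<Sum>b\<in>UNIV. ?m a b b d) = 0" for a d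
      proof -
        have "fr1 P (\<lambda>i. fr1 P (\<lambda>l. v x * (\<Sum>b\<in>UNIV. fr2 P (\<lambda>j k. D3 (D2 E) i j k l x) b b)) d) a
            = fr1 P (\<lambda>i. fr1 P (\<lambda>l. 0) d) a"
          unfolding contract_h[OF P, symmetric] div_D3_E[OF x dR] ..
        then show ?thesis
          by (simp only: fr_linear fr1_sum fr1_fr2[of P "\<lambda>j k l. D3 (D2 E) _ j k l x"] fr4_def)
      qed
      show "v x * (?n a b c - ?n a c b) = ?w b * kd a c - ?w c * kd a b + 2 * (?e a c * ?V b) - 2 * (?e a b * ?V c)"
        for a b c
      proof -
        have "fr3 P (\<lambda>i j k. v x * (D2 E i j k x - D2 E i k j x)) a b c
          = fr3 P (\<lambda>i j k. W j x * g i k x - W k x * g i j x + 2 * (E i k x * dv j x) - 2 * (E i j x * dv k x)) a b c"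
          unfolding static_cotton[OF x] ..
        also have "\<dots> = ?w b * kd a c - ?w c * kd a b + 2 * (?e a c * ?V b) - 2 * (?e a b * ?V c)"
          unfolding frame_g[OF P, symmetric] by (simp only: fr3_def fr2_def fr_linear)
        also have "fr3 P (\<lambda>i j k. v x * (D2 E i j k x - D2 E i k j x)) a b c
          = v x * (?n a b c - fr3 P (\<lambda>i j k. D2 E i k j x) a b c)"
          by (simp only: fr3_def fr2_def fr_linear)
        also have "fr3 P (\<lambda>i j k. D2 E i k j x) a b c = ?n a c b" by (rule fr3_swap23)
        finally show ?thesis .
      qed
      show "?V d * (?n a b c - ?n a c b) + v x * (?m a b c d - ?m a c b d)
          = ?dw b d * kd a c - ?dw c d * kd a b + 2 * (?n a c d * ?V b + ?e a c * ?H b d)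
            - 2 * (?n a b d * ?V c + ?e a b * ?H c d)" for a b c d
      proof -
        have "fr4 P (\<lambda>i j k l. dv l x * (D2 E i j k x - D2 E i k j x)
            + v x * (D3 (D2 E) i j k l x - D3 (D2 E) i k j l x)) a b c d
          = fr4 P (\<lambda>i j k l. D1 W j l x * g i k x - D1 W k l x * g i j x
            + 2 * (D2 E i k l x * dv j x + E i k x * D1 dv j l x)
            - 2 * (D2 E i j l x * dv k x + E i j x * D1 dv k l x)) a b c d"
          unfolding D_static_cotton[OF x] ..
        also have "\<dots> = ?dw b d * kd a c - ?dw c d * kd a b + 2 * (?n a c d * ?V b + ?e a c * ?H b d)
            - 2 * (?n a b d * ?V c + ?e a b * ?H c d)"
          unfolding frame_g[OF P, symmetric] by (simp only: fr4_def fr3_def fr2_def fr_linear)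
        also have "fr4 P (\<lambda>i j k l. dv l x * (D2 E i j k x - D2 E i k j x)
            + v x * (D3 (D2 E) i j k l x - D3 (D2 E) i k j l x)) a b c d
          = ?V d * (?n a b c - fr3 P (\<lambda>i j k. D2 E i k j x) a b c)
            + v x * (?m a b c d - fr4 P (\<lambda>i j k l. D3 (D2 E) i k j l x) a b c d)"
          by (simp only: fr4_def fr3_def fr2_def fr_linear)
        also have "fr3 P (\<lambda>i j k. D2 E i k j x) a b c = ?n a c b" by (rule fr3_swap23)
        also have "fr4 P (\<lambda>i j k l. D3 (D2 E) i k j l x) a b c d = ?m a c b d" by (rule fr4_swap23)
        finally show ?thesis .
      qed
      show "?dw b d = (\<Sum>p\<in>UNIV. ?n b p d * ?V p + ?e b p * ?H p d)" for b d
      proof -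
        have n: "fr2 P (\<lambda>j l. fr1 P (\<lambda>a. D2 E j a l x) p) b d = ?n b p d" for p
          unfolding fr2_def fr3_def by (rule arg_cong[of _ _ "\<lambda>X. fr1 P X b"], rule ext, rule fr1_swap)
        have H: "fr1 P (\<lambda>l. fr1 P (\<lambda>b. D1 dv b l x) p) d = ?H p d" for p
          unfolding fr2_def by (rule fr1_swap)
        have e: "fr1 P (\<lambda>j. fr1 P (\<lambda>a. E j a x) p) b = ?e b p" for p
          unfolding fr2_def ..
        have "?dw b d = fr2 P (\<lambda>j l. \<Sum>p\<in>UNIV. fr1 P (\<lambda>a. D2 E j a l x) p * ?V p
            + fr1 P (\<lambda>a. E j a x) p * fr1 P (\<lambda>b. D1 dv b l x) p) b d"
          unfolding D1_W[OF x] contract_h[OF P] fr2_add fr2_prod ..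
        then show ?thesis by (simp only: fr2_sum fr2_add fr2_cmult_right fr2_prod n H e)
      qed
      show "?H a b = v x * (?e a b - R x / 6 * kd a b)" for a b
      proof -
        have "?H a b = v x * (?e a b - (1/6 * R x) * kd a b)"
          unfolding D1_dv[OF x] frame_g[OF P, symmetric] by (simp only: fr2_def fr_linear)
        then show ?thesis by simp
      qed
      show "?m a b c d - ?m a b d c = - (\<Sum>p\<in>UNIV. ?K p a d c * ?e p b + ?K p b d c * ?e a p)" for a b c d
        by (rule ricci_identity2_frame[OF x P smooth_E])
      show "?K a b c d = ?e a c * kd b d + ?e b d * kd a c - ?e a d * kd b c - ?e b c * kd a d
          + R x / 6 * (kd a c * kd b d - kd a d * kd b c)" for a b c d
        by (rule Rm_frame[OF x P])
    qed
    have trace: "fr2 P (\<lambda>i j. v x * D1 (\<lambda>k. partial k ?f) j i x + dv i x * partial j ?f x) c c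
        = v x * (2 * (\<Sum>a\<in>UNIV. \<Sum>b\<in>UNIV. ?n a b c * ?n a b c) + 2 * (\<Sum>a\<in>UNIV. \<Sum>b\<in>UNIV. ?e a b * ?m a b c c))
          + ?V c * (2 * (\<Sum>a\<in>UNIV. \<Sum>b\<in>UNIV. ?e a b * ?n a b c))" for c
      unfolding partial_norm2[of x E, OF x smooth_E] hessian_norm2[of x E, OF x smooth_E] ip2_frame[OF P]
      by (simp only: fr2_add fr2_cmult fr2_sum fr2_prod fr_linear fr1_sum fr2_fr2[of P "\<lambda>i j k l. D3 (D2 E) i j k l x"]
          fr1_fr2[of P "\<lambda>i j k. D2 E i j k x"])
    have div: "(1/2) * divergence G (\<lambda>y. v y *\<^sub>R grad G ?f y) x
      = (\<Sum>c\<in>UNIV. ?V c * (\<Sum>a\<in>UNIV. \<Sum>b\<in>UNIV. ?e a b * ?n a b c))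
      + v x * (\<Sum>c\<in>UNIV. (\<Sum>a\<in>UNIV. \<Sum>b\<in>UNIV. ?n a b c * ?n a b c) + (\<Sum>a\<in>UNIV. \<Sum>b\<in>UNIV. ?e a b * ?m a b c c))"
      unfolding lhs contract_h[OF P] trace sum_distrib_left[of _ _ UNIV] sum.distrib[symmetric]
      by (rule sum.cong[OF refl]) (simp add: algebra_simps)
    have DE: "norm3_sq G (cov_deriv G (tracefree_ricci G)) x
        = (\<Sum>a\<in>UNIV. \<Sum>b\<in>UNIV. \<Sum>c\<in>UNIV. ?n a b c * ?n a b c)"
      unfolding norm3_sq_frame[OF P] cov_deriv_D2 ..
    have C: "norm3_sq G (cotton G) x
        = (\<Sum>a\<in>UNIV. \<Sum>b\<in>UNIV. \<Sum>c\<in>UNIV. (?n a b c - ?n a c b) * (?n a b c - ?n a c b))"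
      unfolding norm3_sq_frame[OF P] cotton_eq[OF x dR] fr3_diff fr3_swap23[of P "\<lambda>i j k. D2 E i j k x"] ..
    show ?thesis
      unfolding f DE C endo_det_frame[OF P] div algebra ip2_frame[OF P] ..
  qed
qed

end

section \<open>The divergence formula\<close>

lemma static_chart_of_atlas:
  fixes A :: "('a::{t2_space,second_countable_topology}, 3) chart set"
  assumes A: "smooth_atlas A" and g: "riemannian_metric A g" and V: "static_potential A g V"
    and c: "c \<in> A"
  shows "static_chart (chart_image c) (g c) (V \<circ> chart_inv c)"
proof
  show op: "open (chart_image c)"
    using A c unfolding smooth_atlas_def is_chart_def by blast
  have gc: "smooth_fun_on (chart_image c) (g c)"
    "\<forall>x\<in>chart_image c. transpose (g c x) = g c x \<and> (\<forall>u. u \<noteq> 0 \<longrightarrow> u \<bullet> (g c x *v u) > 0)"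
    using g c unfolding riemannian_metric_def by simp_all
  show "smooth_fun_on (chart_image c) (\<lambda>x. g c x $ i $ j)" for i j
    by (rule smooth_linear[OF _ op gc(1)])
       (rule bounded_linear_compose[OF bounded_linear_vec_nth bounded_linear_vec_nth])
  show "g c x $ i $ j = g c x $ j $ i" if "x \<in> chart_image c" for x i j
  proof -
    have "transpose (g c x) = g c x" using gc(2) that by blast
    then have "transpose (g c x) $ i $ j = g c x $ i $ j" by simp
    then show ?thesis by (simp add: transpose_def)
  qed
  show "u \<bullet> (g c x *v u) > 0" if "x \<in> chart_image c" "u \<noteq> 0" for x u
    using gc(2) that by blast
  show "smooth_fun_on (chart_image c) (V \<circ> chart_inv c)"
    using V c unfolding static_potential_def smooth_on_manifold_def by blast
  show "hess (g c) (V \<circ> chart_inv c) x - laplacian (g c) (V \<circ> chart_inv c) x *\<^sub>R g c x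
      - (V \<circ> chart_inv c) x *\<^sub>R ricci (g c) x = 0" if "x \<in> chart_image c" for x
    using V c that unfolding static_potential_def Let_def by blast
qed

theorem proposition12:
  fixes A :: "('a::{t2_space,second_countable_topology}, 3) chart set"
    and g :: "('a, 3) chart \<Rightarrow> 3 field2"
    and V :: "'a \<Rightarrow> real"
  assumes "smooth_atlas A"
    and "riemannian_metric A g"
    and "complete_metric A g"
    and "static_potential A g V"
  shows "\<forall>c\<in>A. \<forall>x\<in>chart_image c.
    let G = g c; v = V \<circ> chart_inv c; E = tracefree_ricci G in
      (1/2) * divergence G (\<lambda>y. v y *\<^sub>R grad G (norm2_sq G E) y) x
      = (norm3_sq G (cov_deriv G E) x + norm3_sq G (cotton G) x / 2) * v x
        + (scalar_curv G x * norm2_sq G E x + 18 * endo_det G E x) * v x"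
  unfolding Let_def
proof (intro ballI)
  fix c x
  assume c: "c \<in> A" and x: "x \<in> chart_image c"
  interpret static_chart "chart_image c" "g c" "V \<circ> chart_inv c"
    by (rule static_chart_of_atlas[OF assms(1,2,4) c])
  show "(1/2) * divergence (g c) (\<lambda>y. (V \<circ> chart_inv c) y *\<^sub>R
        grad (g c) (norm2_sq (g c) (tracefree_ricci (g c))) y) x
      = (norm3_sq (g c) (cov_deriv (g c) (tracefree_ricci (g c))) x
          + norm3_sq (g c) (cotton (g c)) x / 2) * (V \<circ> chart_inv c) x
        + (scalar_curv (g c) x * norm2_sq (g c) (tracefree_ricci (g c)) x
          + 18 * endo_det (g c) (tracefree_ricci (g c)) x) * (V \<circ> chart_inv c) x"
    by (rule bochner_static[OF x])
qed

end
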